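(* Let $Z(x)=\psi(x,\theta^* )$, $x\in\mathcal X\subset\mathbb R^d$, with $\theta^*\in\mathbb R^m$, and let $x^*$ be an optimal solution to $\min_{x\in\mathcal X}Z(x)$. Let $\hat\theta_n$ be an estimator obtained from i.i.d. data $\xi_1,\ldots,\xi_n\sim P$ with empirical distribution $\hat P_n$, let $R:\mathbb R^d\to\mathbb R$, and let $$\hat x_n^{P-EO}\in\text{argmin}_{x\in\mathcal X}\psi(x,\hat\theta_n),\qquad \hat x_n^{P-Reg,\lambda}\in\text{argmin}_{x\in\mathcal X}\{\psi(x,\hat\theta_n)+\lambda R(x)\}.$$ Assume: (A) $\nabla_x\psi(x^*,\theta^* )=0$; $\nabla_x\psi(\cdot,\cdot):\mathbb R^{d+m}\to\mathbb R^d$ is continuously differentiable at $(x^*,\theta^* )$; and the Hessian $\nabla_x^2\psi(x^*,\theta^* )$ is invertible. (B) $R$ is twice continuously differentiable. (C) $\hat\theta_n-\theta^*=\langle IF_\theta,\hat P_n-P\rangle+o_p\left(\frac1{\sqrt n}\right)$ for some $IF_\theta:\Xi\to\mathbb R^m$ with $Cov_P(IF_\theta(\xi))$ finite. Then $$\hat x_n^{P-Reg,\lambda}-x^*=-\langle(\nabla_x^2\psi(x^*,\theta^* ))^{-1}\nabla_{x\theta}\psi(x^*,\theta^* )IF_\theta,\hat P_n-P\rangle-\lambda(\nabla_x^2\psi(x^*,\theta^* ))^{-1}\nabla_xR(x^* )+o_p\left(\frac{1}{\sqrt n}+|\lambda|\right)$$ as $n\to\infty$ and $\lambda\to0$. Hence,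 if in addition $Z$ is twice differentiable with $\nabla Z(x^* )=0$ and $\nabla^2Z(x^* )$ positive semidefinite, and $K^\top\nabla^2Z(x^* )K\ne0$ for $K=-(\nabla_x^2\psi(x^*,\theta^* ))^{-1}\nabla_xR(x^* )$, then $n\mathcal G(\hat x_n^{P-EO})$ is asymptotically second-order stochastically dominated by $n\mathcal G(\hat x_n^{P-Reg,\lambda_n})$ for any $\lambda_n\to0$, where $\mathcal G(x)=Z(x)-Z(x^* )$.
   Context: $\theta^*$ is the true parameter value of a parametric model for the distribution $P$ of $\xi\in\Xi$ (or, if the model is misspecified, the minimizer of the Kullback-Leibler divergence between the true model and the model class). $\nabla_x\in\mathbb R^d$ and $\nabla_x^2\in\mathbb R^{d\times d}$ denote the gradient and Hessian with respect to $x$, and $\nabla_{x\theta}\in\mathbb R^{d\times m}$ the matrix of cross-derivatives with respect to $x$ and $\theta$. The dimensions $d,m$ are fixed. For a function $f$ on $\Xi$, $\langle f,\hat P_n-P\rangle:=\int f\,d(\hat P_n-P)=\frac1n\sum_{i=1}^nf(\xi_i)-E_P[f(\xi)]$. $o_p(b_n)$ denotes a random quantity whose ratio to $b_n$ tends to $0$ in probability. Second-order stochastic dominance (for losses): for random variables $A,B$, $A$ is second-order stochastically dominated by $B$ if $E[u(A)]\le E[u(B)]$ for every non-decreasing convex $u:\mathbb R\to\mathbb R$. Asymptotic version: a real-valued random sequence $A_n$ is asymptotically second-order stochastically dominated by $B_n$ if $A_n\Rightarrow W_0$ and $B_n\Rightarrow W_1$ (weak convergence) with $W_0$ second-order stochastically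 dominated by $W_1$ or, more generally, if for any subsequences $n_{k_0},n_{k_1}\to\infty$ such that $A_{n_{k_0}}$ and $B_{n_{k_1}}$ have weak limits $W_0$ and $W_1$ respectively, $W_0$ is second-order stochastically dominated by $W_1$. Weak limits are allowed to be $\pm\infty$, meaning convergence in probability to $\pm\infty$; a limit $W_1=+\infty$ is regarded as dominating every $W_0$.
   Formalization: Added assumptions, without which the claim fails: x* lies in the interior of X, and both the regularized solution (as n→∞, λ→0) and the P-EO solution converge to x* in probability. *)

theory Defs
  imports "HOL-Probability.Probability"
begin

definition gradient :: "(real^'d \<Rightarrow> real) \<Rightarrow> real^'d \<Rightarrow> real^'d" where
  "gradient f x = (\<chi> i. frechet_derivative f (at x) (axis i 1))"

definition hessian :: "(real^'d \<Rightarrow> real) \<Rightarrow> real^'d \<Rightarrow> real^'d^'d" where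
  "hessian f x = jacobian (gradient f) (at x)"

text \<open>The entry in row \<open>i\<close> and column \<open>j\<close> is the derivative in \<open>\<theta>\<^sub>j\<close> of the partial
  derivative of \<open>\<psi>\<close> in \<open>x\<^sub>i\<close>.\<close>

definition cross_derivative ::
    "(real^'d \<Rightarrow> real^'m \<Rightarrow> real) \<Rightarrow> real^'d \<Rightarrow> real^'m \<Rightarrow> real^'m^'d" where
  "cross_derivative \<psi> x \<theta> = jacobian (\<lambda>t. gradient (\<lambda>y. \<psi> y t) x) (at \<theta>)"

text \<open>Continuous differentiability at a single point: the derivative exists on a neighbourhood
  and is continuous at the point.\<close>

definition cont_diff_at :: "('a::real_normed_vector \<Rightarrow> 'b::real_normed_vector) \<Rightarrow> 'a \<Rightarrow> bool" where
  "cont_diff_at f a \<longleftrightarrow>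
     (\<exists>f'. (\<forall>\<^sub>F x in nhds a. (f has_derivative blinfun_apply (f' x)) (at x)) \<and> isCont f' a)"

definition twice_differentiable_at :: "(real^'d \<Rightarrow> real) \<Rightarrow> real^'d \<Rightarrow> bool" where
  "twice_differentiable_at f x \<longleftrightarrow>
     (\<forall>\<^sub>F y in nhds x. f differentiable (at y)) \<and> gradient f differentiable (at x)"

definition twice_cont_diff :: "(real^'d \<Rightarrow> real) \<Rightarrow> bool" where
  "twice_cont_diff f \<longleftrightarrow> (\<forall>x. twice_differentiable_at f x) \<and> continuous_on UNIV (hessian f)"

text \<open>The pairing of \<open>f\<close> with the difference of the empirical distribution of
  \<open>\<xi> 0, \<dots>, \<xi> (n - 1)\<close> and \<open>P\<close>.\<close>

definition emp_dev ::
    "'x measure \<Rightarrow> (nat \<Rightarrow> 'w \<Rightarrow> 'x) \<Rightarrow> nat \<Rightarrow> ('x \<Rightarrow> 'v::{banach, second_countable_topology}) \<Rightarrow> 'w \<Rightarrow> 'v"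
  where "emp_dev P \<xi> n f \<omega> = (1 / real n) *\<^sub>R (\<Sum>i<n. f (\<xi> i \<omega>)) - (\<integral>z. f z \<partial>P)"

definition iid_sample :: "'w measure \<Rightarrow> 'x measure \<Rightarrow> (nat \<Rightarrow> 'w \<Rightarrow> 'x) \<Rightarrow> bool" where
  "iid_sample M P \<xi> \<longleftrightarrow>
     prob_space.indep_vars M (\<lambda>_. P) \<xi> UNIV \<and> (\<forall>i. distr M P (\<xi> i) = P)"

text \<open>The expectation, and every entry of the covariance matrix, exists and is finite.\<close>

definition finite_covariance :: "'x measure \<Rightarrow> ('x \<Rightarrow> real^'m) \<Rightarrow> bool" where
  "finite_covariance P f \<longleftrightarrow> integrable P f \<and>
     (\<forall>i j. integrable P (\<lambda>z. (f z - (\<integral>y. f y \<partial>P)) $ i * (f z - (\<integral>y. f y \<partial>P)) $ j))"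

text \<open>\<open>Y = o\<^sub>p(b)\<close> along an arbitrary filter on the index type, so that a limit in
  \<open>n \<longrightarrow> \<infinity>\<close> and a joint limit in \<open>n \<longrightarrow> \<infinity>, \<lambda> \<longrightarrow> 0\<close> are covered alike; with \<open>b = 1\<close> it is
  convergence to 0 in probability.\<close>

definition small_o_p ::
    "'w measure \<Rightarrow> ('i \<Rightarrow> 'w \<Rightarrow> 'v::real_normed_vector) \<Rightarrow> ('i \<Rightarrow> real) \<Rightarrow> 'i filter \<Rightarrow> bool" where
  "small_o_p M Y b F \<longleftrightarrow>
     (\<forall>\<epsilon>>0. ((\<lambda>i. measure M {\<omega> \<in> space M. norm (Y i \<omega> /\<^sub>R b i) > \<epsilon>}) \<longlongrightarrow> 0) F)"

text \<open>The expectation of \<open>u\<close> under \<open>W\<close> as an extended real. It is meaningful if at most one of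
  the positive and the negative part has an infinite integral.\<close>

definition has_ext_expectation :: "real measure \<Rightarrow> (real \<Rightarrow> real) \<Rightarrow> bool" where
  "has_ext_expectation W u \<longleftrightarrow>
     (\<integral>\<^sup>+x. ennreal (u x) \<partial>W) < \<infinity> \<or> (\<integral>\<^sup>+x. ennreal (- u x) \<partial>W) < \<infinity>"

definition ext_expectation :: "real measure \<Rightarrow> (real \<Rightarrow> real) \<Rightarrow> ereal" where
  "ext_expectation W u =
     enn2ereal (\<integral>\<^sup>+x. ennreal (u x) \<partial>W) - enn2ereal (\<integral>\<^sup>+x. ennreal (- u x) \<partial>W)"

text \<open>Dominance depends only on the laws of the two random variables, and is defined on laws.\<close>

definition ssd :: "real measure \<Rightarrow> real measure \<Rightarrow> bool" where
  "ssd W0 W1 \<longleftrightarrow> (\<forall>u. mono u \<and> convex_on UNIV u \<longrightarrow>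
     has_ext_expectation W0 u \<and> has_ext_expectation W1 u \<and>
     ext_expectation W0 u \<le> ext_expectation W1 u)"

datatype weak_limit = Law "real measure" | Plus_Inf | Minus_Inf

primrec weakly_to :: "'w measure \<Rightarrow> (nat \<Rightarrow> 'w \<Rightarrow> real) \<Rightarrow> weak_limit \<Rightarrow> bool" where
  "weakly_to M A (Law W) \<longleftrightarrow>
     real_distribution W \<and> weak_conv_m (\<lambda>n. distr M borel (A n)) W"
| "weakly_to M A Plus_Inf \<longleftrightarrow>
     (\<forall>c. (\<lambda>n. measure M {\<omega> \<in> space M. A n \<omega> > c}) \<longlonglongrightarrow> 1)"
| "weakly_to M A Minus_Inf \<longleftrightarrow>
     (\<forall>c. (\<lambda>n. measure M {\<omega> \<in> space M. A n \<omega> < c}) \<longlonglongrightarrow> 1)"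

text \<open>The limit \<open>+\<infinity>\<close> dominates everything; symmetrically \<open>-\<infinity>\<close> is dominated by everything.\<close>

fun limit_ssd :: "weak_limit \<Rightarrow> weak_limit \<Rightarrow> bool" where
  "limit_ssd _ Plus_Inf \<longleftrightarrow> True"
| "limit_ssd Minus_Inf _ \<longleftrightarrow> True"
| "limit_ssd (Law W0) (Law W1) \<longleftrightarrow> ssd W0 W1"
| "limit_ssd _ _ \<longleftrightarrow> False"

text \<open>If the full sequences have weak limits, these are the only subsequential limits, so this
  also covers the case in which the limit of \<open>A\<close> is dominated by the limit of \<open>B\<close>.\<close>

definition asymptotically_ssd ::
    "'w measure \<Rightarrow> (nat \<Rightarrow> 'w \<Rightarrow> real) \<Rightarrow> (nat \<Rightarrow> 'w \<Rightarrow> real) \<Rightarrow> bool" where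
  "asymptotically_ssd M A B \<longleftrightarrow>
     (\<forall>r s W0 W1. strict_mono r \<and> strict_mono s \<and> weakly_to M (A \<circ> r) W0 \<and> weakly_to M (B \<circ> s) W1
        \<longrightarrow> limit_ssd W0 W1)"

end

theory Submission
  imports Defs
begin

text \<open>
  Linearising the first-order condition gives the deterministic expansion of the minimiser in
  \<open>\<theta> - \<theta>s\<close> and \<open>l\<close>; tightness of \<open>S n = \<surd>n \<langle>IF, P\<^sub>n - P\<rangle>\<close> turns it into the stochastic one.

  For the dominance, pass to a subsequence of \<open>n\<close> along which \<open>\<surd>n l n\<close> converges to some \<open>c\<close> or
  diverges. If it diverges, then \<open>n \<G>\<close> of the regularised solution diverges too, because
  \<open>q K > 0\<close> for the quadratic form \<open>q v = v \<bullet> H v / 2\<close>. Otherwise the two limit laws are those of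
  \<open>q(A Y)\<close> and \<open>q(A Y + c K)\<close>, where \<open>Y\<close> is the Gaussian limit of \<open>S n\<close>. As \<open>q(a) \<le> (q(a + b) + q(a - b)) / 2\<close>
  and \<open>Y\<close> and \<open>-Y\<close> have the same law, \<open>E u(q(A Y)) \<le> E u(q(A Y + c K))\<close> for non-decreasing convex \<open>u\<close>.

  The Gaussian vector \<open>Y\<close> is never constructed: all that is needed is that \<open>E h(S n)\<close> and \<open>E h(- S n)\<close>
  have a common limit for continuous \<open>h\<close> of compact support. For trigonometric \<open>h\<close> this is the
  one-dimensional central limit theorem, and the general case follows by Stone--Weierstrass and tightness.
\<close>

subsection \<open>Gradients, Hessians and first-order conditions\<close>

text \<open>All smoothness assumptions on \<open>\<psi>\<close> are local at
  \<open>(xs, \<theta>s)\<close>, whereas the minimisers are global over \<open>\<X>\<close>.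
  Consistency brings them close to \<open>xs\<close> in probability, and \<open>xs\<close> being
  interior then turns optimality into a first-order condition.

  Two obstacles shape the dominance argument. The subsequences \<open>r\<close> and \<open>s\<close>
  in its definition are unrelated, so the two excesses cannot be compared at equal sample sizes; the
  comparison has to pass through limits of \<open>E h(S n)\<close> along the whole sequence, which
  every subsequence inherits. Moreover \<open>u\<close> is unbounded, whereas weak convergence
  speaks about bounded test functions only. Truncating \<open>u\<close> from above destroys
  convexity. Hence, where convexity is used, the cutoff is put on the argument \<open>S\<close>, and
  truncations lying below \<open>u\<close> (shifted to be nonnegative) appear only where weak limits
  are evaluated.\<close>

lemma has_derivative_gradient:
  assumes "f differentiable (at x)"
  shows "(f has_derivative (\<lambda>h. gradient f x \<bullet> h)) (at x)"
proof -
  let ?f' = "frechet_derivative f (at x)"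
  have d: "(f has_derivative ?f') (at x)"
    using assms frechet_derivative_works by blast
  then interpret linear ?f' by (rule has_derivative_linear)
  have "?f' h = gradient f x \<bullet> h" for h
  proof -
    have "?f' h = ?f' (\<Sum>i\<in>UNIV. h $ i *\<^sub>R axis i 1)"
      using basis_expansion[of h] by (simp add: scalar_mult_eq_scaleR)
    also have "\<dots> = gradient f x \<bullet> h"
      by (simp add: sum scaleR gradient_def inner_vec_def mult.commute)
    finally show ?thesis .
  qed
  then show ?thesis using d by (metis (no_types, lifting) ext)
qed

lemma has_derivative_hessian:
  assumes "gradient f differentiable (at x)"
  shows "(gradient f has_derivative (\<lambda>h. hessian f x *v h)) (at x)"
  using assms unfolding hessian_def jacobian_works .

text \<open>The gradient is only known to be differentiable at the single point \<open>x\<close>.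
  The mean value theorem is therefore applied once, to \<open>f (x + t v)\<close> minus its
  quadratic model: the derivative in \<open>t\<close> is
  \<open>(gradient f (x + t v) - H (t v)) \<bullet> v\<close>, and differentiability of the gradient
  bounds it by \<open>\<epsilon> * norm (t v) * norm v\<close>.\<close>

lemma second_order_expansion:
  fixes f :: "real^'d \<Rightarrow> real"
  assumes f: "twice_differentiable_at f x" and grad0: "gradient f x = 0" and "\<epsilon> > 0"
  obtains \<eta> where "\<eta> > 0" and "\<And>v. norm v < \<eta> \<Longrightarrow>
    \<bar>f (x + v) - f x - v \<bullet> (hessian f x *v v) / 2\<bar> \<le> \<epsilon> * (norm v)\<^sup>2"
proof -
  have "\<forall>\<^sub>F y in nhds x. f differentiable (at y)"
    using f by (simp add: twice_differentiable_at_def)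
  then obtain d1 where d1: "d1 > 0" "\<And>y. dist y x < d1 \<Longrightarrow> f differentiable (at y)"
    by (auto simp: eventually_nhds_metric)
  have "(gradient f has_derivative (\<lambda>h. hessian f x *v h)) (at x)"
    using f by (intro has_derivative_hessian) (simp add: twice_differentiable_at_def)
  then obtain d2 where d2: "d2 > 0"
    "\<And>y. norm (y - x) < d2 \<Longrightarrow> norm (gradient f y - hessian f x *v (y - x)) \<le> \<epsilon> * norm (y - x)"
    using \<open>\<epsilon> > 0\<close> grad0 unfolding has_derivative_at_alt by fastforce
  show ?thesis
  proof (rule that[of "min d1 d2"])
    show "min d1 d2 > 0" using d1 d2 by simp
    fix v :: "real^'d" assume v: "norm v < min d1 d2"
    let ?H = "hessian f x"
    define g where "g t = f (x + t *\<^sub>R v) - t\<^sup>2 * (v \<bullet> (?H *v v)) / 2" for t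
    define g' where "g' t = gradient f (x + t *\<^sub>R v) \<bullet> v - t * (v \<bullet> (?H *v v))" for t
    have small: "norm (t *\<^sub>R v) < min d1 d2" if "0 \<le> t" "t \<le> 1" for t
    proof -
      have "t * norm v \<le> 1 * norm v" using that by (intro mult_right_mono) auto
      then show ?thesis using v that by simp
    qed
    have deriv: "(g has_real_derivative g' t) (at t)" if "0 \<le> t" "t \<le> 1" for t
    proof -
      have "f differentiable (at (x + t *\<^sub>R v))"
        using small[OF that] by (intro d1) (simp add: dist_norm)
      note fd = has_derivative_gradient[OF this]
      have "((\<lambda>t. x + t *\<^sub>R v) has_derivative (\<lambda>h. h *\<^sub>R v)) (at t)"
        by (auto intro!: derivative_eq_intros)
      from diff_chain_at[OF this fd]
      have "((\<lambda>t. f (x + t *\<^sub>R v)) has_real_derivative gradient f (x + t *\<^sub>R v) \<bullet> v) (at t)"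
        by (simp add: has_field_derivative_def o_def mult.commute[of _ "gradient f (x + t *\<^sub>R v) \<bullet> v"])
      then show ?thesis unfolding g_def g'_def
        by (auto intro!: derivative_eq_intros simp: field_simps)
    qed
    obtain t where t: "0 < t" "t < 1" "g 1 - g 0 = (1 - 0) * g' t"
      using MVT2[of 0 1 g g'] deriv by auto
    have "g' t = (gradient f (x + t *\<^sub>R v) - ?H *v (t *\<^sub>R v)) \<bullet> v"
      by (simp add: g'_def inner_diff_left inner_diff_right matrix_vector_mult_scaleR inner_commute)
    then have "\<bar>g' t\<bar> \<le> norm (gradient f (x + t *\<^sub>R v) - ?H *v (t *\<^sub>R v)) * norm v"
      by (simp add: Cauchy_Schwarz_ineq2)
    also have "\<dots> \<le> (\<epsilon> * norm (t *\<^sub>R v)) * norm v"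
      using d2(2)[of "x + t *\<^sub>R v"] small[of t] t by (intro mult_right_mono) auto
    also have "\<dots> = t * (\<epsilon> * (norm v)\<^sup>2)" using t by (simp add: power2_eq_square)
    also have "\<dots> \<le> 1 * (\<epsilon> * (norm v)\<^sup>2)" using t \<open>\<epsilon> > 0\<close> by (intro mult_right_mono) auto
    finally show "\<bar>f (x + v) - f x - v \<bullet> (?H *v v) / 2\<bar> \<le> \<epsilon> * (norm v)\<^sup>2"
      using t(3) by (simp add: g_def)
  qed
qed

text \<open>The Hessian and the cross derivative are defined from the partial maps. Composing the
  total derivative \<open>D\<close> with the two slices \<open>(x, b)\<close> and
  \<open>(a, t)\<close> and using uniqueness of derivatives identifies them with the blocks of
  \<open>D\<close>.\<close>

lemma has_derivative_gradient_joint: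
  fixes \<psi> :: "real^'d \<Rightarrow> real^'m \<Rightarrow> real"
  assumes "cont_diff_at (\<lambda>(x, \<theta>). gradient (\<lambda>y. \<psi> y \<theta>) x) (a, b)"
  shows "((\<lambda>(x, \<theta>). gradient (\<lambda>y. \<psi> y \<theta>) x) has_derivative
    (\<lambda>(h, k). hessian (\<lambda>x. \<psi> x b) a *v h + cross_derivative \<psi> a b *v k)) (at (a, b))"
proof -
  let ?g = "\<lambda>(x, \<theta>). gradient (\<lambda>y. \<psi> y \<theta>) x"
  obtain D where D: "(?g has_derivative blinfun_apply D) (at (a, b))"
    using assms unfolding cont_diff_at_def by (blast dest: eventually_nhds_x_imp_x)
  have "((\<lambda>x. (x, b)) has_derivative (\<lambda>h. (h, 0))) (at a)"
    by (auto intro!: derivative_eq_intros)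
  from diff_chain_at[OF this D]
  have 1: "(gradient (\<lambda>y. \<psi> y b) has_derivative (\<lambda>h. D (h, 0))) (at a)"
    by (simp add: o_def)
  then have "(gradient (\<lambda>y. \<psi> y b) has_derivative (\<lambda>h. hessian (\<lambda>x. \<psi> x b) a *v h)) (at a)"
    by (intro has_derivative_hessian) (auto simp: differentiable_def)
  with 1 have H: "D (h, 0) = hessian (\<lambda>x. \<psi> x b) a *v h" for h
    by (metis has_derivative_unique)
  have "((\<lambda>t. (a, t)) has_derivative (\<lambda>k. (0, k))) (at b)"
    by (auto intro!: derivative_eq_intros)
  from diff_chain_at[OF this D]
  have 2: "((\<lambda>t. gradient (\<lambda>y. \<psi> y t) a) has_derivative (\<lambda>k. D (0, k))) (at b)"
    by (simp add: o_def)
  then have "((\<lambda>t. gradient (\<lambda>y. \<psi> y t) a) has_derivative (\<lambda>k. cross_derivative \<psi> a b *v k)) (at b)"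
    unfolding cross_derivative_def by (subst jacobian_works[symmetric]) (auto simp: differentiable_def)
  with 2 have C: "D (0, k) = cross_derivative \<psi> a b *v k" for k
    by (metis has_derivative_unique)
  have "D (h, k) = D (h, 0) + D (0, k)" for h k
    by (simp add: blinfun.add_right[symmetric])
  then have "blinfun_apply D = (\<lambda>(h, k). hessian (\<lambda>x. \<psi> x b) a *v h + cross_derivative \<psi> a b *v k)"
    by (auto simp: H C)
  with D show ?thesis by simp
qed

lemma gradient_zero_at_interior_argmin:
  fixes f g :: "real^'d \<Rightarrow> real"
  assumes min: "is_arg_min (\<lambda>y. f y + l * g y) (\<lambda>y. y \<in> X) x" and x: "x \<in> interior X"
    and f: "f differentiable (at x)" and g: "g differentiable (at x)"
  shows "gradient f x + l *\<^sub>R gradient g x = 0"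
proof -
  have "((\<lambda>y. f y + l * g y) has_derivative (\<lambda>h. gradient f x \<bullet> h + l * (gradient g x \<bullet> h))) (at x)"
    by (intro derivative_intros has_derivative_gradient f g)
  moreover have "\<forall>\<^sub>F y in at x. f x + l * g x \<le> f y + l * g y"
  proof -
    have "\<forall>\<^sub>F y in nhds x. y \<in> interior X" using x by (intro eventually_nhds_in_open) auto
    then have "\<forall>\<^sub>F y in at x. y \<in> interior X" by (rule eventually_nhds_conv_at[THEN iffD1, THEN conjunct1])
    then show ?thesis
      by eventually_elim (use min interior_subset in \<open>force simp: is_arg_min_def not_less\<close>)
  qed
  ultimately have "(\<lambda>h. gradient f x \<bullet> h + l * (gradient g x \<bullet> h)) = (\<lambda>h. 0)"
    by (rule has_derivative_local_min)
  then have "(gradient f x + l *\<^sub>R gradient g x) \<bullet> h = 0" for h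
    by (metis (mono_tags) inner_add_left inner_scaleR_left)
  then show ?thesis by (metis inner_eq_zero_iff)
qed

lemma matrix_vector_bound:
  fixes A :: "real^'n^'m"
  obtains B where "B > 0" "\<And>v. norm (A *v v) \<le> B * norm v"
  using bounded_linear.pos_bounded[OF matrix_vector_mul_bounded_linear[of A]]
  by (metis mult.commute)

text \<open>The first-order condition \<open>\<nabla>\<^sub>x\<psi>(x, \<theta>) + l \<nabla>R(x) = 0\<close> is linearised at \<open>(xs, \<theta>s)\<close> and solved
  for \<open>x - xs\<close>; the resulting bound \<open>\<parallel>x - xs\<parallel> = O(\<parallel>\<theta> - \<theta>s\<parallel> + \<bar>l\<bar>)\<close> is fed back into the
  remainder.\<close>

lemma argmin_expansion:
  fixes \<psi> :: "real^'d \<Rightarrow> real^'m \<Rightarrow> real" and R :: "real^'d \<Rightarrow> real"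
  assumes H: "H = hessian (\<lambda>x. \<psi> x \<theta>s) xs" and C: "C = cross_derivative \<psi> xs \<theta>s"
    and xs: "xs \<in> interior \<X>"
    and stationary: "gradient (\<lambda>x. \<psi> x \<theta>s) xs = 0"
    and diff: "\<forall>\<^sub>F (x, \<theta>) in nhds (xs, \<theta>s). (\<lambda>y. \<psi> y \<theta>) differentiable (at x)"
    and smooth: "cont_diff_at (\<lambda>(x, \<theta>). gradient (\<lambda>y. \<psi> y \<theta>) x) (xs, \<theta>s)"
    and inv: "invertible H" and R: "twice_cont_diff R" and "\<epsilon> > 0"
  obtains \<eta> where "\<eta> > 0" and "\<And>x \<theta> l. norm (x - xs) < \<eta> \<Longrightarrow> norm (\<theta> - \<theta>s) < \<eta> \<Longrightarrow>
    is_arg_min (\<lambda>y. \<psi> y \<theta> + l * R y) (\<lambda>y. y \<in> \<X>) x \<Longrightarrow>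
    norm (x - xs + (matrix_inv H ** C) *v (\<theta> - \<theta>s) + l *\<^sub>R (matrix_inv H *v gradient R xs))
      \<le> \<epsilon> * (norm (\<theta> - \<theta>s) + \<bar>l\<bar>)"
proof -
  let ?Hi = "matrix_inv H"
  obtain B where B: "B > 0" "\<And>v. norm (?Hi *v v) \<le> B * norm v"
    using matrix_vector_bound[of ?Hi] by blast
  obtain c where c: "c > 0" "\<And>v. norm (C *v v) \<le> c * norm v"
    using matrix_vector_bound[of C] by blast
  define \<gamma> where "\<gamma> = norm (gradient R xs)"
  \<comment> \<open>The eventual Lipschitz constant for \<open>norm u\<close>: it exceeds both
    coefficients \<open>2 * B * (c + 1)\<close> of \<open>norm k\<close> and
    \<open>2 * B * (\<gamma> + 1)\<close> of \<open>\<bar>l\<bar>\<close> that remain after the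
    absorption below.\<close>
  define D where "D = 2 * B * (c + \<gamma> + 2)"
  have "\<gamma> \<ge> 0" by (simp add: \<gamma>_def)
  then have "D > 0" using B(1) c(1) by (simp add: D_def)
  \<comment> \<open>The tolerance both for linearising the gradient of \<open>\<psi>\<close> and for
    the variation of the gradient of \<open>R\<close>. The bound \<open>e * B \<le> 1/2\<close>
    permits the absorption, and \<open>\<epsilon> / (B * (D + 2))\<close> gives the final
    accuracy.\<close>
  define e where "e = min (min 1 (1 / (2 * B))) (\<epsilon> / (B * (D + 2)))"
  have e: "e > 0" "e \<le> 1" "e * B \<le> 1/2" "B * e * (D + 2) \<le> \<epsilon>"
  proof -
    show "e > 0" using B(1) \<open>D > 0\<close> \<open>\<epsilon> > 0\<close> by (simp add: e_def)
    show "e \<le> 1" by (simp add: e_def)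
    have "e \<le> 1 / (2 * B)" by (simp add: e_def)
    then show "e * B \<le> 1/2" using B(1) by (simp add: field_simps)
    have "e \<le> \<epsilon> / (B * (D + 2))" by (simp add: e_def)
    moreover have "B * (D + 2) > 0" using B(1) \<open>D > 0\<close> by simp
    ultimately have "e * (B * (D + 2)) \<le> \<epsilon>" by (simp only: pos_le_divide_eq)
    then show "B * e * (D + 2) \<le> \<epsilon>" by (simp only: ac_simps)
  qed
  obtain d1 where d1: "d1 > 0" "\<And>x. norm (x - xs) < d1 \<Longrightarrow> x \<in> interior \<X>"
    using xs open_interior[of \<X>] by (auto simp: open_dist dist_norm)
  obtain d2 where d2: "d2 > 0"
    "\<And>x \<theta>. dist (x, \<theta>) (xs, \<theta>s) < d2 \<Longrightarrow> (\<lambda>y. \<psi> y \<theta>) differentiable (at x)"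
    using diff by (force simp: eventually_nhds_metric)
  obtain d3 where d3: "d3 > 0" "\<And>x \<theta>. norm ((x, \<theta>) - (xs, \<theta>s)) < d3 \<Longrightarrow>
      norm (gradient (\<lambda>y. \<psi> y \<theta>) x - (H *v (x - xs) + C *v (\<theta> - \<theta>s)))
        \<le> e * norm ((x, \<theta>) - (xs, \<theta>s))"
    using has_derivative_gradient_joint[OF smooth] e(1) stationary
    unfolding has_derivative_at_alt H C by force
  have Rdiff: "R differentiable (at x)" for x
    using R unfolding twice_cont_diff_def twice_differentiable_at_def
    by (blast dest: eventually_nhds_x_imp_x)
  have "isCont (gradient R) xs"
    using R unfolding twice_cont_diff_def twice_differentiable_at_def
    by (blast intro: differentiable_imp_continuous_within)
  then obtain d4 where d4: "d4 > 0"
    "\<And>x. norm (x - xs) < d4 \<Longrightarrow> norm (gradient R x - gradient R xs) < e"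
    using e(1) unfolding continuous_at_eps_delta dist_norm by blast
  \<comment> \<open>\<open>d2\<close> and \<open>d3\<close> limit the distance of the pair
    \<open>(x, \<theta>)\<close>, which is at most the sum of the two component distances; hence the
    halves.\<close>
  define \<eta> where "\<eta> = min (min d1 (d2/2)) (min (d3/2) d4)"
  show ?thesis
  proof (rule that)
    show "\<eta> > 0" using d1 d2 d3 d4 by (simp add: \<eta>_def)
    fix x \<theta> l
    assume x: "norm (x - xs) < \<eta>" and \<theta>: "norm (\<theta> - \<theta>s) < \<eta>"
      and min: "is_arg_min (\<lambda>y. \<psi> y \<theta> + l * R y) (\<lambda>y. y \<in> \<X>) x"
    define u where "u = x - xs"
    define k where "k = \<theta> - \<theta>s"
    define r where "r = gradient (\<lambda>y. \<psi> y \<theta>) x - (H *v u + C *v k)"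
    define s where "s = gradient R x - gradient R xs"
    have pair: "norm ((x, \<theta>) - (xs, \<theta>s)) \<le> norm u + norm k"
      by (simp add: u_def k_def norm_Pair_le)
    have "x \<in> interior \<X>" using x by (intro d1) (simp add: \<eta>_def)
    moreover have "(\<lambda>y. \<psi> y \<theta>) differentiable (at x)"
      using pair x \<theta> by (intro d2) (simp add: \<eta>_def dist_norm u_def k_def)
    ultimately have foc: "gradient (\<lambda>y. \<psi> y \<theta>) x + l *\<^sub>R gradient R x = 0"
      using min Rdiff by (intro gradient_zero_at_interior_argmin)
    have "norm r \<le> e * norm ((x, \<theta>) - (xs, \<theta>s))"
      unfolding r_def u_def k_def
      using pair x \<theta> by (intro d3) (simp add: \<eta>_def u_def k_def)
    also have "\<dots> \<le> e * (norm u + norm k)"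
      using pair e(1) by (intro mult_left_mono) auto
    finally have r: "norm r \<le> e * (norm u + norm k)" .
    have s: "norm s \<le> e"
      unfolding s_def using d4(2)[of x] x by (simp add: \<eta>_def)
    have Hu: "H *v u = - (C *v k) - l *\<^sub>R gradient R x - r"
      using foc by (simp add: r_def algebra_simps add_eq_0_iff)
    have "?Hi ** H = mat 1" 
    using someI_ex[OF inv[unfolded invertible_def]] by (simp add: matrix_inv_def)
    then have "u = ?Hi *v (H *v u)" by (simp add: matrix_vector_mul_assoc)
    then have u: "u = ?Hi *v (- (C *v k) - l *\<^sub>R gradient R x - r)" by (simp add: Hu)
    have neg: "?Hi *v (- w) = - (?Hi *v w)" for w
      using linear_neg[OF matrix_vector_mul_linear[of ?Hi]] .
    have lin: "u + (?Hi ** C) *v k + l *\<^sub>R (?Hi *v gradient R xs) = - (?Hi *v (r + l *\<^sub>R s))"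
      by (subst u) (simp add: s_def neg matrix_vector_mul_assoc[symmetric] matrix_vector_mult_diff_distrib
          matrix_vector_right_distrib matrix_vector_mult_scaleR algebra_simps)
    have "norm (?Hi *v (r + l *\<^sub>R s)) \<le> B * norm (r + l *\<^sub>R s)" by (rule B)
    also have "\<dots> \<le> B * (e * (norm u + norm k) + \<bar>l\<bar> * e)"
      using r s B(1) by (intro mult_left_mono order.trans[OF norm_triangle_ineq] add_mono)
        (auto intro: mult_left_mono)
    finally have rem: "norm (u + (?Hi ** C) *v k + l *\<^sub>R (?Hi *v gradient R xs))
        \<le> B * (e * (norm u + norm k) + \<bar>l\<bar> * e)"
      by (simp add: lin)
    \<comment> \<open>The remainder contains \<open>norm u\<close> itself. Its coefficient is
      \<open>e * B \<le> 1/2\<close>, so it can be moved to the left-hand side.\<close>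
    have main: "norm u \<le> D * (norm k + \<bar>l\<bar>)"
    proof -
      have "norm u \<le> norm (u + (?Hi ** C) *v k + l *\<^sub>R (?Hi *v gradient R xs))
          + norm ((?Hi ** C) *v k) + norm (l *\<^sub>R (?Hi *v gradient R xs))"
      proof -
        have "norm u \<le> norm (u + a + b) + norm a + norm b" for a b :: "real^'d" by norm
        then show ?thesis .
      qed
      also have "\<dots> \<le> B * (e * (norm u + norm k) + \<bar>l\<bar> * e) + B * (c * norm k) + \<bar>l\<bar> * (B * \<gamma>)"
      proof (intro add_mono rem)
        show "norm ((?Hi ** C) *v k) \<le> B * (c * norm k)"
          using B c order.trans[OF B(2) mult_left_mono[OF c(2)]]
          by (simp add: matrix_vector_mul_assoc[symmetric])
        show "norm (l *\<^sub>R (?Hi *v gradient R xs)) \<le> \<bar>l\<bar> * (B * \<gamma>)"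
          using B(2) by (auto simp: \<gamma>_def intro: mult_left_mono)
      qed
      also have "\<dots> = (e * B) * norm u + (e * B) * norm k + (e * B) * \<bar>l\<bar> + B * c * norm k + B * \<gamma> * \<bar>l\<bar>"
        by (simp add: algebra_simps)
      also have "\<dots> \<le> (1/2) * norm u + (1 * B) * norm k + (1 * B) * \<bar>l\<bar> + B * c * norm k + B * \<gamma> * \<bar>l\<bar>"
        using e B(1) c(1) \<open>\<gamma> \<ge> 0\<close> by (intro add_mono mult_right_mono) auto
      finally have "norm u \<le> 2 * (B * norm k + B * \<bar>l\<bar> + B * c * norm k + B * \<gamma> * \<bar>l\<bar>)"
        by simp
      also have "\<dots> \<le> 2 * (B * norm k + B * \<bar>l\<bar> + B * c * norm k + B * \<gamma> * \<bar>l\<bar>)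
          + 2 * (B * norm k + B * \<gamma> * norm k + B * \<bar>l\<bar> + B * c * \<bar>l\<bar>)"
        using B c \<open>\<gamma> \<ge> 0\<close> by simp
      also have "\<dots> = D * (norm k + \<bar>l\<bar>)" by (simp add: D_def algebra_simps)
      finally show ?thesis .
    qed
    have "B * (e * (norm u + norm k) + \<bar>l\<bar> * e)
        \<le> B * (e * (D * (norm k + \<bar>l\<bar>) + (norm k + \<bar>l\<bar>)) + (norm k + \<bar>l\<bar>) * e)"
      using main e(1) B(1) by (intro mult_left_mono add_mono mult_right_mono) auto
    also have "\<dots> = B * e * (D + 2) * (norm k + \<bar>l\<bar>)" by (simp add: algebra_simps)
    also have "\<dots> \<le> \<epsilon> * (norm k + \<bar>l\<bar>)" using e(4) by (intro mult_right_mono) auto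
    finally show "norm (x - xs + (?Hi ** C) *v (\<theta> - \<theta>s) + l *\<^sub>R (?Hi *v gradient R xs))
      \<le> \<epsilon> * (norm (\<theta> - \<theta>s) + \<bar>l\<bar>)"
      using rem by (simp add: u_def k_def)
  qed
qed

subsection \<open>Events of high probability\<close>

context prob_space
begin

text \<open>Bad events are covered by a measurable \<open>B\<close>, so that \<open>Q\<close> itself need not be measurable.\<close>

definition whp :: "real \<Rightarrow> 'i filter \<Rightarrow> ('i \<Rightarrow> 'a \<Rightarrow> bool) \<Rightarrow> bool" where
  "whp \<delta> F Q \<longleftrightarrow> (\<forall>\<^sub>F i in F. \<exists>B\<in>events. prob B \<le> \<delta> \<and> (\<forall>\<omega>\<in>space M - B. Q i \<omega>))"

lemma whp_mono:
  assumes "whp \<delta> F Q" and "\<forall>\<^sub>F i in F. \<forall>\<omega>\<in>space M. Q i \<omega> \<longrightarrow> Q' i \<omega>"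
  shows "whp \<delta> F Q'"
  using assms unfolding whp_def by eventually_elim fastforce

lemma whp_conj:
  assumes "whp a F Q" and "whp b F Q'"
  shows "whp (a + b) F (\<lambda>i \<omega>. Q i \<omega> \<and> Q' i \<omega>)"
  using assms unfolding whp_def
proof eventually_elim
  case (elim i)
  then obtain B B' where B: "B \<in> events" "prob B \<le> a" "\<forall>\<omega>\<in>space M - B. Q i \<omega>"
    and B': "B' \<in> events" "prob B' \<le> b" "\<forall>\<omega>\<in>space M - B'. Q' i \<omega>" by blast
  have "prob (B \<union> B') \<le> a + b"
    using measure_Un_le[OF B(1) B'(1)] B B' by linarith
  with B B' show ?case by (intro bexI[of _ "B \<union> B'"]) auto
qed

lemma whp_filterlim:
  "whp \<delta> F Q \<Longrightarrow> filterlim f F G \<Longrightarrow> whp \<delta> G (\<lambda>i. Q (f i))"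
  unfolding whp_def by (rule eventually_compose_filterlim)

text \<open>Measurability of \<open>Y i\<close> makes the deviation event its own measurable cover.
  It matters because \<open>measure\<close> is 0 on a non-measurable set, so
  \<open>small_o_p\<close> would say nothing about a non-measurable event.\<close>

lemma small_o_p_imp_whp:
  fixes Y :: "'i \<Rightarrow> 'a \<Rightarrow> 'v::{real_normed_vector, second_countable_topology}"
  assumes "small_o_p M Y b F" and ev: "\<forall>\<^sub>F i in F. Y i \<in> borel_measurable M \<and> b i > 0"
    and "\<epsilon> > 0" "\<delta> > 0"
  shows "whp \<delta> F (\<lambda>i \<omega>. norm (Y i \<omega>) \<le> \<epsilon> * b i)"
proof -
  have "((\<lambda>i. prob {\<omega> \<in> space M. norm (Y i \<omega> /\<^sub>R b i) > \<epsilon>}) \<longlongrightarrow> 0) F"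
    using assms by (simp add: small_o_p_def)
  then have "\<forall>\<^sub>F i in F. prob {\<omega> \<in> space M. norm (Y i \<omega> /\<^sub>R b i) > \<epsilon>} < \<delta>"
    using \<open>\<delta> > 0\<close> by (rule order_tendstoD(2))
  with ev show ?thesis unfolding whp_def
  proof eventually_elim
    case (elim i)
    then have [measurable]: "Y i \<in> borel_measurable M" and "b i > 0" by auto
    show ?case
      using elim \<open>b i > 0\<close>
      by (intro bexI[of _ "{\<omega> \<in> space M. norm (Y i \<omega> /\<^sub>R b i) > \<epsilon>}"])
        (auto simp: field_simps not_less)
  qed
qed

text \<open>The deviation event lies inside the bad set \<open>B\<close>, and \<open>measure\<close>
  is monotone as soon as the larger set is measurable. Half of \<open>\<delta>\<close> yields the
  strict inequality.\<close>

lemma whp_imp_small_o_p: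
  assumes whp: "\<And>\<epsilon> \<delta>. \<epsilon> > 0 \<Longrightarrow> \<delta> > 0 \<Longrightarrow> whp \<delta> F (\<lambda>i \<omega>. norm (Y i \<omega>) \<le> \<epsilon> * b i)"
    and ev: "\<forall>\<^sub>F i in F. b i > 0"
  shows "small_o_p M Y b F"
  unfolding small_o_p_def
proof (intro allI impI tendstoI)
  fix \<epsilon> \<delta> :: real assume "\<epsilon> > 0" "\<delta> > 0"
  then have "whp (\<delta> / 2) F (\<lambda>i \<omega>. norm (Y i \<omega>) \<le> \<epsilon> * b i)" by (intro whp) auto
  then show "\<forall>\<^sub>F i in F. dist (prob {\<omega> \<in> space M. norm (Y i \<omega> /\<^sub>R b i) > \<epsilon>}) 0 < \<delta>"
    using ev unfolding whp_def
  proof eventually_elim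
    case (elim i)
    then obtain B where B: "B \<in> events" "prob B \<le> \<delta> / 2" "\<forall>\<omega>\<in>space M - B. norm (Y i \<omega>) \<le> \<epsilon> * b i"
      by blast
    have "{\<omega> \<in> space M. norm (Y i \<omega> /\<^sub>R b i) > \<epsilon>} \<subseteq> B"
      using B(3) elim(2) by (force simp: field_simps not_less)
    then have "prob {\<omega> \<in> space M. norm (Y i \<omega> /\<^sub>R b i) > \<epsilon>} \<le> prob B"
      using B(1) by (rule finite_measure_mono)
    with B(2) \<open>\<delta> > 0\<close> show ?case by simp
  qed
qed

lemma whp_prob_le:
  assumes "whp \<delta> F Q"
  shows "\<forall>\<^sub>F i in F. prob {\<omega> \<in> space M. \<not> Q i \<omega>} \<le> \<delta>"
  using assms unfolding whp_def
proof eventually_elim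
  case (elim i)
  then obtain B where B: "B \<in> events" "prob B \<le> \<delta>" "\<forall>\<omega>\<in>space M - B. Q i \<omega>" by blast
  then have "prob {\<omega> \<in> space M. \<not> Q i \<omega>} \<le> prob B" by (intro finite_measure_mono) auto
  with B show ?case by simp
qed

text \<open>Pointwise \<open>f i \<le> c + B * indicator E\<close> for the bad event
  \<open>E\<close>: off \<open>E\<close> by assumption, on \<open>E\<close> because of the bound
  \<open>B\<close> and \<open>c \<ge> 0\<close>.\<close>

lemma expectation_le_whp:
  fixes f :: "'i \<Rightarrow> 'a \<Rightarrow> real"
  assumes whp: "whp \<delta> F (\<lambda>i \<omega>. f i \<omega> \<le> c)" and f: "\<And>i. f i \<in> borel_measurable M"
    and bd: "\<And>i \<omega>. \<bar>f i \<omega>\<bar> \<le> B" and "c \<ge> 0"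
  shows "\<forall>\<^sub>F i in F. expectation (f i) \<le> c + B * \<delta>"
  using whp unfolding whp_def
proof eventually_elim
  case (elim i)
  then obtain E where E: "E \<in> events" "prob E \<le> \<delta>" "\<forall>\<omega>\<in>space M - E. f i \<omega> \<le> c" by blast
  have "B \<ge> 0" using bd[of i undefined] by linarith
  have intE: "integrable M (indicator E :: 'a \<Rightarrow> real)"
    using E by (intro integrable_real_indicator) (auto simp: less_top[symmetric])
  have "expectation (f i) \<le> expectation (\<lambda>\<omega>. c + B * indicator E \<omega>)"
  proof (rule integral_mono)
    show "integrable M (f i)"
      by (rule integrable_const_bound[of _ B]) (use bd f in auto)
    show "integrable M (\<lambda>\<omega>. c + B * indicator E \<omega>)"
      using intE by auto
    fix \<omega> assume "\<omega> \<in> space M"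
    then show "f i \<omega> \<le> c + B * indicator E \<omega>"
      using E(3) bd[of i \<omega>] \<open>c \<ge> 0\<close> by (cases "\<omega> \<in> E") auto
  qed
  also have "\<dots> = c + B * prob E"
    using E intE prob_space by (subst Bochner_Integration.integral_add) auto
  also have "\<dots> \<le> c + B * \<delta>"
    using E \<open>B \<ge> 0\<close> by (intro add_left_mono mult_left_mono) auto
  finally show ?case .
qed

text \<open>A Slutsky argument: uniform continuity of \<open>h\<close> carries closeness in
  probability over to \<open>h (X i)\<close> and \<open>h (Y i)\<close>, and on the exceptional
  event the difference is at most \<open>2 * B\<close>. Plain continuity would not do, since nothing
  confines \<open>X\<close> and \<open>Y\<close> to a compact set.\<close>

lemma expectation_diff_tendsto_0:
  fixes h :: "real \<Rightarrow> real" and X Y :: "'i \<Rightarrow> 'a \<Rightarrow> real"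
  assumes h: "uniformly_continuous_on UNIV h" and bd: "\<And>x. \<bar>h x\<bar> \<le> B"
    and X[measurable]: "\<And>i. X i \<in> borel_measurable M"
    and Y[measurable]: "\<And>i. Y i \<in> borel_measurable M"
    and close: "\<And>\<epsilon> \<delta>. \<epsilon> > 0 \<Longrightarrow> \<delta> > 0 \<Longrightarrow> whp \<delta> F (\<lambda>i \<omega>. \<bar>X i \<omega> - Y i \<omega>\<bar> \<le> \<epsilon>)"
  shows "((\<lambda>i. expectation (\<lambda>\<omega>. h (X i \<omega>)) - expectation (\<lambda>\<omega>. h (Y i \<omega>))) \<longlongrightarrow> 0) F"
proof (rule tendstoI)
  fix e :: real assume "e > 0"
  have "B \<ge> 0" using bd[of 0] by linarith
  have [measurable]: "h \<in> borel_measurable borel"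
    by (intro borel_measurable_continuous_onI uniformly_continuous_imp_continuous h)
  from h \<open>e > 0\<close> obtain d where d: "d > 0" "\<And>x y. \<bar>x - y\<bar> < d \<Longrightarrow> \<bar>h x - h y\<bar> < e / 4"
    unfolding uniformly_continuous_on_def dist_real_def
    by (metis UNIV_I abs_minus_commute zero_less_divide_iff zero_less_numeral)
  \<comment> \<open>The summand 1 keeps the denominator positive when \<open>B = 0\<close>.\<close>
  define \<delta> where "\<delta> = (e / 4) / (2 * B + 1)"
  have "\<delta> > 0" using \<open>e > 0\<close> \<open>B \<ge> 0\<close> by (simp add: \<delta>_def)
  have "2 * B * \<delta> \<le> (2 * B + 1) * \<delta>" using \<open>\<delta> > 0\<close> by (simp add: algebra_simps)
  also have "\<dots> = e / 4"
  proof -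
    have "2 * B + 1 \<noteq> 0" using \<open>B \<ge> 0\<close> by linarith
    then show ?thesis unfolding \<delta>_def by (metis nonzero_mult_div_cancel_left times_divide_eq_right)
  qed
  finally have \<delta>: "2 * B * \<delta> \<le> e / 4" .
  have "whp \<delta> F (\<lambda>i \<omega>. \<bar>h (X i \<omega>) - h (Y i \<omega>)\<bar> \<le> e / 4)"
  proof (rule whp_mono[OF close[of "d/2" \<delta>]])
    show "\<forall>\<^sub>F i in F. \<forall>\<omega>\<in>space M. \<bar>X i \<omega> - Y i \<omega>\<bar> \<le> d / 2 \<longrightarrow> \<bar>h (X i \<omega>) - h (Y i \<omega>)\<bar> \<le> e / 4"
      using d by (intro always_eventually) (force intro!: less_imp_le[OF d(2)])
  qed (use d \<open>\<delta> > 0\<close> in auto)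
  then have "\<forall>\<^sub>F i in F. expectation (\<lambda>\<omega>. \<bar>h (X i \<omega>) - h (Y i \<omega>)\<bar>) \<le> e / 4 + 2 * B * \<delta>"
  proof (rule expectation_le_whp)
    show "\<bar>\<bar>h (X i \<omega>) - h (Y i \<omega>)\<bar>\<bar> \<le> 2 * B" for i \<omega>
      using bd[of "X i \<omega>"] bd[of "Y i \<omega>"] by linarith
  qed (use \<open>e > 0\<close> in auto)
  then show "\<forall>\<^sub>F i in F. dist (expectation (\<lambda>\<omega>. h (X i \<omega>)) - expectation (\<lambda>\<omega>. h (Y i \<omega>))) 0 < e"
  proof eventually_elim
    case (elim i)
    have int: "integrable M (\<lambda>\<omega>. h (X i \<omega>))" "integrable M (\<lambda>\<omega>. h (Y i \<omega>))"
      using bd by (auto intro!: integrable_const_bound[of _ B])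
    have "\<bar>expectation (\<lambda>\<omega>. h (X i \<omega>)) - expectation (\<lambda>\<omega>. h (Y i \<omega>))\<bar>
        = \<bar>expectation (\<lambda>\<omega>. h (X i \<omega>) - h (Y i \<omega>))\<bar>"
      using int by simp
    also have "\<dots> \<le> expectation (\<lambda>\<omega>. \<bar>h (X i \<omega>) - h (Y i \<omega>)\<bar>)"
      by (rule integral_abs_bound)
    finally show ?case using elim \<delta> \<open>e > 0\<close> by simp
  qed
qed

text \<open>\<open>X\<close> has a weak limit and \<open>Y\<close> is a surrogate close to it in
  probability. With a scaled excess for \<open>X\<close> and a quadratic function of
  \<open>S\<close> for \<open>Y\<close>, this expresses an arbitrary weak limit of the excess
  through \<open>S\<close>.\<close>

lemma weak_limit_expectation:
  fixes h :: "real \<Rightarrow> real" and X Y :: "nat \<Rightarrow> 'a \<Rightarrow> real"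
  assumes W: "real_distribution W" and conv: "weak_conv_m (\<lambda>n. distr M borel (X n)) W"
    and h: "uniformly_continuous_on UNIV h" and bd: "\<And>x. \<bar>h x\<bar> \<le> B"
    and X: "\<And>n. X n \<in> borel_measurable M" and Y: "\<And>n. Y n \<in> borel_measurable M"
    and close: "\<And>\<epsilon> \<delta>. \<epsilon> > 0 \<Longrightarrow> \<delta> > 0 \<Longrightarrow> whp \<delta> sequentially (\<lambda>n \<omega>. \<bar>X n \<omega> - Y n \<omega>\<bar> \<le> \<epsilon>)"
  shows "(\<lambda>n. expectation (\<lambda>\<omega>. h (Y n \<omega>))) \<longlonglongrightarrow> (\<integral>x. h x \<partial>W)"
proof -
  have h_cont: "isCont h x" for x
    using uniformly_continuous_imp_continuous[OF h] by (simp add: continuous_on_eq_continuous_at)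
  have [measurable]: "h \<in> borel_measurable borel"
    by (intro borel_measurable_continuous_onI uniformly_continuous_imp_continuous h)
  have "(\<lambda>n. \<integral>x. h x \<partial>distr M borel (X n)) \<longlonglongrightarrow> (\<integral>x. h x \<partial>W)"
    using bd h_cont X
    by (intro weak_conv_imp_integral_bdd_continuous_conv[OF _ W conv]) auto
  then have "(\<lambda>n. expectation (\<lambda>\<omega>. h (X n \<omega>))) \<longlonglongrightarrow> (\<integral>x. h x \<partial>W)"
    using X by (simp add: integral_distr)
  from tendsto_diff[OF this expectation_diff_tendsto_0[OF h bd X Y close]] show ?thesis by simp
qed

end

subsection \<open>Trigonometric approximation\<close>

text \<open>Trigonometric polynomials with arbitrary frequencies. Each generator sees
  \<open>x\<close> only through \<open>t \<bullet> x\<close>, so a one-dimensional limit theorem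
  determines its expectation; the phase \<open>b\<close> supplies sines along with cosines, and
  product-to-sum formulas make the class an algebra.\<close>

inductive trig_fun :: "('a::real_inner \<Rightarrow> real) \<Rightarrow> bool" where
  cos: "trig_fun (\<lambda>x. cos (t \<bullet> x + b))"
| add: "trig_fun f \<Longrightarrow> trig_fun g \<Longrightarrow> trig_fun (\<lambda>x. f x + g x)"
| scale: "trig_fun f \<Longrightarrow> trig_fun (\<lambda>x. c * f x)"

lemma trig_fun_const: "trig_fun (\<lambda>x. c)"
  using trig_fun.scale[OF trig_fun.cos[of 0 0], of c] by simp

lemma trig_fun_sum: "finite I \<Longrightarrow> (\<And>i. i \<in> I \<Longrightarrow> trig_fun (f i)) \<Longrightarrow> trig_fun (\<lambda>x. \<Sum>i\<in>I. f i x)"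
  by (induction I rule: finite_induct) (auto intro: trig_fun_const trig_fun.add)

lemma trig_fun_mult:
  assumes "trig_fun f" and g: "trig_fun g"
  shows "trig_fun (\<lambda>x. f x * g x)"
  using assms(1)
proof induction
  case (cos t b)
  show ?case using g
  proof induction
    case (cos s c)
    have "cos (t \<bullet> x + b) * cos (s \<bullet> x + c)
        = 1/2 * cos ((t - s) \<bullet> x + (b - c)) + 1/2 * cos ((t + s) \<bullet> x + (b + c))" for x
      by (simp add: cos_times_cos algebra_simps)
    then show ?case by (simp only:) (intro trig_fun.intros)
  next
    case (add f g)
    then show ?case using trig_fun.add[OF add.IH] by (simp add: algebra_simps)
  next
    case (scale f c)
    then show ?case using trig_fun.scale[OF scale.IH, of c] by (simp add: algebra_simps)
  qed
next
  case (add f1 f2)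
  then show ?case using trig_fun.add[OF add.IH] by (simp add: algebra_simps)
next
  case (scale f c)
  then show ?case using trig_fun.scale[OF scale.IH, of c] by (simp add: algebra_simps)
qed

lemma continuous_on_trig_fun: "trig_fun f \<Longrightarrow> continuous_on A f"
  by (induction rule: trig_fun.induct) (auto intro!: continuous_intros)

text \<open>A real polynomial on \<open>complex^'m\<close> is built by sums and products from
  constants and real-linear functionals. On the torus such a functional is a combination of
  \<open>cos (x $ i / \<rho>)\<close> and \<open>sin (x $ i / \<rho>)\<close>, the sine being
  written as a cosine with phase \<open>- (pi / 2)\<close>.\<close>

lemma trig_fun_torus_polynomial:
  fixes g :: "complex^'m \<Rightarrow> real"
  assumes "real_polynomial_function g"
  shows "trig_fun (\<lambda>x::real^'m. g (\<chi> i. cis (x $ i / \<rho>)))"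
  using assms
proof induction
  case (linear L)
  then interpret bounded_linear L .
  have "L (\<chi> i. cis (x $ i / \<rho>)) = (\<Sum>i\<in>UNIV. L (axis i 1) * cos (axis i (1 / \<rho>) \<bullet> x + 0)
      + L (axis i \<i>) * cos (axis i (1 / \<rho>) \<bullet> x + (- (pi / 2))))" for x :: "real^'m"
  proof -
    have "(\<chi> i. cis (x $ i / \<rho>))
        = (\<Sum>i\<in>UNIV. cos (x $ i / \<rho>) *\<^sub>R axis i 1 + sin (x $ i / \<rho>) *\<^sub>R axis i \<i>)"
    proof (subst vec_eq_iff, intro allI)
      fix j
      have "(\<Sum>i\<in>UNIV. cos (x $ i / \<rho>) *\<^sub>R axis i 1 + sin (x $ i / \<rho>) *\<^sub>R axis i \<i>) $ j
          = (\<Sum>i\<in>UNIV. if i = j then cis (x $ i / \<rho>) else 0)"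
        unfolding sum_component
        by (rule sum.cong) (auto simp: axis_def complex_eq_iff)
      then show "(\<chi> i. cis (x $ i / \<rho>)) $ j
          = (\<Sum>i\<in>UNIV. cos (x $ i / \<rho>) *\<^sub>R axis i 1 + sin (x $ i / \<rho>) *\<^sub>R axis i \<i>) $ j"
        by simp
    qed
    then show ?thesis
      by (simp add: sum add scaleR inner_axis' cos_diff mult.commute)
  qed
  then show ?case
    by (simp only:) (intro trig_fun_sum trig_fun.intros finite)
next
  case (const c)
  show ?case by (rule trig_fun_const)
next
  case (add f g)
  then show ?case by (intro trig_fun.add)
next
  case (mult f g)
  then show ?case by (intro trig_fun_mult)
qed

text \<open>\<open>f\<close> is transported to the torus \<open>\<bar>z\<^sub>i\<bar> = 1\<close> by \<open>x\<^sub>i = \<rho> Arg z\<^sub>i\<close>. As \<open>f\<close> vanishes outside a ball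
  inside the fundamental domain, the jump of \<open>Arg\<close> is harmless, and Stone--Weierstrass applies.\<close>

lemma trig_fun_approximation:
  fixes f :: "real^'m \<Rightarrow> real"
  assumes f: "continuous_on UNIV f" and supp: "\<And>x. norm x \<ge> T \<Longrightarrow> f x = 0"
    and bd: "\<And>x. \<bar>f x\<bar> \<le> B" and \<rho>: "\<rho> > 0" "\<rho> \<ge> T" and "\<epsilon> > 0"
  obtains p where "trig_fun p" and "\<And>x. norm x < pi * \<rho> \<Longrightarrow> \<bar>p x - f x\<bar> \<le> \<epsilon>"
    and "\<And>x. \<bar>p x\<bar> \<le> B + \<epsilon>"
proof -
  define K where "K = {z::complex^'m. \<forall>i. norm (z $ i) = 1}"
  define F where "F z = f (\<chi> i. \<rho> * Arg (z $ i))" for z :: "complex^'m"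
  have "compact K"
  proof -
    have "norm z \<le> real CARD('m)" if "z \<in> K" for z
      using norm_le_l1_cart[of "\<chi> i. norm (z $ i)"] that
      by (simp add: K_def norm_vec_def L2_set_def)
    then have "bounded K" by (auto simp: bounded_iff)
    moreover have "closed K"
      unfolding K_def by (intro closed_Collect_all closed_Collect_eq continuous_intros)
    ultimately show ?thesis by (simp add: compact_eq_bounded_closed)
  qed
  have "isCont F z" if "z \<in> K" for z
  proof (cases "\<exists>i. z $ i \<in> \<real>\<^sub>\<le>\<^sub>0")
    case False
    have "((\<lambda>w. \<chi> i. \<rho> * Arg (w $ i)) \<longlongrightarrow> (\<chi> i. \<rho> * Arg (z $ i))) (at z)"
    proof (intro tendsto_vec_lambda tendsto_mult tendsto_const)
      fix i
      have "isCont Arg (z $ i)" using False by (intro continuous_at_Arg) auto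
      then show "((\<lambda>w. Arg (w $ i)) \<longlongrightarrow> Arg (z $ i)) (at z)"
        by (rule isCont_tendsto_compose) (intro tendsto_intros)
    qed
    moreover have "isCont f (\<chi> i. \<rho> * Arg (z $ i))"
      using f by (simp add: continuous_on_eq_continuous_at)
    ultimately have "((\<lambda>w. f (\<chi> i. \<rho> * Arg (w $ i))) \<longlongrightarrow> f (\<chi> i. \<rho> * Arg (z $ i))) (at z)"
      by (rule isCont_tendsto_compose[rotated])
    then show ?thesis by (simp add: isCont_def F_def[abs_def])
  next
    \<comment> \<open>A torus coordinate on the branch cut of \<open>Arg\<close> equals -1, so its
      real part is strictly negative and stays negative nearby.\<close>
    case True
    then obtain i where i: "z $ i \<in> \<real>\<^sub>\<le>\<^sub>0" ..
    have zi: "Re (z $ i) < 0"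
    proof -
      have "Re (z $ i) \<le> 0" "Im (z $ i) = 0" "norm (z $ i) = 1"
        using i that by (auto simp: complex_nonpos_Reals_iff K_def)
      then show ?thesis by (cases "Re (z $ i) = 0") (auto simp: cmod_def)
    qed
    \<comment> \<open>A negative real part forces \<open>\<bar>Arg\<bar> > pi / 2 > 1\<close>, so
      the transported point has norm at least \<open>\<rho> \<ge> T\<close> and lies where
      \<open>f\<close> vanishes.\<close>
    have F0: "F w = 0" if w: "Re (w $ i) < 0" for w
    proof -
      have "\<bar>Arg (w $ i)\<bar> > pi / 2"
      proof (rule ccontr)
        assume "\<not> ?thesis"
        then have "cos (Arg (w $ i)) \<ge> 0" by (intro cos_ge_zero) auto
        moreover have "w $ i \<noteq> 0" using w by auto
        ultimately show False using w by (simp add: cos_Arg zero_le_divide_iff)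
      qed
      then have "\<bar>Arg (w $ i)\<bar> \<ge> 1" using pi_gt3 by linarith
      then have "\<rho> * 1 \<le> \<rho> * \<bar>Arg (w $ i)\<bar>" using \<rho> by (intro mult_left_mono) auto
      also have "\<dots> = \<bar>(\<chi> i. \<rho> * Arg (w $ i)) $ i\<bar>" using \<rho> by (simp add: abs_mult)
      also have "\<dots> \<le> norm (\<chi> i. \<rho> * Arg (w $ i))" by (rule component_le_norm_cart)
      finally show ?thesis unfolding F_def using \<rho> by (intro supp) linarith
    qed
    have "((\<lambda>w. Re (w $ i)) \<longlongrightarrow> Re (z $ i)) (nhds z)"
      by (intro tendsto_intros filterlim_ident)
    then have "\<forall>\<^sub>F w in nhds z. Re (w $ i) < 0" using zi by (rule order_tendstoD(2))
    then have "\<forall>\<^sub>F w in nhds z. F w = 0" by eventually_elim (rule F0)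
    then show ?thesis by (subst isCont_cong[where g="\<lambda>_. 0"]) auto
  qed
  then have "continuous_on K F" by (intro continuous_at_imp_continuous_on) auto
  from Stone_Weierstrass_real_polynomial_function[OF \<open>compact K\<close> this \<open>\<epsilon> > 0\<close>]
  obtain g where g: "real_polynomial_function g" "\<And>z. z \<in> K \<Longrightarrow> \<bar>F z - g z\<bar> < \<epsilon>" by blast
  define e where "e x = (\<chi> i. cis (x $ i / \<rho>))" for x :: "real^'m"
  have e: "e x \<in> K" for x by (simp add: K_def e_def)
  have Fe: "F (e x) = f x" if "norm x < pi * \<rho>" for x
  proof -
    have "\<rho> * Arg (e x $ i) = x $ i" for i
    proof -
      have "\<bar>x $ i\<bar> < pi * \<rho>" using component_le_norm_cart[of x i] that by linarith
      then have "\<bar>x $ i / \<rho>\<bar> < pi" using \<rho> by (simp add: field_simps)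
      then have "x $ i / \<rho> \<in> {-pi<..pi}" unfolding abs_less_iff greaterThanAtMost_iff by linarith
      then have "Arg (cis (x $ i / \<rho>)) = x $ i / \<rho>" by (rule Arg_cis)
      then show ?thesis using \<rho> by (simp add: e_def)
    qed
    then show ?thesis by (simp add: F_def)
  qed
  show ?thesis
  proof (rule that[of "\<lambda>x. g (e x)"])
    show "trig_fun (\<lambda>x. g (e x))" unfolding e_def by (rule trig_fun_torus_polynomial[OF g(1)])
    show "\<bar>g (e x) - f x\<bar> \<le> \<epsilon>" if "norm x < pi * \<rho>" for x
      using g(2)[OF e[of x]] Fe[OF that] by linarith
    \<comment> \<open>This bound is global: \<open>e x\<close> always lies on the torus, where
      \<open>g\<close> is within \<open>\<epsilon>\<close> of \<open>F\<close>, and \<open>F\<close>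
      takes only values of \<open>f\<close>. It will control the approximant on the event where
      \<open>S n\<close> is large.\<close>
    show "\<bar>g (e x)\<bar> \<le> B + \<epsilon>" for x
      using g(2)[OF e[of x]] bd[of "\<chi> i. \<rho> * Arg (e x $ i)"] unfolding F_def by linarith
  qed
qed

subsection \<open>The limit law of the normalised empirical deviation\<close>

text \<open>\<open>J\<close> may vary with \<open>\<epsilon>\<close>: it will be the limit belonging
  to a trigonometric approximant of that accuracy. Closeness to \<open>J\<close> makes
  \<open>a\<close> a Cauchy sequence, and \<open>b\<close> has the same limit because
  \<open>J\<close> is shared.\<close>

lemma common_limitI:
  fixes a b :: "nat \<Rightarrow> real"
  assumes "\<And>\<epsilon>. \<epsilon> > 0 \<Longrightarrow> \<exists>J. \<forall>\<^sub>F n in sequentially. \<bar>a n - J\<bar> \<le> \<epsilon> \<and> \<bar>b n - J\<bar> \<le> \<epsilon>"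
  obtains I where "a \<longlonglongrightarrow> I" "b \<longlonglongrightarrow> I"
proof -
  have "Cauchy a"
  proof (rule metric_CauchyI)
    fix e :: real assume "e > 0"
    obtain J N where N: "\<And>n. n \<ge> N \<Longrightarrow> \<bar>a n - J\<bar> \<le> e / 3"
      using assms[of "e / 3"] \<open>e > 0\<close> by (auto simp: eventually_sequentially)
    have "dist (a m) (a n) < e" if "m \<ge> N" "n \<ge> N" for m n
      using N[OF that(1)] N[OF that(2)] \<open>e > 0\<close> unfolding dist_real_def by linarith
    then show "\<exists>N. \<forall>m\<ge>N. \<forall>n\<ge>N. dist (a m) (a n) < e" by blast
  qed
  then obtain I where I: "a \<longlonglongrightarrow> I" using Cauchy_convergent convergentD by blast
  have "b \<longlonglongrightarrow> I"
  proof (rule tendstoI)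
    fix e :: real assume "e > 0"
    obtain J where "\<forall>\<^sub>F n in sequentially. \<bar>a n - J\<bar> \<le> e / 4 \<and> \<bar>b n - J\<bar> \<le> e / 4"
      using assms[of "e / 4"] \<open>e > 0\<close> by auto
    moreover have "\<forall>\<^sub>F n in sequentially. dist (a n) I < e / 4"
      using I \<open>e > 0\<close> by (intro tendstoD) auto
    ultimately show "\<forall>\<^sub>F n in sequentially. dist (b n) I < e"
      by eventually_elim (unfold dist_real_def, linarith)
  qed
  with I show ?thesis by (rule that)
qed

lemma real_distribution_std_normal [simp]: "real_distribution std_normal_distribution"
  by (simp add: real_dist_normal_dist)

locale iid_finite_covariance = prob_space M + P: prob_space P
  for M :: "'w measure" and P :: "'x measure" +
  fixes \<xi> :: "nat \<Rightarrow> 'w \<Rightarrow> 'x" and f :: "'x \<Rightarrow> real^'m"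
  assumes iid: "iid_sample M P \<xi>" and cov: "finite_covariance P f"
begin

definition S :: "nat \<Rightarrow> 'w \<Rightarrow> real^'m" where
  "S n \<omega> = sqrt (real n) *\<^sub>R emp_dev P \<xi> n f \<omega>"

definition centred :: "real^'m \<Rightarrow> 'x \<Rightarrow> real" where
  "centred t z = t \<bullet> (f z - (\<integral>y. f y \<partial>P))"

lemma measurable_f [measurable]: "f \<in> borel_measurable P"
  using cov by (simp add: finite_covariance_def borel_measurable_integrable)

lemma integrable_f: "integrable P f"
  using cov by (simp add: finite_covariance_def)

lemma measurable_\<xi> [measurable]: "\<xi> i \<in> measurable M P"
  using iid unfolding iid_sample_def indep_vars_def by auto

lemma distr_\<xi>: "distr M P (\<xi> i) = P"
  using iid unfolding iid_sample_def by auto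

lemma measurable_emp_dev [measurable]: "emp_dev P \<xi> n f \<in> borel_measurable M"
  unfolding emp_dev_def by measurable

lemma measurable_S [measurable]: "S n \<in> borel_measurable M"
  unfolding S_def by measurable

lemma measurable_centred [measurable]: "centred t \<in> borel_measurable P"
  unfolding centred_def by measurable

lemma inner_S:
  assumes "n \<ge> 1"
  shows "t \<bullet> S n \<omega> = (\<Sum>i<n. centred t (\<xi> i \<omega>)) / sqrt (real n)"
proof -
  have "t \<bullet> S n \<omega> = sqrt (real n) * (1 / real n) * (\<Sum>i<n. centred t (\<xi> i \<omega>))"
    using assms by (simp add: S_def emp_dev_def centred_def inner_diff_right inner_sum_right sum_subtractf
        algebra_simps)
  also have "sqrt (real n) * (1 / real n) = 1 / sqrt (real n)"
    using assms by (simp add: field_simps)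
  finally show ?thesis by simp
qed

lemma expectation_centred: "(\<integral>z. centred t z \<partial>P) = 0"
proof -
  have "(\<integral>z. centred t z \<partial>P) = t \<bullet> (\<integral>z. f z - (\<integral>y. f y \<partial>P) \<partial>P)"
    unfolding centred_def using integrable_f by (intro integral_inner_right) auto
  also have "\<dots> = 0" using integrable_f by (simp add: P.prob_space)
  finally show ?thesis .
qed

lemma integrable_centred_square: "integrable P (\<lambda>z. (centred t z)\<^sup>2)"
proof -
  let ?g = "\<lambda>z. f z - (\<integral>y. f y \<partial>P)"
  have "(centred t z)\<^sup>2 = (\<Sum>i\<in>UNIV. \<Sum>j\<in>UNIV. (t $ i * t $ j) * (?g z $ i * ?g z $ j))" for z
    by (simp add: centred_def inner_vec_def power2_eq_square sum_product algebra_simps)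
  moreover have "integrable P (\<lambda>z. ?g z $ i * ?g z $ j)" for i j
    using cov by (simp add: finite_covariance_def)
  ultimately show ?thesis
    by (simp only:) (intro Bochner_Integration.integrable_sum integrable_mult_right)
qed

text \<open>The standard deviation of \<open>t \<bullet> f\<close> under \<open>P\<close>, that is,
  the square root of the covariance form at \<open>t\<close>.\<close>

definition \<sigma> :: "real^'m \<Rightarrow> real" where "\<sigma> t = sqrt (\<integral>z. (centred t z)\<^sup>2 \<partial>P)"

text \<open>This evenness is the source of the symmetry between \<open>S\<close> and
  \<open>- S\<close> in the limit: the Gaussian limit of \<open>t \<bullet> S n\<close> depends on
  \<open>t\<close> only through \<open>\<sigma> t\<close>.\<close>

lemma \<sigma>_minus [simp]: "\<sigma> (- t) = \<sigma> t"
  by (simp add: \<sigma>_def centred_def)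

lemma \<sigma>_square: "(\<sigma> t)\<^sup>2 = (\<integral>z. (centred t z)\<^sup>2 \<partial>P)"
  unfolding \<sigma>_def by (intro real_sqrt_pow2 integral_nonneg) auto

lemma integral_\<xi>: "g \<in> borel_measurable P \<Longrightarrow> expectation (\<lambda>\<omega>. g (\<xi> i \<omega>)) = (\<integral>z. g z \<partial>P)"
  for g :: "'x \<Rightarrow> real"
  using integral_distr[OF measurable_\<xi>, of g i] by (simp add: distr_\<xi>)

lemma AE_centred_eq_0:
  assumes "\<sigma> t = 0"
  shows "AE \<omega> in M. \<forall>i. centred t (\<xi> i \<omega>) = 0"
proof -
  have "(\<integral>z. (centred t z)\<^sup>2 \<partial>P) = 0" using \<sigma>_square[of t] assms by simp
  then have "AE z in P. (centred t z)\<^sup>2 = 0"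
    by (subst (asm) integral_nonneg_eq_0_iff_AE[OF integrable_centred_square]) auto
  then have "AE z in distr M P (\<xi> i). centred t z = 0" for i unfolding distr_\<xi> by simp
  then have "AE \<omega> in M. centred t (\<xi> i \<omega>) = 0" for i by (subst (asm) AE_distr_iff) auto
  then show ?thesis by (simp add: AE_all_countable)
qed

text \<open>The covariance may be singular, while the central limit theorem asks for a positive
  variance. If \<open>\<sigma> t = 0\<close>, then \<open>t \<bullet> S n\<close> vanishes almost
  surely for \<open>n \<ge> 1\<close>, and the expectations and the Gaussian integral all equal
  \<open>h 0\<close>. Otherwise the standardised sum is
  \<open>(t \<bullet> S n) / \<sigma> t\<close>, and the test function becomes
  \<open>h (\<sigma> t * y)\<close>.\<close>

lemma clt_inner:
  assumes h: "\<And>x. isCont h x" and bd: "\<And>x. \<bar>h x :: real\<bar> \<le> B"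
  shows "(\<lambda>n. expectation (\<lambda>\<omega>. h (t \<bullet> S n \<omega>))) \<longlonglongrightarrow> (\<integral>y. h (\<sigma> t * y) \<partial>std_normal_distribution)"
proof (cases "\<sigma> t = 0")
  case True
  have [measurable]: "h \<in> borel_measurable borel"
    using h by (intro borel_measurable_continuous_onI continuous_at_imp_continuous_on) auto
  have "expectation (\<lambda>\<omega>. h (t \<bullet> S n \<omega>)) = h 0" if n: "n \<ge> 1" for n
  proof -
    have "AE \<omega> in M. h (t \<bullet> S n \<omega>) = h 0"
      using AE_centred_eq_0[OF True] by eventually_elim (simp add: inner_S[OF n])
    then have "expectation (\<lambda>\<omega>. h (t \<bullet> S n \<omega>)) = expectation (\<lambda>\<omega>. h 0)"
      by (intro integral_cong_AE) auto
    then show ?thesis by (simp add: prob_space)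
  qed
  then have "\<forall>\<^sub>F n in sequentially. h 0 = expectation (\<lambda>\<omega>. h (t \<bullet> S n \<omega>))"
    by (auto simp: eventually_sequentially intro!: exI[of _ 1])
  then have "(\<lambda>n. expectation (\<lambda>\<omega>. h (t \<bullet> S n \<omega>))) \<longlonglongrightarrow> h 0"
    by (rule Lim_transform_eventually[OF tendsto_const])
  moreover interpret N: real_distribution std_normal_distribution by simp
  have "(\<integral>y. h (\<sigma> t * y) \<partial>std_normal_distribution) = h 0"
    using N.prob_space by (simp add: True)
  ultimately show ?thesis by simp
next
  case False
  have "\<sigma> t \<ge> 0" unfolding \<sigma>_def by (intro real_sqrt_ge_zero integral_nonneg) auto
  with False have pos: "\<sigma> t > 0" by simp
  let ?X = "\<lambda>i \<omega>. centred t (\<xi> i \<omega>)"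
  have conv: "weak_conv_m (\<lambda>n. distr M borel (\<lambda>\<omega>. (\<Sum>i<n. ?X i \<omega>) / sqrt (n * (\<sigma> t)\<^sup>2)))
      std_normal_distribution"
  proof (rule central_limit_theorem_zero_mean[where \<mu>="distr P borel (centred t)"])
    show "indep_vars (\<lambda>i. borel) ?X UNIV"
    proof (rule indep_vars_compose2[where X=\<xi> and M'="\<lambda>_. P"])
      show "indep_vars (\<lambda>_. P) \<xi> UNIV" using iid by (simp add: iid_sample_def)
    qed measurable
    show "expectation (?X n) = 0" for n using integral_\<xi>[of "centred t" n] by (simp add: expectation_centred)
    then show "variance (?X n) = (\<sigma> t)\<^sup>2" for n
      using integral_\<xi>[of "\<lambda>z. (centred t z)\<^sup>2" n] by (simp add: \<sigma>_square)
    show "integrable M (\<lambda>\<omega>. (?X n \<omega>)\<^sup>2)" for n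
    proof -
      have "integrable (distr M P (\<xi> n)) (\<lambda>z. (centred t z)\<^sup>2)"
        unfolding distr_\<xi> by (rule integrable_centred_square)
      then show ?thesis by (subst (asm) integrable_distr_eq) auto
    qed
    show "distr M borel (?X n) = distr P borel (centred t)" for n
      using distr_distr[of "centred t" P borel "\<xi> n" M] by (simp add: distr_\<xi> o_def)
  qed (rule pos)
  have cont: "isCont (\<lambda>y. h (\<sigma> t * y)) x" for x
    by (rule isCont_o2[OF _ h]) (intro continuous_intros)
  have "(\<lambda>n. \<integral>y. h (\<sigma> t * y) \<partial>distr M borel (\<lambda>\<omega>. (\<Sum>i<n. ?X i \<omega>) / sqrt (n * (\<sigma> t)\<^sup>2)))
      \<longlonglongrightarrow> (\<integral>y. h (\<sigma> t * y) \<partial>std_normal_distribution)"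
    using bd cont
    by (intro weak_conv_imp_integral_bdd_continuous_conv[OF _ _ conv] real_distribution_distr) auto
  moreover have "\<forall>\<^sub>F n in sequentially.
      (\<integral>y. h (\<sigma> t * y) \<partial>distr M borel (\<lambda>\<omega>. (\<Sum>i<n. ?X i \<omega>) / sqrt (n * (\<sigma> t)\<^sup>2)))
        = expectation (\<lambda>\<omega>. h (t \<bullet> S n \<omega>))"
  proof (rule eventually_sequentiallyI[of 1])
    fix n :: nat assume n: "1 \<le> n"
    have [measurable]: "h \<in> borel_measurable borel"
      using h by (intro borel_measurable_continuous_onI continuous_at_imp_continuous_on) auto
    have "\<sigma> t * ((\<Sum>i<n. ?X i \<omega>) / sqrt (n * (\<sigma> t)\<^sup>2)) = t \<bullet> S n \<omega>" for \<omega>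
      using n pos by (simp add: inner_S real_sqrt_mult)
    then show "(\<integral>y. h (\<sigma> t * y) \<partial>distr M borel (\<lambda>\<omega>. (\<Sum>i<n. ?X i \<omega>) / sqrt (n * (\<sigma> t)\<^sup>2)))
        = expectation (\<lambda>\<omega>. h (t \<bullet> S n \<omega>))"
      by (subst integral_distr) auto
  qed
  ultimately show ?thesis by (rule Lim_transform_eventually)
qed

lemma component_S_tight:
  assumes "\<delta> > 0"
  obtains T where "T > 0" "\<forall>\<^sub>F n in sequentially. prob {\<omega> \<in> space M. \<bar>S n \<omega> $ i\<bar> > T} \<le> \<delta>"
proof -
  interpret N: real_distribution std_normal_distribution by simp
  \<comment> \<open>A continuous ramp, 0 for \<open>\<bar>y\<bar> \<le> k\<close> and 1 for
    \<open>\<bar>y\<bar> \<ge> k + 1\<close>. It dominates the indicator of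
    \<open>\<bar>y\<bar> > k + 1\<close>, so its Gaussian integral, small for large
    \<open>k\<close>, bounds the tail probability for large \<open>n\<close>.\<close>
  define h where "h k y = min 1 (max 0 (\<bar>y\<bar> - real k))" for k y
  let ?\<sigma> = "\<sigma> (axis i 1)"
  have "(\<lambda>k. \<integral>y. h k (?\<sigma> * y) \<partial>std_normal_distribution) \<longlonglongrightarrow> (\<integral>y. 0 \<partial>std_normal_distribution)"
  proof (rule integral_dominated_convergence[where w="\<lambda>_. 1"])
    show "AE y in std_normal_distribution. (\<lambda>k. h k (?\<sigma> * y)) \<longlonglongrightarrow> 0"
    proof (rule AE_I2)
      fix y
      obtain k0 where k0: "\<bar>?\<sigma> * y\<bar> \<le> real k0" using real_arch_simple by blast
      have "\<forall>\<^sub>F k in sequentially. 0 = h k (?\<sigma> * y)"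
        using eventually_ge_at_top[of k0] by eventually_elim (use k0 in \<open>auto simp: h_def\<close>)
      then show "(\<lambda>k. h k (?\<sigma> * y)) \<longlonglongrightarrow> 0" by (rule Lim_transform_eventually[OF tendsto_const])
    qed
  qed (auto simp: h_def)
  then have "(\<lambda>k. \<integral>y. h k (?\<sigma> * y) \<partial>std_normal_distribution) \<longlonglongrightarrow> 0" by simp
  then have "\<forall>\<^sub>F k in sequentially. (\<integral>y. h k (?\<sigma> * y) \<partial>std_normal_distribution) < \<delta>"
    using assms by (rule order_tendstoD(2))
  then obtain k where k: "(\<integral>y. h k (?\<sigma> * y) \<partial>std_normal_distribution) < \<delta>"
    by (auto dest: eventually_happens)
  have "(\<lambda>n. expectation (\<lambda>\<omega>. h k (axis i 1 \<bullet> S n \<omega>))) \<longlonglongrightarrow> (\<integral>y. h k (?\<sigma> * y) \<partial>std_normal_distribution)"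
    by (rule clt_inner[where B=1]) (auto simp: h_def intro!: continuous_intros)
  from order_tendstoD(2)[OF this k]
  have "\<forall>\<^sub>F n in sequentially. prob {\<omega> \<in> space M. \<bar>S n \<omega> $ i\<bar> > real k + 1} \<le> \<delta>"
  proof eventually_elim
    case (elim n)
    let ?A = "{\<omega> \<in> space M. \<bar>S n \<omega> $ i\<bar> > real k + 1}"
    have A: "?A \<in> events" by measurable
    have "prob ?A = expectation (indicator ?A)" using A by simp
    also have "\<dots> \<le> expectation (\<lambda>\<omega>. h k (axis i 1 \<bullet> S n \<omega>))"
    proof (rule integral_mono)
      show "integrable M (\<lambda>\<omega>. h k (axis i 1 \<bullet> S n \<omega>))"
        unfolding h_def by (rule integrable_const_bound[of _ 1]) auto
      show "indicator ?A \<omega> \<le> h k (axis i 1 \<bullet> S n \<omega>)" for \<omega>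
        by (auto simp: h_def inner_axis' indicator_def)
      show "integrable M (indicator ?A :: 'w \<Rightarrow> real)"
        using A by (intro integrable_real_indicator) (auto simp: less_top[symmetric])
    qed
    finally show ?case using elim by simp
  qed
  then show ?thesis by (intro that[of "real k + 1"]) auto
qed

text \<open>A union bound over the coordinates, each allotted \<open>\<delta> / CARD('m)\<close>,
  combined with the bound of the norm by the sum of the absolute coordinates.\<close>

lemma S_tight:
  assumes "\<delta> > 0"
  obtains T where "T > 0" "whp \<delta> sequentially (\<lambda>n \<omega>. norm (S n \<omega>) \<le> T)"
proof -
  define \<delta>' where "\<delta>' = \<delta> / real CARD('m)"
  have "\<delta>' > 0" using assms by (simp add: \<delta>'_def)
  have "\<forall>i. \<exists>T. T > 0 \<and> (\<forall>\<^sub>F n in sequentially. prob {\<omega> \<in> space M. \<bar>S n \<omega> $ i\<bar> > T} \<le> \<delta>')"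
  proof
    fix i show "\<exists>T. T > 0 \<and> (\<forall>\<^sub>F n in sequentially. prob {\<omega> \<in> space M. \<bar>S n \<omega> $ i\<bar> > T} \<le> \<delta>')"
      by (rule component_S_tight[OF \<open>\<delta>' > 0\<close>, of i]) blast
  qed
  from choice[OF this] obtain T where T: "\<And>i. T i > 0"
    "\<And>i. \<forall>\<^sub>F n in sequentially. prob {\<omega> \<in> space M. \<bar>S n \<omega> $ i\<bar> > T i} \<le> \<delta>'" by blast
  have "\<forall>\<^sub>F n in sequentially. \<forall>i. prob {\<omega> \<in> space M. \<bar>S n \<omega> $ i\<bar> > T i} \<le> \<delta>'"
    using T(2) by (rule eventually_all_finite)
  then have "whp \<delta> sequentially (\<lambda>n \<omega>. norm (S n \<omega>) \<le> (\<Sum>i\<in>UNIV. T i))"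
    unfolding whp_def
  proof eventually_elim
    case (elim n)
    let ?B = "\<lambda>i. {\<omega> \<in> space M. \<bar>S n \<omega> $ i\<bar> > T i}"
    have "prob (\<Union>i. ?B i) \<le> (\<Sum>i\<in>UNIV. prob (?B i))"
      by (intro finite_measure_subadditive_finite) auto
    also have "\<dots> \<le> (\<Sum>i\<in>(UNIV::'m set). \<delta>')" using elim by (intro sum_mono) auto
    also have "\<dots> = \<delta>" by (simp add: \<delta>'_def)
    finally have "prob (\<Union>i. ?B i) \<le> \<delta>" .
    moreover have "norm (S n \<omega>) \<le> (\<Sum>i\<in>UNIV. T i)" if "\<omega> \<in> space M - (\<Union>i. ?B i)" for \<omega>
    proof -
      have "norm (S n \<omega>) \<le> (\<Sum>i\<in>UNIV. \<bar>S n \<omega> $ i\<bar>)" by (rule norm_le_l1_cart)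
      also have "\<dots> \<le> (\<Sum>i\<in>UNIV. T i)" using that by (intro sum_mono) (auto simp: not_less)
      finally show ?thesis .
    qed
    ultimately show ?case by (intro bexI[of _ "\<Union>i. ?B i"]) auto
  qed
  moreover have "(\<Sum>i\<in>UNIV. T i) > 0" using T(1) by (intro sum_pos) auto
  ultimately show ?thesis using that by blast
qed

text \<open>For a generator, \<open>p (- S n)\<close> is the cosine with frequency
  \<open>- t\<close>, and the limit depends only on \<open>\<sigma> (- t) = \<sigma> t\<close>.
  Integrability is carried through the induction so that expectations split over sums.\<close>

lemma trig_fun_limit:
  assumes "trig_fun p"
  obtains J where "(\<lambda>n. expectation (\<lambda>\<omega>. p (S n \<omega>))) \<longlonglongrightarrow> J"
    "(\<lambda>n. expectation (\<lambda>\<omega>. p (- S n \<omega>))) \<longlonglongrightarrow> J"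
proof -
  have "(\<exists>J. (\<lambda>n. expectation (\<lambda>\<omega>. p (S n \<omega>))) \<longlonglongrightarrow> J \<and> (\<lambda>n. expectation (\<lambda>\<omega>. p (- S n \<omega>))) \<longlonglongrightarrow> J)
      \<and> (\<forall>n. integrable M (\<lambda>\<omega>. p (S n \<omega>)) \<and> integrable M (\<lambda>\<omega>. p (- S n \<omega>)))"
    using assms
  proof induction
    case (cos t b)
    have lim: "(\<lambda>n. expectation (\<lambda>\<omega>. cos (s \<bullet> S n \<omega> + b)))
        \<longlonglongrightarrow> (\<integral>y. cos (\<sigma> s * y + b) \<partial>std_normal_distribution)" for s
      by (rule clt_inner[where B=1 and h="\<lambda>x. cos (x + b)"]) (auto intro!: continuous_intros)
    have int: "integrable M (\<lambda>\<omega>. cos (s \<bullet> S n \<omega> + b))" for s n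
      by (rule integrable_const_bound[of _ 1]) auto
    then show ?case using lim[of t] lim[of "- t"] int[of t] int[of "- t"] by auto
  next
    case (add f g)
    then obtain I J where
      "(\<lambda>n. expectation (\<lambda>\<omega>. f (S n \<omega>))) \<longlonglongrightarrow> I" "(\<lambda>n. expectation (\<lambda>\<omega>. f (- S n \<omega>))) \<longlonglongrightarrow> I"
      "(\<lambda>n. expectation (\<lambda>\<omega>. g (S n \<omega>))) \<longlonglongrightarrow> J" "(\<lambda>n. expectation (\<lambda>\<omega>. g (- S n \<omega>))) \<longlonglongrightarrow> J"
      by blast
    from tendsto_add[OF this(1,3)] tendsto_add[OF this(2,4)] add.IH show ?case by auto
  next
    case (scale f c)
    then obtain I where
      "(\<lambda>n. expectation (\<lambda>\<omega>. f (S n \<omega>))) \<longlonglongrightarrow> I" "(\<lambda>n. expectation (\<lambda>\<omega>. f (- S n \<omega>))) \<longlonglongrightarrow> I"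
      by blast
    from tendsto_mult_left[OF this(1), of c] tendsto_mult_left[OF this(2), of c] scale.IH
    show ?case by auto
  qed
  then show ?thesis using that by blast
qed

text \<open>Up to an event of probability \<open>\<delta>\<close>, tightness puts \<open>S n\<close>
  into the ball where a trigonometric approximant is accurate. Replacing \<open>g\<close> by the
  approximant costs at most \<open>2 * (\<epsilon> / 3)\<close>; convergence of the approximant's
  expectations takes the last third.\<close>

lemma compact_support_limit:
  fixes g :: "real^'m \<Rightarrow> real"
  assumes g: "continuous_on UNIV g" and supp: "\<And>x. norm x \<ge> T \<Longrightarrow> g x = 0"
  obtains I where "(\<lambda>n. expectation (\<lambda>\<omega>. g (S n \<omega>))) \<longlonglongrightarrow> I"
    "(\<lambda>n. expectation (\<lambda>\<omega>. g (- S n \<omega>))) \<longlonglongrightarrow> I"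
proof (rule common_limitI[of "\<lambda>n. expectation (\<lambda>\<omega>. g (S n \<omega>))" "\<lambda>n. expectation (\<lambda>\<omega>. g (- S n \<omega>))"])
  have "compact (g ` cball 0 \<bar>T\<bar>)"
    using g by (intro compact_continuous_image continuous_on_subset[OF g]) auto
  then obtain B0 where B0: "\<And>x. norm x \<le> \<bar>T\<bar> \<Longrightarrow> \<bar>g x\<bar> \<le> B0"
    using compact_imp_bounded by (fastforce simp: bounded_iff)
  define B where "B = max B0 0"
  have bd: "\<bar>g x\<bar> \<le> B" for x
    using B0[of x] supp[of x] by (cases "norm x \<le> \<bar>T\<bar>") (auto simp: B_def)
  have "B \<ge> 0" by (simp add: B_def)
  have [measurable]: "g \<in> borel_measurable borel" using g by (rule borel_measurable_continuous_onI)
  fix \<epsilon> :: real assume "\<epsilon> > 0"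
  \<comment> \<open>On the exceptional event the approximant is at most
    \<open>B + \<epsilon> / 3\<close> and \<open>g\<close> at most \<open>B\<close> in absolute
    value; \<open>\<delta>\<close> makes the contribution of that event at most
    \<open>\<epsilon> / 3\<close>.\<close>
  define \<delta> where "\<delta> = (\<epsilon> / 3) / (2 * B + 1 + \<epsilon> / 3)"
  have "\<delta> > 0" using \<open>\<epsilon> > 0\<close> \<open>B \<ge> 0\<close> by (simp add: \<delta>_def)
  have "(2 * B + \<epsilon> / 3) * \<delta> \<le> (2 * B + 1 + \<epsilon> / 3) * \<delta>"
    using \<open>\<delta> > 0\<close> by (intro mult_right_mono) auto
  also have "\<dots> = \<epsilon> / 3"
  proof -
    have "2 * B + 1 + \<epsilon> / 3 \<noteq> 0" using \<open>\<epsilon> > 0\<close> \<open>B \<ge> 0\<close> by linarith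
    then show ?thesis
      unfolding \<delta>_def by (metis nonzero_mult_div_cancel_left times_divide_eq_right)
  qed
  finally have \<delta>: "(2 * B + \<epsilon> / 3) * \<delta> \<le> \<epsilon> / 3" .
  obtain T' where T': "T' > 0" "whp \<delta> sequentially (\<lambda>n \<omega>. norm (S n \<omega>) \<le> T')"
    using S_tight[OF \<open>\<delta> > 0\<close>] by blast
  \<comment> \<open>\<open>\<rho> \<ge> T\<close> is the support condition of the approximation, and
    \<open>T' < pi * \<rho>\<close> keeps the ball that carries most of the mass of
    \<open>S n\<close> inside the fundamental domain.\<close>
  define \<rho> where "\<rho> = max T T'"
  have \<rho>: "\<rho> > 0" "\<rho> \<ge> T" "T' < pi * \<rho>"
  proof -
    show "\<rho> > 0" "\<rho> \<ge> T" using T' by (auto simp: \<rho>_def)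
    have "1 * \<rho> < pi * \<rho>" using \<open>\<rho> > 0\<close> pi_gt3 by (intro mult_strict_right_mono) auto
    then show "T' < pi * \<rho>" by (simp add: \<rho>_def)
  qed
  obtain p where p: "trig_fun p" "\<And>x. norm x < pi * \<rho> \<Longrightarrow> \<bar>p x - g x\<bar> \<le> \<epsilon> / 3"
      "\<And>x. \<bar>p x\<bar> \<le> B + \<epsilon> / 3"
    using trig_fun_approximation[OF g supp bd \<rho>(1,2), of "\<epsilon> / 3"] \<open>\<epsilon> > 0\<close> by auto
  have [measurable]: "p \<in> borel_measurable borel"
    using continuous_on_trig_fun[OF p(1)] by (rule borel_measurable_continuous_onI)
  have close: "\<forall>\<^sub>F n in sequentially.
      \<bar>expectation (\<lambda>\<omega>. g (s *\<^sub>R S n \<omega>)) - expectation (\<lambda>\<omega>. p (s *\<^sub>R S n \<omega>))\<bar> \<le> 2 * (\<epsilon> / 3)"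
    if s: "s = 1 \<or> s = - 1" for s :: real
  proof -
    have "whp \<delta> sequentially (\<lambda>n \<omega>. \<bar>p (s *\<^sub>R S n \<omega>) - g (s *\<^sub>R S n \<omega>)\<bar> \<le> \<epsilon> / 3)"
    proof (rule whp_mono[OF T'(2)], intro always_eventually allI ballI impI)
      fix n \<omega> assume "norm (S n \<omega>) \<le> T'"
      then have "norm (s *\<^sub>R S n \<omega>) < pi * \<rho>" using s \<rho>(3) by auto
      then show "\<bar>p (s *\<^sub>R S n \<omega>) - g (s *\<^sub>R S n \<omega>)\<bar> \<le> \<epsilon> / 3" by (rule p(2))
    qed
    then have "\<forall>\<^sub>F n in sequentially. expectation (\<lambda>\<omega>. \<bar>p (s *\<^sub>R S n \<omega>) - g (s *\<^sub>R S n \<omega>)\<bar>)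
        \<le> \<epsilon> / 3 + (2 * B + \<epsilon> / 3) * \<delta>"
    proof (rule expectation_le_whp)
      show "\<bar>\<bar>p (s *\<^sub>R S n \<omega>) - g (s *\<^sub>R S n \<omega>)\<bar>\<bar> \<le> 2 * B + \<epsilon> / 3" for n \<omega>
        using p(3)[of "s *\<^sub>R S n \<omega>"] bd[of "s *\<^sub>R S n \<omega>"] by linarith
    qed (use \<open>\<epsilon> > 0\<close> in auto)
    then show ?thesis
    proof eventually_elim
      case (elim n)
      have int: "integrable M (\<lambda>\<omega>. p (s *\<^sub>R S n \<omega>))" "integrable M (\<lambda>\<omega>. g (s *\<^sub>R S n \<omega>))"
        by (rule integrable_const_bound[of _ "B + \<epsilon> / 3"], use p(3) in auto)
          (rule integrable_const_bound[of _ B], use bd in auto)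
      have "\<bar>expectation (\<lambda>\<omega>. g (s *\<^sub>R S n \<omega>)) - expectation (\<lambda>\<omega>. p (s *\<^sub>R S n \<omega>))\<bar>
          = \<bar>expectation (\<lambda>\<omega>. p (s *\<^sub>R S n \<omega>) - g (s *\<^sub>R S n \<omega>))\<bar>"
        using int by simp
      also have "\<dots> \<le> expectation (\<lambda>\<omega>. \<bar>p (s *\<^sub>R S n \<omega>) - g (s *\<^sub>R S n \<omega>)\<bar>)"
        by (rule integral_abs_bound)
      finally show ?case using elim \<delta> by linarith
    qed
  qed
  obtain J where J: "(\<lambda>n. expectation (\<lambda>\<omega>. p (S n \<omega>))) \<longlonglongrightarrow> J"
    "(\<lambda>n. expectation (\<lambda>\<omega>. p (- S n \<omega>))) \<longlonglongrightarrow> J"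
    using trig_fun_limit[OF p(1)] by blast
  have "\<forall>\<^sub>F n in sequentially. dist (expectation (\<lambda>\<omega>. p (S n \<omega>))) J < \<epsilon> / 3"
    "\<forall>\<^sub>F n in sequentially. dist (expectation (\<lambda>\<omega>. p (- S n \<omega>))) J < \<epsilon> / 3"
    by (rule tendstoD[OF J(1)], use \<open>\<epsilon> > 0\<close> in simp) (rule tendstoD[OF J(2)], use \<open>\<epsilon> > 0\<close> in simp)
  then have "\<forall>\<^sub>F n in sequentially. \<bar>expectation (\<lambda>\<omega>. g (S n \<omega>)) - J\<bar> \<le> \<epsilon>
      \<and> \<bar>expectation (\<lambda>\<omega>. g (- S n \<omega>)) - J\<bar> \<le> \<epsilon>"
    using close[of 1, simplified] close[of "-1", simplified]
  proof eventually_elim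
    case (elim n)
    have tri: "\<bar>x - J\<bar> \<le> \<epsilon>" if "\<bar>y - J\<bar> < \<epsilon> / 3" "\<bar>x - y\<bar> * 3 \<le> 2 * \<epsilon>" for x y :: real
    proof -
      have "w \<le> \<epsilon>" if "w \<le> v + u" "u < \<epsilon> / 3" "v * 3 \<le> 2 * \<epsilon>" for u v w
        using that by linarith
      moreover have "\<bar>x - J\<bar> \<le> \<bar>x - y\<bar> + \<bar>y - J\<bar>"
        using abs_triangle_ineq[of "x - y" "y - J"] by simp
      ultimately show ?thesis using that by blast
    qed
    show ?case using elim unfolding dist_real_def by (blast intro: tri)
  qed
  then show "\<exists>J. \<forall>\<^sub>F n in sequentially. \<bar>expectation (\<lambda>\<omega>. g (S n \<omega>)) - J\<bar> \<le> \<epsilon>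
      \<and> \<bar>expectation (\<lambda>\<omega>. g (- S n \<omega>)) - J\<bar> \<le> \<epsilon>" ..
qed (rule that)

end

subsection \<open>Dominance of the limit laws\<close>

text \<open>Where \<open>u \<ge> - k\<close>, the positive part plus \<open>k\<close> equals
  \<open>u + k\<close> plus the negative part. Integrating this gives the formula once the integral
  of the negative part, which is at most \<open>k\<close>, is cancelled.\<close>

lemma ext_expectation_bounded_below:
  assumes W: "real_distribution W" and u[measurable]: "u \<in> borel_measurable borel"
    and k: "k \<ge> 0" "AE x in W. - k \<le> u x"
  shows "has_ext_expectation W u"
    and "ext_expectation W u = enn2ereal (\<integral>\<^sup>+x. ennreal (u x + k) \<partial>W) - ereal k"
proof -
  interpret real_distribution W by fact
  have one: "emeasure W UNIV = 1" using emeasure_space_1 by simp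
  let ?a = "\<integral>\<^sup>+x. ennreal (u x) \<partial>W" and ?b = "\<integral>\<^sup>+x. ennreal (- u x) \<partial>W"
    and ?w = "\<integral>\<^sup>+x. ennreal (u x + k) \<partial>W"
  have "?b \<le> (\<integral>\<^sup>+x. ennreal k \<partial>W)"
    using k(2) by (intro nn_integral_mono_AE) (auto elim!: eventually_mono intro!: ennreal_leI)
  also have "\<dots> = ennreal k" by (simp add: one)
  finally have b: "?b \<le> ennreal k" .
  then have b_fin: "?b < \<infinity>" by (rule order.strict_trans1) simp
  then show "has_ext_expectation W u" by (simp add: has_ext_expectation_def)
  have "?a + ennreal k = (\<integral>\<^sup>+x. ennreal (u x) + ennreal k \<partial>W)"
    by (subst nn_integral_add) (auto simp: one)
  also have "\<dots> = (\<integral>\<^sup>+x. ennreal (u x + k) + ennreal (- u x) \<partial>W)"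
  proof (rule nn_integral_cong_AE)
    show "AE x in W. ennreal (u x) + ennreal k = ennreal (u x + k) + ennreal (- u x)"
      using k(2)
    proof eventually_elim
      case (elim x)
      show ?case
      proof (cases "u x \<ge> 0")
        case True
        then show ?thesis using k(1) by (simp add: ennreal_plus ennreal_neg)
      next
        case False
        then have "ennreal (u x + k) + ennreal (- u x) = ennreal k"
          using elim by (subst ennreal_plus[symmetric]) auto
        then show ?thesis using False by (simp add: ennreal_neg)
      qed
    qed
  qed
  also have "\<dots> = ?w + ?b" by (subst nn_integral_add) auto
  finally have eq: "?a + ennreal k = ?w + ?b" .
  from b_fin obtain b where b: "?b = ennreal b" "b \<ge> 0" by (cases ?b) auto
  show "ext_expectation W u = enn2ereal ?w - ereal k"
  proof (cases ?a)
    case (real a)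
    then obtain w where w: "?w = ennreal w" "w \<ge> 0"
      using eq by (cases ?w) (auto simp: ennreal_plus[symmetric] simp del: ennreal_plus)
    have "a + k = w + b"
      using eq real w b k(1) by (simp add: ennreal_plus[symmetric] del: ennreal_plus)
    then have "a - b = w - k" by simp
    then show ?thesis using real w b by (simp add: ext_expectation_def)
  next
    case top
    then have "?w = \<infinity>" using eq b by (cases ?w) (auto simp: ennreal_plus[symmetric] simp del: ennreal_plus)
    then show ?thesis using top b by (simp add: ext_expectation_def)
  qed
qed

text \<open>On the half-line a non-decreasing \<open>u\<close> is bounded below by
  \<open>u 0\<close>. Adding \<open>k = max 0 (- u 0)\<close> makes it nonnegative there and
  preserves monotonicity and convexity, so comparing integrals of nonnegative functions suffices,
  and both expectations are meaningful.\<close>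

lemma ssdI:
  assumes W: "real_distribution W0" "real_distribution W1"
    and nonneg: "AE x in W0. 0 \<le> x" "AE x in W1. 0 \<le> x"
    and le: "\<And>v. mono v \<Longrightarrow> continuous_on UNIV v \<Longrightarrow> convex_on UNIV v \<Longrightarrow> (\<And>x. x \<ge> 0 \<Longrightarrow> v x \<ge> 0) \<Longrightarrow>
      (\<integral>\<^sup>+x. ennreal (v x) \<partial>W0) \<le> (\<integral>\<^sup>+x. ennreal (v x) \<partial>W1)"
  shows "ssd W0 W1"
  unfolding ssd_def
proof (intro allI impI)
  fix u :: "real \<Rightarrow> real" assume u: "mono u \<and> convex_on UNIV u"
  then have cont: "continuous_on UNIV u" by (intro convex_on_continuous) auto
  then have [measurable]: "u \<in> borel_measurable borel" by (rule borel_measurable_continuous_onI)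
  define k where "k = max 0 (- u 0)"
  have k: "k \<ge> 0" "x \<ge> 0 \<Longrightarrow> - k \<le> u x" for x
    using u monoD[of u 0 x] by (auto simp: k_def)
  have AE: "AE x in W0. - k \<le> u x" "AE x in W1. - k \<le> u x"
    using nonneg by (auto elim!: eventually_mono intro: k(2))
  have "convex_on UNIV (\<lambda>x. u x + k)"
    using u by (intro convex_on_add) (auto simp: convex_on_def algebra_simps simp flip: distrib_right)
  moreover have "mono (\<lambda>x. u x + k)" using u by (auto simp: mono_def)
  moreover have "continuous_on UNIV (\<lambda>x. u x + k)" using cont by (intro continuous_intros)
  moreover have "u x + k \<ge> 0" if "x \<ge> 0" for x using k(2)[OF that] by linarith
  ultimately have "(\<integral>\<^sup>+x. ennreal (u x + k) \<partial>W0) \<le> (\<integral>\<^sup>+x. ennreal (u x + k) \<partial>W1)"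
    by (intro le)
  then have "enn2ereal (\<integral>\<^sup>+x. ennreal (u x + k) \<partial>W0) - ereal k
      \<le> enn2ereal (\<integral>\<^sup>+x. ennreal (u x + k) \<partial>W1) - ereal k"
    by (intro ereal_minus_mono) (simp_all add: less_eq_ennreal.rep_eq)
  then show "has_ext_expectation W0 u \<and> has_ext_expectation W1 u \<and> ext_expectation W0 u \<le> ext_expectation W1 u"
    using ext_expectation_bounded_below[OF W(1) _ k(1) AE(1)] ext_expectation_bounded_below[OF W(2) _ k(1) AE(2)]
    by simp
qed

text \<open>The supply of test functions: the limit statements ask for bounded uniformly continuous
  ones, and precomposing a continuous function with a clamp, which is 1-Lipschitz with compact
  range, provides them.\<close>

lemma uniformly_continuous_clamp:
  fixes v :: "real \<Rightarrow> real"
  assumes v: "continuous_on UNIV v" and "a \<le> b"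
  shows "uniformly_continuous_on UNIV (\<lambda>x. v (min b (max a x)))"
proof -
  have "uniformly_continuous_on {a..b} v"
    using v by (intro compact_uniformly_continuous continuous_on_subset[OF v]) auto
  moreover have "uniformly_continuous_on UNIV (\<lambda>x. min b (max a x))"
    unfolding uniformly_continuous_on_def dist_real_def
  proof (intro allI impI)
    fix e :: real assume "e > 0"
    have "\<bar>min b (max a x') - min b (max a x)\<bar> \<le> \<bar>x' - x\<bar>" for x x'
      by (auto simp: min_def max_def abs_if)
    note lip = le_less_trans[OF this]
    show "\<exists>d>0. \<forall>x\<in>UNIV. \<forall>x'\<in>UNIV. \<bar>x' - x\<bar> < d \<longrightarrow>
        \<bar>min b (max a x') - min b (max a x)\<bar> < e"
      by (intro exI[of _ e] conjI ballI impI lip \<open>e > 0\<close>)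
  qed
  moreover have "range (\<lambda>x. min b (max a x)) = {a..b}"
  proof
    show "{a..b} \<subseteq> range (\<lambda>x. min b (max a x))"
    proof
      fix x assume "x \<in> {a..b}"
      then have "x = min b (max a x)" by simp
      then show "x \<in> range (\<lambda>x. min b (max a x))" by (rule range_eqI)
    qed
  qed (use \<open>a \<le> b\<close> in auto)
  ultimately show ?thesis
    using uniformly_continuous_on_compose[of UNIV "\<lambda>x. min b (max a x)" v] by simp
qed

context iid_finite_covariance
begin

text \<open>By the symmetry \<open>S \<leftrightarrow> -S\<close> of the limit, the hypothesis \<open>q0 y \<le> (q1 y + q1 (- y)) / 2\<close> gives
  \<open>E v(q0(S)) \<le> E v(q1(S))\<close> for convex \<open>v\<close>. The cutoff \<open>\<phi>\<close> is even, hence preserves this argument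
  while making all integrands compactly supported.\<close>

lemma ssd_limit_laws:
  fixes q0 q1 :: "real^'m \<Rightarrow> real"
  assumes r: "strict_mono r" and s: "strict_mono s"
    and W: "real_distribution W0" "real_distribution W1"
    and q0: "continuous_on UNIV q0" "\<And>y. q0 y \<ge> 0" and q1: "continuous_on UNIV q1" "\<And>y. q1 y \<ge> 0"
    and mid: "\<And>y. q0 y \<le> (q1 y + q1 (- y)) / 2"
    and lim0: "\<And>(h :: real \<Rightarrow> real) B. uniformly_continuous_on UNIV h \<Longrightarrow> (\<And>x. \<bar>h x\<bar> \<le> B) \<Longrightarrow>
      (\<lambda>n. expectation (\<lambda>\<omega>. h (q0 (S (r n) \<omega>)))) \<longlonglongrightarrow> (\<integral>x. h x \<partial>W0)"
    and lim1: "\<And>(h :: real \<Rightarrow> real) B. uniformly_continuous_on UNIV h \<Longrightarrow> (\<And>x. \<bar>h x\<bar> \<le> B) \<Longrightarrow>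
      (\<lambda>n. expectation (\<lambda>\<omega>. h (q1 (S (s n) \<omega>)))) \<longlonglongrightarrow> (\<integral>x. h x \<partial>W1)"
  shows "ssd W0 W1"
proof -
  interpret W0: real_distribution W0 by fact
  interpret W1: real_distribution W1 by fact
  have [measurable]: "q0 \<in> borel_measurable borel" "q1 \<in> borel_measurable borel"
    using q0 q1 by (auto intro: borel_measurable_continuous_onI)
  have nonneg: "AE x in W. 0 \<le> x"
    if W: "real_distribution W" and q: "\<And>y. q y \<ge> 0"
      and lim: "\<And>(h :: real \<Rightarrow> real) B. uniformly_continuous_on UNIV h \<Longrightarrow> (\<And>x. \<bar>h x\<bar> \<le> B) \<Longrightarrow>
        (\<lambda>n. expectation (\<lambda>\<omega>. h (q (S (t n) \<omega>)))) \<longlonglongrightarrow> (\<integral>x. h x \<partial>W)"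
    for W t and q :: "real^'m \<Rightarrow> real"
  proof -
    interpret W: real_distribution W by fact
    \<comment> \<open>The negative part capped at 1. It vanishes at all values of \<open>q\<close>,
      so its integral under the limit law is 0.\<close>
    define h where "h x = - min 0 (max (-1) x)" for x :: real
    have [measurable]: "h \<in> borel_measurable borel" unfolding h_def by measurable
    have h: "uniformly_continuous_on UNIV h"
      unfolding h_def by (rule uniformly_continuous_clamp[of uminus]) (auto intro: continuous_intros)
    have "(\<lambda>n. expectation (\<lambda>\<omega>. h (q (S (t n) \<omega>)))) \<longlonglongrightarrow> (\<integral>x. h x \<partial>W)"
      by (rule lim[OF h, of 1]) (auto simp: h_def)
    moreover have "h (q y) = 0" for y using q[of y] by (simp add: h_def)
    ultimately have "(\<integral>x. h x \<partial>W) = 0" by (simp add: LIMSEQ_const_iff)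
    moreover have "integrable W h"
      by (rule W.integrable_const_bound[of _ 1]) (auto simp: h_def)
    ultimately have "AE x in W. h x = 0"
      by (subst (asm) integral_nonneg_eq_0_iff_AE) (auto simp: h_def)
    then show ?thesis by eventually_elim (auto simp: h_def min_def max_def split: if_splits)
  qed
  have AE0: "AE x in W0. 0 \<le> x" by (rule nonneg[OF W(1) q0(2) lim0])
  have AE1: "AE x in W1. 0 \<le> x" by (rule nonneg[OF W(2) q1(2) lim1])
  show ?thesis
  proof (rule ssdI[OF W AE0 AE1])
    fix v :: "real \<Rightarrow> real"
    assume v: "mono v" "continuous_on UNIV v" "convex_on UNIV v" "\<And>x. x \<ge> 0 \<Longrightarrow> v x \<ge> 0"
    have [measurable]: "v \<in> borel_measurable borel" using v(2) by (rule borel_measurable_continuous_onI)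
    \<comment> \<open>A bounded truncation of \<open>v\<close>, in general no longer convex; the
      midpoint inequality is therefore applied to \<open>v\<close> itself. Letting \<open>X\<close>
      grow recovers \<open>v\<close> on the half-line by monotone convergence.\<close>
    define h where "h X x = v (min X (max 0 x))" for X x :: real
    have [measurable]: "h X \<in> borel_measurable borel" for X unfolding h_def by measurable
    have h: "uniformly_continuous_on UNIV (h X)" "0 \<le> h X x" "h X x \<le> v X" "\<bar>h X x\<bar> \<le> v X"
      if "X \<ge> 0" for X x
    proof -
      show "uniformly_continuous_on UNIV (h X)"
        unfolding h_def using that by (intro uniformly_continuous_clamp v)
      show "0 \<le> h X x" using that by (auto simp: h_def intro!: v(4))
      moreover show "h X x \<le> v X" using that by (auto simp: h_def intro!: monoD[OF v(1)])
      ultimately show "\<bar>h X x\<bar> \<le> v X" by simp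
    qed
    have h_le: "h X x \<le> v x" if "x \<ge> 0" for X x
      using that by (auto simp: h_def intro!: monoD[OF v(1)])
    define N1 where "N1 = (\<integral>\<^sup>+x. ennreal (v x) \<partial>W1)"
    have int_h: "integrable M (\<lambda>\<omega>. h X (g \<omega>))" if "X \<ge> 0" "g \<in> borel_measurable M" for X g
      using h(4)[OF that(1)] that(2) by (intro integrable_const_bound[of _ "v X"]) auto
    \<comment> \<open>For finite \<open>N1 = c\<close> the chain is \<open>\<integral> h X
      \<partial>W0 \<le> I0 + \<epsilon> \<le> I1 + \<epsilon> \<le> c + \<epsilon>\<close>, where
      \<open>I0\<close> and \<open>I1\<close> are limits of cut-off expectations along the full
      sequence. They link \<open>W0\<close>, seen along \<open>r\<close>, to \<open>W1\<close>, seen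
      along \<open>s\<close>.\<close>
    have clamp_le: "(\<integral>\<^sup>+x. ennreal (h X x) \<partial>W0) \<le> N1" if "X \<ge> 0" for X
    proof (cases N1)
      case top
      then show ?thesis by simp
    next
      case (real c)
      have "(\<integral>x. h X x \<partial>W0) \<le> c + \<epsilon>" if "\<epsilon> > 0" for \<epsilon>
      proof -
        have "v X \<ge> 0" using v(4) \<open>X \<ge> 0\<close> .
        \<comment> \<open>Since \<open>h X\<close> is at most \<open>v X\<close>, cutting off
          outside the tightness ball loses at most
          \<open>v X * \<delta> \<le> \<epsilon>\<close>.\<close>
        define \<delta> where "\<delta> = \<epsilon> / (v X + 1)"
        have "\<delta> > 0" using \<open>\<epsilon> > 0\<close> \<open>v X \<ge> 0\<close> by (simp add: \<delta>_def)
        have "v X * \<delta> \<le> \<epsilon>"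
          using \<open>\<epsilon> > 0\<close> \<open>v X \<ge> 0\<close> by (simp add: \<delta>_def field_simps)
        obtain T where T: "T > 0" "whp \<delta> sequentially (\<lambda>n \<omega>. norm (S n \<omega>) \<le> T)"
          by (rule S_tight[OF \<open>\<delta> > 0\<close>])
        define \<phi> where "\<phi> y = max 0 (min 1 (T + 1 - norm y))" for y :: "real^'m"
        have \<phi>: "0 \<le> \<phi> y" "\<phi> y \<le> 1" "\<phi> (- y) = \<phi> y" "norm y \<le> T \<Longrightarrow> \<phi> y = 1"
          "norm y \<ge> T + 1 \<Longrightarrow> \<phi> y = 0" for y
          by (auto simp: \<phi>_def)
        have \<phi>_cont: "continuous_on UNIV \<phi>" unfolding \<phi>_def by (intro continuous_intros)
        define f0 where "f0 y = \<phi> y * v (q0 y)" for y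
        define f1 where "f1 y = \<phi> y * v (q1 y)" for y
        have f_cont: "continuous_on UNIV f0" "continuous_on UNIV f1"
          unfolding f0_def f1_def using q0 q1 \<phi>_cont
          by (intro continuous_on_mult continuous_on_compose2[OF v(2)]; auto)+
        have [measurable]: "\<phi> \<in> borel_measurable borel" "f0 \<in> borel_measurable borel" "f1 \<in> borel_measurable borel"
          using \<phi>_cont f_cont by (auto intro: borel_measurable_continuous_onI)
        have supp: "f0 y = 0" "f1 y = 0" if "norm y \<ge> T + 1" for y
          using \<phi>(5)[OF that] by (simp_all add: f0_def f1_def)
        have bounded: "\<exists>B. \<forall>y. \<bar>g y\<bar> \<le> B"
          if g: "continuous_on UNIV g" "\<And>y. norm y \<ge> T + 1 \<Longrightarrow> g y = 0" for g :: "real^'m \<Rightarrow> real"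
        proof -
          have "compact (g ` cball 0 (T + 1))"
            by (intro compact_continuous_image continuous_on_subset[OF g(1)]) auto
          then obtain B where B: "\<And>y. norm y \<le> T + 1 \<Longrightarrow> \<bar>g y\<bar> \<le> B"
            using compact_imp_bounded by (fastforce simp: bounded_iff)
          have "\<bar>g y\<bar> \<le> max B 0" for y
            using B[of y] g(2)[of y] by (cases "norm y \<le> T + 1") auto
          then show ?thesis by blast
        qed
        obtain B0 where B0: "\<And>y. \<bar>f0 y\<bar> \<le> B0" using bounded[OF f_cont(1) supp(1)] by blast
        obtain B1 where B1: "\<And>y. \<bar>f1 y\<bar> \<le> B1" using bounded[OF f_cont(2) supp(2)] by blast
        have int: "integrable M (\<lambda>\<omega>. f0 (Y \<omega>))" "integrable M (\<lambda>\<omega>. f1 (Y \<omega>))"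
          if "Y \<in> borel_measurable M" for Y
          by (rule integrable_const_bound[of _ B0], use B0 that in auto)
            (rule integrable_const_bound[of _ B1], use B1 that in auto)
        obtain I0 where I0: "(\<lambda>n. expectation (\<lambda>\<omega>. f0 (S n \<omega>))) \<longlonglongrightarrow> I0"
          by (rule compact_support_limit[OF f_cont(1) supp(1)])
        obtain I1 where I1: "(\<lambda>n. expectation (\<lambda>\<omega>. f1 (S n \<omega>))) \<longlonglongrightarrow> I1"
            "(\<lambda>n. expectation (\<lambda>\<omega>. f1 (- S n \<omega>))) \<longlonglongrightarrow> I1"
          by (rule compact_support_limit[OF f_cont(2) supp(2)])

        have "I0 \<le> I1"
        proof (rule LIMSEQ_le[OF I0])
          show "(\<lambda>n. (expectation (\<lambda>\<omega>. f1 (S n \<omega>)) + expectation (\<lambda>\<omega>. f1 (- S n \<omega>))) / 2) \<longlonglongrightarrow> I1"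
            using tendsto_divide[OF tendsto_add[OF I1] tendsto_const[of 2]] by simp
          have "f0 y \<le> (f1 y + f1 (- y)) / 2" for y
          proof -
            have "v (q0 y) \<le> v ((1 - 1/2) *\<^sub>R q1 y + (1/2) *\<^sub>R q1 (- y))"
              using mid[of y] by (intro monoD[OF v(1)]) simp
            also have "\<dots> \<le> (1 - 1/2) * v (q1 y) + (1/2) * v (q1 (- y))"
              by (rule convex_onD[OF v(3)]) auto
            finally have "\<phi> y * v (q0 y) \<le> \<phi> y * ((v (q1 y) + v (q1 (- y))) / 2)"
              using \<phi>(1) by (intro mult_left_mono) auto
            then show ?thesis by (simp add: f0_def f1_def \<phi>(3) algebra_simps)
          qed
          then have "expectation (\<lambda>\<omega>. f0 (S n \<omega>)) \<le> expectation (\<lambda>\<omega>. (f1 (S n \<omega>) + f1 (- S n \<omega>)) / 2)" for n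
            by (intro integral_mono int integrable_divide Bochner_Integration.integrable_add) auto
          moreover have "expectation (\<lambda>\<omega>. (f1 (S n \<omega>) + f1 (- S n \<omega>)) / 2)
              = (expectation (\<lambda>\<omega>. f1 (S n \<omega>)) + expectation (\<lambda>\<omega>. f1 (- S n \<omega>))) / 2" for n
            using int(2)[of "S n"] int(2)[of "\<lambda>\<omega>. - S n \<omega>"] by simp
          ultimately show "\<exists>N. \<forall>n\<ge>N. expectation (\<lambda>\<omega>. f0 (S n \<omega>))
              \<le> (expectation (\<lambda>\<omega>. f1 (S n \<omega>)) + expectation (\<lambda>\<omega>. f1 (- S n \<omega>))) / 2"
            by auto
        qed

        moreover have "(\<integral>x. h X x \<partial>W0) \<le> I0 + \<epsilon>"
        proof -
          have "whp \<delta> sequentially (\<lambda>n \<omega>. norm (S (r n) \<omega>) \<le> T)"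
            by (rule whp_filterlim[OF T(2) filterlim_subseq[OF r]])
          then have "whp \<delta> sequentially (\<lambda>n \<omega>. h X (q0 (S (r n) \<omega>)) * (1 - \<phi> (S (r n) \<omega>)) \<le> 0)"
            by (rule whp_mono) (auto simp: \<phi>(4))
          then have "\<forall>\<^sub>F n in sequentially.
              expectation (\<lambda>\<omega>. h X (q0 (S (r n) \<omega>)) * (1 - \<phi> (S (r n) \<omega>))) \<le> 0 + v X * \<delta>"
          proof (rule expectation_le_whp)
            fix n \<omega>
            have "\<bar>h X (q0 (S (r n) \<omega>)) * (1 - \<phi> (S (r n) \<omega>))\<bar> \<le> v X * 1"
              unfolding abs_mult using h(4)[OF \<open>X \<ge> 0\<close>] \<phi>(1,2)[of "S (r n) \<omega>"] \<open>v X \<ge> 0\<close>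
              by (intro mult_mono) auto
            then show "\<bar>h X (q0 (S (r n) \<omega>)) * (1 - \<phi> (S (r n) \<omega>))\<bar> \<le> v X" by simp
          qed auto
          then have "\<forall>\<^sub>F n in sequentially. expectation (\<lambda>\<omega>. h X (q0 (S (r n) \<omega>)))
              \<le> expectation (\<lambda>\<omega>. f0 (S (r n) \<omega>)) + \<epsilon>"
          proof eventually_elim
            case (elim n)
            have i1: "integrable M (\<lambda>\<omega>. h X (q0 (S (r n) \<omega>)))"
              by (rule int_h[OF \<open>X \<ge> 0\<close>]) measurable
            have i2: "integrable M (\<lambda>\<omega>. h X (q0 (S (r n) \<omega>)) * (1 - \<phi> (S (r n) \<omega>)))"
              by (rule Bochner_Integration.integrable_bound[OF i1])
                (use \<phi>(1,2) in \<open>auto simp: abs_mult intro!: mult_left_le\<close>)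
            have "expectation (\<lambda>\<omega>. h X (q0 (S (r n) \<omega>)))
                \<le> expectation (\<lambda>\<omega>. f0 (S (r n) \<omega>) + h X (q0 (S (r n) \<omega>)) * (1 - \<phi> (S (r n) \<omega>)))"
            proof (intro integral_mono i1 i2 int Bochner_Integration.integrable_add)
              fix \<omega>
              have "\<phi> (S (r n) \<omega>) * h X (q0 (S (r n) \<omega>)) \<le> f0 (S (r n) \<omega>)"
                unfolding f0_def using \<phi>(1) q0(2) by (intro mult_left_mono h_le) auto
              then show "h X (q0 (S (r n) \<omega>)) \<le> f0 (S (r n) \<omega>) + h X (q0 (S (r n) \<omega>)) * (1 - \<phi> (S (r n) \<omega>))"
                by (simp add: algebra_simps)
            qed simp
            also have "\<dots> = expectation (\<lambda>\<omega>. f0 (S (r n) \<omega>))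
                + expectation (\<lambda>\<omega>. h X (q0 (S (r n) \<omega>)) * (1 - \<phi> (S (r n) \<omega>)))"
              by (intro Bochner_Integration.integral_add int i2) simp
            finally show ?case using elim \<open>v X * \<delta> \<le> \<epsilon>\<close> by linarith
          qed
          moreover have "(\<lambda>n. expectation (\<lambda>\<omega>. h X (q0 (S (r n) \<omega>)))) \<longlonglongrightarrow> (\<integral>x. h X x \<partial>W0)"
            using h(1,4)[OF \<open>X \<ge> 0\<close>] by (rule lim0)
          moreover have "(\<lambda>n. expectation (\<lambda>\<omega>. f0 (S (r n) \<omega>)) + \<epsilon>) \<longlonglongrightarrow> I0 + \<epsilon>"
            using LIMSEQ_subseq_LIMSEQ[OF I0 r] by (intro tendsto_intros) (simp add: o_def)
          ultimately show ?thesis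
            by (intro tendsto_le[OF sequentially_bot, rotated])
        qed

        moreover have "I1 \<le> c"
        proof -
          have "compact (q1 ` cball 0 (T + 1))"
            by (intro compact_continuous_image continuous_on_subset[OF q1(1)]) auto
          then obtain X1' where X1': "\<And>y. norm y \<le> T + 1 \<Longrightarrow> \<bar>q1 y\<bar> \<le> X1'"
            using compact_imp_bounded by (fastforce simp: bounded_iff)
          \<comment> \<open>\<open>X1\<close> bounds \<open>q1\<close> on the ball containing the
            support of the cutoff. Truncation at \<open>X1\<close> leaves \<open>v (q1 y)\<close>
            unchanged there, so \<open>f1\<close> lies below a bounded test function of
            \<open>q1\<close>.\<close>
          define X1 where "X1 = max X1' 0"
          have "X1 \<ge> 0" by (simp add: X1_def)
          have f1_le: "f1 y \<le> h X1 (q1 y)" for y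
          proof (cases "norm y \<le> T + 1")
            case True
            then have "h X1 (q1 y) = v (q1 y)"
              using X1'[of y] q1(2)[of y] by (simp add: h_def X1_def)
            moreover have "\<phi> y * v (q1 y) \<le> 1 * v (q1 y)"
              using \<phi>(2) v(4) q1(2) by (intro mult_right_mono) auto
            ultimately show ?thesis by (simp add: f1_def)
          next
            case False
            then show ?thesis using supp(2)[of y] h(2)[OF \<open>X1 \<ge> 0\<close>] by simp
          qed
          have "I1 \<le> (\<integral>x. h X1 x \<partial>W1)"
          proof (rule LIMSEQ_le)
            show "(\<lambda>n. expectation (\<lambda>\<omega>. f1 (S (s n) \<omega>))) \<longlonglongrightarrow> I1"
              using LIMSEQ_subseq_LIMSEQ[OF I1(1) s] by (simp add: o_def)
            show "(\<lambda>n. expectation (\<lambda>\<omega>. h X1 (q1 (S (s n) \<omega>)))) \<longlonglongrightarrow> (\<integral>x. h X1 x \<partial>W1)"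
              using h(1,4)[OF \<open>X1 \<ge> 0\<close>] by (rule lim1)
            have "expectation (\<lambda>\<omega>. f1 (S (s n) \<omega>)) \<le> expectation (\<lambda>\<omega>. h X1 (q1 (S (s n) \<omega>)))" for n
              using f1_le by (intro integral_mono int int_h \<open>X1 \<ge> 0\<close>) auto
            then show "\<exists>N. \<forall>n\<ge>N. expectation (\<lambda>\<omega>. f1 (S (s n) \<omega>)) \<le> expectation (\<lambda>\<omega>. h X1 (q1 (S (s n) \<omega>)))"
              by blast
          qed
          also have "\<dots> \<le> c"
          proof -
            have "integrable W1 (h X1)"
              using h(4)[OF \<open>X1 \<ge> 0\<close>] by (intro W1.integrable_const_bound[of _ "v X1"]) auto
            then have "ennreal (\<integral>x. h X1 x \<partial>W1) = (\<integral>\<^sup>+x. ennreal (h X1 x) \<partial>W1)"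
              using h(2)[OF \<open>X1 \<ge> 0\<close>] by (intro nn_integral_eq_integral[symmetric]) auto
            also have "\<dots> \<le> N1" unfolding N1_def
              using AE1 by (intro nn_integral_mono_AE) (auto elim!: eventually_mono intro!: ennreal_leI h_le)
            finally show ?thesis using real by simp
          qed
          finally show ?thesis .
        qed
        ultimately show ?thesis by linarith
      qed
      then have "(\<integral>x. h X x \<partial>W0) \<le> c" by (rule field_le_epsilon)
      moreover have "integrable W0 (h X)"
        using h(4)[OF \<open>X \<ge> 0\<close>] by (intro W0.integrable_const_bound[of _ "v X"]) auto
      then have "(\<integral>\<^sup>+x. ennreal (h X x) \<partial>W0) = ennreal (\<integral>x. h X x \<partial>W0)"
        using h(2)[OF \<open>X \<ge> 0\<close>] by (intro nn_integral_eq_integral) auto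
      ultimately show ?thesis using real by (simp add: ennreal_leI)
    qed
    have "(\<integral>\<^sup>+x. ennreal (v x) \<partial>W0) = (\<integral>\<^sup>+x. (SUP k. ennreal (h (real k) x)) \<partial>W0)"
    proof (rule nn_integral_cong_AE)
      show "AE x in W0. ennreal (v x) = (SUP k. ennreal (h (real k) x))"
        using AE0
      proof eventually_elim
        case (elim x)
        obtain k where k: "x \<le> real k" using real_arch_simple by blast
        show ?case
        proof (rule antisym)
          have "v x = h (real k) x" using k elim by (simp add: h_def)
          then show "ennreal (v x) \<le> (SUP k. ennreal (h (real k) x))"
            by (intro SUP_upper2[of k]) auto
          show "(SUP k. ennreal (h (real k) x)) \<le> ennreal (v x)"
            using elim by (intro SUP_least ennreal_leI h_le)
        qed
      qed
    qed
    also have "\<dots> = (SUP k. \<integral>\<^sup>+x. ennreal (h (real k) x) \<partial>W0)"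
    proof (rule nn_integral_monotone_convergence_SUP)
      show "incseq (\<lambda>k x. ennreal (h (real k) x))"
        by (auto simp: mono_def le_fun_def h_def intro!: ennreal_leI monoD[OF v(1)])
    qed measurable
    also have "\<dots> \<le> N1" by (intro SUP_least clamp_le) simp
    finally show "(\<integral>\<^sup>+x. ennreal (v x) \<partial>W0) \<le> (\<integral>\<^sup>+x. ennreal (v x) \<partial>W1)" by (simp add: N1_def)
  qed
qed

end

subsection \<open>Stochastic expansions\<close>

text \<open>The difference of the two forms splits as
  \<open>(u - w) \<bullet> H u + w \<bullet> H (u - w)\<close>, which respects the order of the
  factors and so suits a matrix \<open>H\<close> that is not assumed symmetric.\<close>

lemma quadratic_form_diff:
  fixes H :: "real^'d^'d"
  assumes h: "\<And>v. norm (H *v v) \<le> h * norm v" and "h \<ge> 0"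
  shows "\<bar>u \<bullet> (H *v u) / 2 - w \<bullet> (H *v w) / 2\<bar> \<le> h * norm (u - w) * (norm u + norm w)"
proof -
  have "u \<bullet> (H *v u) - w \<bullet> (H *v w) = (u - w) \<bullet> (H *v u) + w \<bullet> (H *v (u - w))"
    by (simp add: inner_diff_left inner_diff_right matrix_vector_mult_diff_distrib)
  also have "\<bar>\<dots>\<bar> \<le> norm (u - w) * norm (H *v u) + norm w * norm (H *v (u - w))"
    by (intro order.trans[OF abs_triangle_ineq] add_mono Cauchy_Schwarz_ineq2)
  also have "\<dots> \<le> norm (u - w) * (h * norm u) + norm w * (h * norm (u - w))"
    by (intro add_mono mult_left_mono h) auto
  also have "\<dots> = h * norm (u - w) * (norm u + norm w)" by (simp add: algebra_simps)
  finally have "\<bar>u \<bullet> (H *v u) - w \<bullet> (H *v w)\<bar> \<le> h * norm (u - w) * (norm u + norm w)" .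
  moreover have "0 \<le> h * norm (u - w) * (norm u + norm w)" using \<open>h \<ge> 0\<close> by simp
  moreover have "\<bar>u \<bullet> (H *v u) / 2 - w \<bullet> (H *v w) / 2\<bar> = \<bar>u \<bullet> (H *v u) - w \<bullet> (H *v w)\<bar> / 2"
    by (simp add: diff_divide_distrib[symmetric])
  ultimately show ?thesis by linarith
qed

lemma tendsto_mult_inverse_sqrt_0: "(\<lambda>n. c * (1 / sqrt (real n))) \<longlonglongrightarrow> 0"
  by (intro tendsto_mult_right_zero tendsto_divide_0[OF tendsto_const] filterlim_at_top_imp_at_infinity
      filterlim_compose[OF sqrt_at_top filterlim_real_sequentially])

text \<open>Failure of divergence leaves, for some \<open>Z\<close>, infinitely many indices with
  \<open>\<bar>a n\<bar> < Z\<close>; Bolzano-Weierstrass applies along them.\<close>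

lemma convergent_subsequence_if_not_divergent:
  fixes a :: "nat \<Rightarrow> real"
  assumes "\<not> filterlim (\<lambda>n. \<bar>a n\<bar>) at_top sequentially"
  obtains t c where "strict_mono t" "(\<lambda>n. a (t n)) \<longlonglongrightarrow> c"
proof -
  from assms obtain Z where "\<not> (\<forall>\<^sub>F n in sequentially. Z \<le> \<bar>a n\<bar>)"
    by (auto simp: filterlim_at_top)
  then have "\<exists>\<^sub>F n in sequentially. \<not> Z \<le> \<bar>a n\<bar>" by (simp add: frequently_def)
  then have "infinite {n. \<not> Z \<le> \<bar>a n\<bar>}"
    by (simp add: cofinite_eq_sequentially[symmetric] frequently_cofinite)
  then obtain t1 :: "nat \<Rightarrow> nat" where t1: "strict_mono t1" "\<And>n. t1 n \<in> {n. \<not> Z \<le> \<bar>a n\<bar>}"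
    using infinite_enumerate by blast
  have "bounded (range (a \<circ> t1))"
    unfolding bounded_iff using t1(2) by (intro exI[of _ Z]) (auto intro: less_imp_le simp: not_le)
  then obtain c t2 where "strict_mono t2" "((a \<circ> t1) \<circ> t2) \<longlonglongrightarrow> c"
    using bounded_imp_convergent_subsequence by blast
  then show ?thesis
    using t1(1) by (intro that[of "t1 \<circ> t2" c]) (auto simp: o_def strict_mono_def)
qed

text \<open>The ramp \<open>h T\<close> is 1 below \<open>T\<close> and 0 above
  \<open>T + 1\<close>. As the mass of \<open>Y n\<close> moves beyond every level, the integral of
  \<open>h T\<close> under \<open>W\<close> is at most 0 for every \<open>T\<close>; yet that
  integral tends to 1 as \<open>T\<close> grows.\<close>

lemma (in prob_space) divergent_not_weakly_convergent:
  fixes Y :: "nat \<Rightarrow> 'a \<Rightarrow> real"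
  assumes Y: "\<And>n. Y n \<in> borel_measurable M"
    and div: "\<And>c \<delta>. \<delta> > 0 \<Longrightarrow> whp \<delta> sequentially (\<lambda>n \<omega>. c \<le> Y n \<omega>)"
    and W: "real_distribution W" and conv: "weak_conv_m (\<lambda>n. distr M borel (Y n)) W"
  shows False
proof -
  interpret W: real_distribution W by fact
  define h where "h T x = T + 1 - min (T + 1) (max T x)" for T x :: real
  have [measurable]: "h T \<in> borel_measurable borel" for T unfolding h_def by measurable
  have h_cont: "uniformly_continuous_on UNIV (h T)" for T
    unfolding h_def by (rule uniformly_continuous_clamp[of "\<lambda>x. T + 1 - x"]) (auto intro!: continuous_intros)
  have h_bd: "\<bar>h T x\<bar> \<le> 1" for T x by (simp add: h_def min_def max_def)
  have "(\<integral>x. h T x \<partial>W) \<le> 0" for T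
  proof (rule field_le_epsilon)
    fix \<delta> :: real assume "\<delta> > 0"
    have close: "whp \<delta> sequentially (\<lambda>n \<omega>. \<bar>Y n \<omega> - Y n \<omega>\<bar> \<le> \<epsilon>)" if "\<epsilon> > 0" "\<delta> > 0" for \<epsilon> \<delta>
      by (rule whp_mono[OF div[OF that(2)]]) (use that in auto)
    have "(\<lambda>n. expectation (\<lambda>\<omega>. h T (Y n \<omega>))) \<longlonglongrightarrow> (\<integral>x. h T x \<partial>W)"
      by (rule weak_limit_expectation[OF W conv h_cont h_bd Y Y close])
    moreover have "whp \<delta> sequentially (\<lambda>n \<omega>. h T (Y n \<omega>) \<le> 0)"
      by (rule whp_mono[OF div[OF \<open>\<delta> > 0\<close>, of "T + 1"]]) (auto simp: h_def)
    then have "\<forall>\<^sub>F n in sequentially. expectation (\<lambda>\<omega>. h T (Y n \<omega>)) \<le> 0 + 1 * \<delta>"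
      by (rule expectation_le_whp) (use Y h_bd in auto)
    ultimately show "(\<integral>x. h T x \<partial>W) \<le> 0 + \<delta>"
      by (intro tendsto_upperbound) auto
  qed
  moreover have "(\<lambda>k. \<integral>x. h (real k) x \<partial>W) \<longlonglongrightarrow> (\<integral>x. 1 \<partial>W)"
  proof (rule integral_dominated_convergence[where w="\<lambda>_. 1"])
    show "AE x in W. (\<lambda>k. h (real k) x) \<longlonglongrightarrow> 1"
    proof (rule AE_I2)
      fix x :: real
      obtain k0 where k0: "x \<le> real k0" using real_arch_simple by blast
      have "\<forall>\<^sub>F k in sequentially. 1 = h (real k) x"
        using eventually_ge_at_top[of k0] by eventually_elim (use k0 in \<open>auto simp: h_def\<close>)
      then show "(\<lambda>k. h (real k) x) \<longlonglongrightarrow> 1" by (rule Lim_transform_eventually[OF tendsto_const])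
    qed
  qed (use h_bd in auto)
  ultimately have "(\<integral>x. 1 \<partial>W) \<le> (0 :: real)"
    by (intro tendsto_upperbound[where F=sequentially]) auto
  then show False using W.prob_space by simp
qed

text \<open>\<open>\<X>\<close> is an arbitrary set and \<open>Z\<close> is regular only near it.
  The interior \<open>U\<close> of the set of continuity points is open and contains
  \<open>\<X>\<close>, so \<open>Z\<close> times the indicator of \<open>U\<close> is Borel and
  agrees with \<open>Z\<close> at all values of \<open>X\<close>.\<close>

lemma measurable_comp_differentiable:
  fixes Z :: "real^'d \<Rightarrow> real"
  assumes X: "X \<in> borel_measurable M" "\<And>\<omega>. \<omega> \<in> space M \<Longrightarrow> X \<omega> \<in> \<X>"
    and Z: "\<forall>x\<in>\<X>. twice_differentiable_at Z x"
  shows "(\<lambda>\<omega>. Z (X \<omega>)) \<in> borel_measurable M"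
proof -
  define U where "U = interior {x. isCont Z x}"
  have "\<X> \<subseteq> U"
  proof
    fix x assume "x \<in> \<X>"
    then have "\<forall>\<^sub>F y in nhds x. Z differentiable (at y)"
      using Z by (simp add: twice_differentiable_at_def)
    then have "\<forall>\<^sub>F y in nhds x. isCont Z y"
      by eventually_elim (rule differentiable_imp_continuous_within)
    then show "x \<in> U" unfolding U_def interior_def eventually_nhds by blast
  qed
  have "continuous_on U Z"
    unfolding U_def using interior_subset by (blast intro: continuous_at_imp_continuous_on)
  then have "(\<lambda>x. indicator U x *\<^sub>R Z x) \<in> borel_measurable borel"
    by (intro borel_measurable_continuous_on_indicator) (auto simp: U_def)
  from measurable_compose[OF X(1) this] have "(\<lambda>\<omega>. indicator U (X \<omega>) *\<^sub>R Z (X \<omega>)) \<in> borel_measurable M" .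
  then show ?thesis
    by (rule measurable_cong[THEN iffD1, rotated]) (use X(2) \<open>\<X> \<subseteq> U\<close> in \<open>auto simp: indicator_def\<close>)
qed

context iid_finite_covariance
begin

lemma norm_emp_dev:
  assumes "n \<ge> 1" "norm (S n \<omega>) \<le> T"
  shows "norm (emp_dev P \<xi> n f \<omega>) \<le> T * (1 / sqrt (real n))"
  using assms by (simp add: S_def field_simps)

text \<open>With high probability \<open>S\<close> is bounded, the estimator follows its expansion
  and \<open>X\<close> is near \<open>xs\<close>. Then the estimation error is at most
  \<open>(T + 1) / sqrt n\<close> and the deterministic expansion \<open>local\<close> applies. The
  filter \<open>F\<close> with the map \<open>N\<close> covers the joint limit in \<open>n\<close>
  and the penalty as well as subsequences of \<open>n\<close>.\<close>

lemma argmin_expansion_whp: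
  fixes X :: "'i \<Rightarrow> 'w \<Rightarrow> real^'d" and A :: "real^'m^'d"
  assumes local: "\<And>\<epsilon>. \<epsilon> > 0 \<Longrightarrow> \<exists>\<eta>>0. \<forall>x \<theta> l. norm (x - xs) < \<eta> \<longrightarrow> norm (\<theta> - \<theta>s) < \<eta> \<longrightarrow> opt \<theta> l x \<longrightarrow>
      norm (x - xs + A *v (\<theta> - \<theta>s) + l *\<^sub>R g) \<le> \<epsilon> * (norm (\<theta> - \<theta>s) + \<bar>l\<bar>)"
    and \<theta>: "\<And>\<epsilon> \<delta>. \<epsilon> > 0 \<Longrightarrow> \<delta> > 0 \<Longrightarrow>
      whp \<delta> sequentially (\<lambda>n \<omega>. norm (\<theta>h n \<omega> - \<theta>s - emp_dev P \<xi> n f \<omega>) \<le> \<epsilon> * (1 / sqrt (real n)))"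
    and N: "filterlim N sequentially F"
    and cons: "\<And>\<epsilon> \<delta>. \<epsilon> > 0 \<Longrightarrow> \<delta> > 0 \<Longrightarrow> whp \<delta> F (\<lambda>i \<omega>. norm (X i \<omega> - xs) \<le> \<epsilon>)"
    and opt: "\<forall>\<^sub>F i in F. \<forall>\<omega>\<in>space M. opt (\<theta>h (N i) \<omega>) (l i) (X i \<omega>)"
    and "\<epsilon> > 0" "\<delta> > 0"
  shows "whp \<delta> F (\<lambda>i \<omega>. norm (X i \<omega> - xs + A *v emp_dev P \<xi> (N i) f \<omega> + l i *\<^sub>R g)
    \<le> \<epsilon> * (1 / sqrt (real (N i)) + \<bar>l i\<bar>))"
proof -
  obtain B where B: "B > 0" "\<And>v. norm (A *v v) \<le> B * norm v"
    using matrix_vector_bound[of A] by blast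
  obtain T where T: "T > 0" "whp (\<delta>/3) sequentially (\<lambda>n \<omega>. norm (S n \<omega>) \<le> T)"
    using S_tight[of "\<delta>/3"] \<open>\<delta> > 0\<close> by auto
  \<comment> \<open>\<open>e0\<close> pays for the deterministic remainder, \<open>e1\<close> for
    replacing the estimation error by the empirical deviation under \<open>A\<close>; each takes
    half of \<open>\<epsilon>\<close> in the \<open>1 / sqrt n\<close> term.\<close>
  define e0 where "e0 = \<epsilon> / (2 * (T + 1))"
  define e1 where "e1 = min 1 (\<epsilon> / (2 * B))"
  have e: "e0 > 0" "e0 \<le> \<epsilon>" "e0 * (T + 1) = \<epsilon> / 2" "e1 > 0" "e1 \<le> 1" "B * e1 \<le> \<epsilon> / 2"
  proof -
    show "e0 > 0" "e0 \<le> \<epsilon>" "e0 * (T + 1) = \<epsilon> / 2"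
      using T(1) \<open>\<epsilon> > 0\<close> by (auto simp: e0_def field_simps)
    show "e1 > 0" "e1 \<le> 1" using B(1) \<open>\<epsilon> > 0\<close> by (auto simp: e1_def)
    have "B * e1 \<le> B * (\<epsilon> / (2 * B))" using B(1) by (intro mult_left_mono) (auto simp: e1_def)
    then show "B * e1 \<le> \<epsilon> / 2" using B(1) by simp
  qed
  obtain \<eta> where \<eta>: "\<eta> > 0" "\<And>x \<theta> l. norm (x - xs) < \<eta> \<Longrightarrow> norm (\<theta> - \<theta>s) < \<eta> \<Longrightarrow> opt \<theta> l x \<Longrightarrow>
      norm (x - xs + A *v (\<theta> - \<theta>s) + l *\<^sub>R g) \<le> e0 * (norm (\<theta> - \<theta>s) + \<bar>l\<bar>)"
    using local[OF e(1)] by blast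
  have "whp (\<delta>/3) F (\<lambda>i \<omega>. norm (S (N i) \<omega>) \<le> T)"
    by (rule whp_filterlim[OF T(2) N])
  moreover have "whp (\<delta>/3) F (\<lambda>i \<omega>. norm (\<theta>h (N i) \<omega> - \<theta>s - emp_dev P \<xi> (N i) f \<omega>)
      \<le> e1 * (1 / sqrt (real (N i))))"
    using \<open>\<delta> > 0\<close> e by (intro whp_filterlim[OF \<theta> N]) auto
  moreover have "whp (\<delta>/3) F (\<lambda>i \<omega>. norm (X i \<omega> - xs) \<le> \<eta>/2)"
    using \<open>\<delta> > 0\<close> \<eta>(1) by (intro cons) auto
  ultimately have good: "whp (\<delta>/3 + (\<delta>/3 + \<delta>/3)) F (\<lambda>i \<omega>. norm (S (N i) \<omega>) \<le> T \<and>
      norm (\<theta>h (N i) \<omega> - \<theta>s - emp_dev P \<xi> (N i) f \<omega>) \<le> e1 * (1 / sqrt (real (N i))) \<and>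
      norm (X i \<omega> - xs) \<le> \<eta>/2)"
    by (intro whp_conj)
  note tendsto_mult_inverse_sqrt_0[of "T + 1"]
  then have "\<forall>\<^sub>F n in sequentially. (T + 1) * (1 / sqrt (real n)) < \<eta>"
    using \<eta>(1) by (rule order_tendstoD(2))
  then have "\<forall>\<^sub>F n in sequentially. n \<ge> 1 \<and> (T + 1) * (1 / sqrt (real n)) < \<eta>"
    using eventually_ge_at_top[of 1] by eventually_elim auto
  then have large: "\<forall>\<^sub>F i in F. N i \<ge> 1 \<and> (T + 1) * (1 / sqrt (real (N i))) < \<eta>"
    using N by (rule eventually_compose_filterlim)
  from good have "whp (\<delta>/3 + (\<delta>/3 + \<delta>/3)) F (\<lambda>i \<omega>. norm (X i \<omega> - xs + A *v emp_dev P \<xi> (N i) f \<omega> + l i *\<^sub>R g)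
    \<le> \<epsilon> * (1 / sqrt (real (N i)) + \<bar>l i\<bar>))"
  proof (rule whp_mono)
    show "\<forall>\<^sub>F i in F. \<forall>\<omega>\<in>space M. norm (S (N i) \<omega>) \<le> T \<and>
      norm (\<theta>h (N i) \<omega> - \<theta>s - emp_dev P \<xi> (N i) f \<omega>) \<le> e1 * (1 / sqrt (real (N i))) \<and>
      norm (X i \<omega> - xs) \<le> \<eta>/2 \<longrightarrow> norm (X i \<omega> - xs + A *v emp_dev P \<xi> (N i) f \<omega> + l i *\<^sub>R g)
        \<le> \<epsilon> * (1 / sqrt (real (N i)) + \<bar>l i\<bar>)"
      using large opt
    proof eventually_elim
      case (elim i)
      show ?case
      proof (intro ballI impI)
        fix \<omega> assume \<omega>: "\<omega> \<in> space M" and H: "norm (S (N i) \<omega>) \<le> T \<and>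
          norm (\<theta>h (N i) \<omega> - \<theta>s - emp_dev P \<xi> (N i) f \<omega>) \<le> e1 * (1 / sqrt (real (N i))) \<and>
          norm (X i \<omega> - xs) \<le> \<eta>/2"
        define \<tau> where "\<tau> = 1 / sqrt (real (N i))"
        define k where "k = \<theta>h (N i) \<omega> - \<theta>s"
        define d where "d = emp_dev P \<xi> (N i) f \<omega>"
        have "\<tau> \<ge> 0" by (simp add: \<tau>_def)
        have d: "norm d \<le> T * \<tau>" unfolding d_def \<tau>_def using H elim by (intro norm_emp_dev) auto
        have kd: "norm (k - d) \<le> e1 * \<tau>" using H by (simp add: k_def d_def \<tau>_def)
        have "norm k \<le> norm (k - d) + norm d" by norm
        also have "\<dots> \<le> 1 * \<tau> + T * \<tau>"
          using d kd mult_right_mono[OF e(5) \<open>\<tau> \<ge> 0\<close>] by linarith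
        finally have k: "norm k \<le> (T + 1) * \<tau>" by (simp add: algebra_simps)
        have main: "norm (X i \<omega> - xs + A *v k + l i *\<^sub>R g) \<le> e0 * (norm k + \<bar>l i\<bar>)"
          unfolding k_def
        proof (rule \<eta>(2))
          show "norm (X i \<omega> - xs) < \<eta>" using H \<eta>(1) by linarith
          show "norm (\<theta>h (N i) \<omega> - \<theta>s) < \<eta>" using k elim by (simp add: k_def \<tau>_def)
          show "opt (\<theta>h (N i) \<omega>) (l i) (X i \<omega>)" using elim \<omega> by blast
        qed
        have "X i \<omega> - xs + A *v d + l i *\<^sub>R g = (X i \<omega> - xs + A *v k + l i *\<^sub>R g) - A *v (k - d)"
          by (simp add: matrix_vector_mult_diff_distrib)
        then have "norm (X i \<omega> - xs + A *v d + l i *\<^sub>R g)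
            \<le> norm (X i \<omega> - xs + A *v k + l i *\<^sub>R g) + norm (A *v (k - d))"
          by (simp only: norm_triangle_ineq4)
        also have "\<dots> \<le> e0 * ((T + 1) * \<tau> + \<bar>l i\<bar>) + B * (e1 * \<tau>)"
        proof (intro add_mono)
          show "norm (X i \<omega> - xs + A *v k + l i *\<^sub>R g) \<le> e0 * ((T + 1) * \<tau> + \<bar>l i\<bar>)"
            by (rule order.trans[OF main]) (use k e(1) in auto)
          show "norm (A *v (k - d)) \<le> B * (e1 * \<tau>)"
            by (rule order.trans[OF B(2)]) (use kd B(1) in auto)
        qed
        also have "\<dots> = (e0 * (T + 1)) * \<tau> + e0 * \<bar>l i\<bar> + (B * e1) * \<tau>" by (simp add: algebra_simps)
        also have "\<dots> \<le> \<epsilon> / 2 * \<tau> + \<epsilon> * \<bar>l i\<bar> + \<epsilon> / 2 * \<tau>"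
          using e \<open>\<tau> \<ge> 0\<close> by (intro add_mono mult_right_mono) auto
        also have "\<dots> = \<epsilon> * (\<tau> + \<bar>l i\<bar>)" by (simp add: algebra_simps)
        finally show "norm (X i \<omega> - xs + A *v emp_dev P \<xi> (N i) f \<omega> + l i *\<^sub>R g)
          \<le> \<epsilon> * (1 / sqrt (real (N i)) + \<bar>l i\<bar>)" by (simp add: d_def \<tau>_def)
      qed
    qed
  qed
  then show ?thesis by simp
qed

text \<open>At the scale \<open>V = sqrt n * (X - xs)\<close> the expansion reads
  \<open>V = - A S - c g + o(1)\<close>, because \<open>sqrt n\<close> times its error is
  \<open>\<epsilon> * (1 + \<bar>sqrt n * l\<bar>)\<close> and \<open>sqrt n * l\<close> converges.
  As \<open>V\<close> stays bounded with high probability, the Taylor remainder of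
  \<open>n G\<close> is negligible.\<close>

lemma scaled_excess_limit:
  fixes X :: "'i \<Rightarrow> 'w \<Rightarrow> real^'d" and A :: "real^'m^'d" and H :: "real^'d^'d"
  assumes taylor: "\<And>\<epsilon>. \<epsilon> > 0 \<Longrightarrow> \<exists>\<eta>>0. \<forall>v. norm v < \<eta> \<longrightarrow>
      \<bar>G (xs + v) - v \<bullet> (H *v v) / 2\<bar> \<le> \<epsilon> * (norm v)\<^sup>2"
    and exp: "\<And>\<epsilon> \<delta>. \<epsilon> > 0 \<Longrightarrow> \<delta> > 0 \<Longrightarrow>
      whp \<delta> F (\<lambda>i \<omega>. norm (X i \<omega> - xs + A *v emp_dev P \<xi> (N i) f \<omega> + l i *\<^sub>R g)
        \<le> \<epsilon> * (1 / sqrt (real (N i)) + \<bar>l i\<bar>))"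
    and N: "filterlim N sequentially F" and c: "((\<lambda>i. sqrt (real (N i)) * l i) \<longlongrightarrow> c) F"
    and "\<epsilon> > 0" "\<delta> > 0"
  shows "whp \<delta> F (\<lambda>i \<omega>. \<bar>real (N i) * G (X i \<omega>)
    - (- (A *v S (N i) \<omega>) - c *\<^sub>R g) \<bullet> (H *v (- (A *v S (N i) \<omega>) - c *\<^sub>R g)) / 2\<bar> \<le> \<epsilon>)"
proof -
  obtain B where B: "B > 0" "\<And>v. norm (A *v v) \<le> B * norm v"
    using matrix_vector_bound[of A] by blast
  obtain h where h: "h > 0" "\<And>v. norm (H *v v) \<le> h * norm v"
    using matrix_vector_bound[of H] by blast
  obtain T where T: "T > 0" "whp (\<delta>/2) sequentially (\<lambda>n \<omega>. norm (S n \<omega>) \<le> T)"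
    using S_tight[of "\<delta>/2"] \<open>\<delta> > 0\<close> by auto
  \<comment> \<open>Bounds \<open>norm w + 1\<close> for the limiting argument \<open>w\<close> of
    the quadratic form, hence also \<open>norm V\<close>, as \<open>V\<close> will differ from
    \<open>w\<close> by at most \<open>\<epsilon>' \<le> 1\<close>.\<close>
  define D where "D = B * T + \<bar>c\<bar> * norm g + 1"
  have "D \<ge> 1" using B T by (simp add: D_def)
  define \<epsilon>' where "\<epsilon>' = min 1 (\<epsilon> / (4 * h * D))"
  have \<epsilon>': "\<epsilon>' > 0" "\<epsilon>' \<le> 1" "h * \<epsilon>' * (2 * D) \<le> \<epsilon> / 2"
  proof -
    show "\<epsilon>' > 0" "\<epsilon>' \<le> 1" using h \<open>D \<ge> 1\<close> \<open>\<epsilon> > 0\<close> by (auto simp: \<epsilon>'_def)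
    have "h * \<epsilon>' * (2 * D) \<le> h * (\<epsilon> / (4 * h * D)) * (2 * D)"
      using h \<open>D \<ge> 1\<close> by (intro mult_right_mono mult_left_mono) (auto simp: \<epsilon>'_def)
    also have "\<dots> = \<epsilon> / 2" using h \<open>D \<ge> 1\<close> by (simp add: field_simps)
    finally show "h * \<epsilon>' * (2 * D) \<le> \<epsilon> / 2" .
  qed
  \<comment> \<open>The factor \<open>2 + \<bar>c\<bar>\<close> bounds
    \<open>1 + \<bar>sqrt n * l\<bar>\<close> once \<open>sqrt n * l\<close> is within
    \<open>e2 \<le> 1\<close> of \<open>c\<close>.\<close>
  define e1 where "e1 = \<epsilon>' / (2 * (2 + \<bar>c\<bar>))"
  have e1: "e1 > 0" "e1 * (2 + \<bar>c\<bar>) = \<epsilon>' / 2" using \<epsilon>' by (auto simp: e1_def field_simps)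
  define e2 where "e2 = min 1 (\<epsilon>' / (2 * (norm g + 1)))"
  have e2: "e2 > 0" "e2 \<le> 1" "e2 * norm g \<le> \<epsilon>' / 2"
  proof -
    have pos: "norm g + 1 > 0" by (simp add: add_nonneg_pos)
    then show "e2 > 0" "e2 \<le> 1" using \<epsilon>' by (auto simp: e2_def)
    have "e2 * norm g \<le> (\<epsilon>' / (2 * (norm g + 1))) * (norm g + 1)"
      using \<epsilon>' pos by (intro mult_mono) (auto simp: e2_def)
    also have "\<dots> = \<epsilon>' / 2" using pos by (simp add: field_simps)
    finally show "e2 * norm g \<le> \<epsilon>' / 2" .
  qed
  obtain \<eta> where \<eta>: "\<eta> > 0" "\<And>v. norm v < \<eta> \<Longrightarrow>
      \<bar>G (xs + v) - v \<bullet> (H *v v) / 2\<bar> \<le> \<epsilon> / (2 * D\<^sup>2) * (norm v)\<^sup>2"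
    using taylor[of "\<epsilon> / (2 * D\<^sup>2)"] \<open>\<epsilon> > 0\<close> \<open>D \<ge> 1\<close> by auto
  have "whp (\<delta>/2 + \<delta>/2) F (\<lambda>i \<omega>. norm (S (N i) \<omega>) \<le> T \<and>
      norm (X i \<omega> - xs + A *v emp_dev P \<xi> (N i) f \<omega> + l i *\<^sub>R g) \<le> e1 * (1 / sqrt (real (N i)) + \<bar>l i\<bar>))"
    using \<open>\<delta> > 0\<close> e1(1) by (intro whp_conj whp_filterlim[OF T(2) N] exp) auto
  moreover have "\<delta>/2 + \<delta>/2 = \<delta>" by simp
  ultimately have "whp \<delta> F (\<lambda>i \<omega>. norm (S (N i) \<omega>) \<le> T \<and>
      norm (X i \<omega> - xs + A *v emp_dev P \<xi> (N i) f \<omega> + l i *\<^sub>R g) \<le> e1 * (1 / sqrt (real (N i)) + \<bar>l i\<bar>))"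
    by simp
  then show ?thesis
  proof (rule whp_mono)
    note tendsto_mult_inverse_sqrt_0[of D]
    then have "\<forall>\<^sub>F n in sequentially. D * (1 / sqrt (real n)) < \<eta>"
      using \<eta>(1) by (rule order_tendstoD(2))
    then have "\<forall>\<^sub>F n in sequentially. n \<ge> 1 \<and> D * (1 / sqrt (real n)) < \<eta>"
      using eventually_ge_at_top[of 1] by eventually_elim auto
    then have "\<forall>\<^sub>F i in F. N i \<ge> 1 \<and> D * (1 / sqrt (real (N i))) < \<eta>"
      using N by (rule eventually_compose_filterlim)
    moreover have "\<forall>\<^sub>F i in F. dist (sqrt (real (N i)) * l i) c < e2"
      using c e2(1) by (rule tendstoD)
    ultimately show "\<forall>\<^sub>F i in F. \<forall>\<omega>\<in>space M. norm (S (N i) \<omega>) \<le> T \<and>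
      norm (X i \<omega> - xs + A *v emp_dev P \<xi> (N i) f \<omega> + l i *\<^sub>R g) \<le> e1 * (1 / sqrt (real (N i)) + \<bar>l i\<bar>)
      \<longrightarrow> \<bar>real (N i) * G (X i \<omega>)
        - (- (A *v S (N i) \<omega>) - c *\<^sub>R g) \<bullet> (H *v (- (A *v S (N i) \<omega>) - c *\<^sub>R g)) / 2\<bar> \<le> \<epsilon>"
    proof eventually_elim
      case (elim i)
      show ?case
      proof (intro ballI impI)
        fix \<omega> assume H': "norm (S (N i) \<omega>) \<le> T \<and>
          norm (X i \<omega> - xs + A *v emp_dev P \<xi> (N i) f \<omega> + l i *\<^sub>R g) \<le> e1 * (1 / sqrt (real (N i)) + \<bar>l i\<bar>)"
        define n where "n = sqrt (real (N i))"
        have n: "n \<ge> 1" "n\<^sup>2 = real (N i)" using elim by (auto simp: n_def)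
        define w where "w = - (A *v S (N i) \<omega>) - c *\<^sub>R g"
        define V where "V = n *\<^sub>R (X i \<omega> - xs)"
        define a where "a = n * l i"
        have a: "\<bar>a - c\<bar> < e2" using elim by (simp add: a_def n_def dist_real_def)
        have "V - w = n *\<^sub>R (X i \<omega> - xs + A *v emp_dev P \<xi> (N i) f \<omega> + l i *\<^sub>R g) - (a - c) *\<^sub>R g"
          by (simp add: V_def w_def a_def S_def n_def matrix_vector_mult_scaleR algebra_simps)
        then have "norm (V - w) \<le> norm (n *\<^sub>R (X i \<omega> - xs + A *v emp_dev P \<xi> (N i) f \<omega> + l i *\<^sub>R g))
            + norm ((a - c) *\<^sub>R g)"
          by (simp only: norm_triangle_ineq4)
        also have "\<dots> \<le> e1 * (2 + \<bar>c\<bar>) + e2 * norm g"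
        proof (intro add_mono)
          have "norm (n *\<^sub>R (X i \<omega> - xs + A *v emp_dev P \<xi> (N i) f \<omega> + l i *\<^sub>R g))
              \<le> n * (e1 * (1 / n + \<bar>l i\<bar>))"
            using H' n(1) by (simp add: n_def mult_left_mono)
          also have "\<dots> = e1 * (1 + \<bar>a\<bar>)" using n(1) by (simp add: a_def abs_mult field_simps)
          also have "\<dots> \<le> e1 * (2 + \<bar>c\<bar>)"
            using a e2(2) e1(1) by (intro mult_left_mono) auto
          finally show "norm (n *\<^sub>R (X i \<omega> - xs + A *v emp_dev P \<xi> (N i) f \<omega> + l i *\<^sub>R g)) \<le> e1 * (2 + \<bar>c\<bar>)" .
          show "norm ((a - c) *\<^sub>R g) \<le> e2 * norm g" using a by (simp add: mult_right_mono)
        qed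
        finally have Vw: "norm (V - w) \<le> \<epsilon>'" using e1(2) e2(3) by linarith
        have "norm w \<le> norm (A *v S (N i) \<omega>) + norm (c *\<^sub>R g)"
          unfolding w_def by (rule order.trans[OF norm_triangle_ineq4]) simp
        also have "\<dots> \<le> B * T + \<bar>c\<bar> * norm g"
          using H' B by (intro add_mono order.trans[OF B(2)] mult_left_mono) auto
        finally have w: "norm w \<le> D - 1" by (simp add: D_def)
        have "norm V \<le> norm (V - w) + norm w" by norm
        then have V: "norm V \<le> D" using Vw w \<epsilon>'(2) by linarith
        have Xv: "X i \<omega> = xs + (1 / n) *\<^sub>R V" using n(1) by (simp add: V_def)
        have "norm ((1 / n) *\<^sub>R V) \<le> D * (1 / n)" using V n(1) by (simp add: divide_right_mono)
        then have "norm ((1 / n) *\<^sub>R V) < \<eta>" using elim by (simp add: n_def)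
        from \<eta>(2)[OF this] have "n\<^sup>2 * \<bar>G (X i \<omega>) - ((1 / n) *\<^sub>R V) \<bullet> (H *v ((1 / n) *\<^sub>R V)) / 2\<bar>
            \<le> n\<^sup>2 * (\<epsilon> / (2 * D\<^sup>2) * (norm ((1 / n) *\<^sub>R V))\<^sup>2)"
          unfolding Xv by (intro mult_left_mono) auto
        also have "\<dots> = \<epsilon> / (2 * D\<^sup>2) * (norm V)\<^sup>2"
          using n(1) by (simp add: power_divide)
        also have "\<dots> \<le> \<epsilon> / (2 * D\<^sup>2) * D\<^sup>2"
          using V \<open>\<epsilon> > 0\<close> by (intro mult_left_mono power_mono) auto
        also have "\<dots> = \<epsilon> / 2" using \<open>D \<ge> 1\<close> by simp
        also have "n\<^sup>2 * \<bar>G (X i \<omega>) - ((1 / n) *\<^sub>R V) \<bullet> (H *v ((1 / n) *\<^sub>R V)) / 2\<bar>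
            = \<bar>n\<^sup>2 * G (X i \<omega>) - V \<bullet> (H *v V) / 2\<bar>"
        proof -
          have "n\<^sup>2 * \<bar>G (X i \<omega>) - ((1 / n) *\<^sub>R V) \<bullet> (H *v ((1 / n) *\<^sub>R V)) / 2\<bar>
            = \<bar>n\<^sup>2 * (G (X i \<omega>) - ((1 / n) *\<^sub>R V) \<bullet> (H *v ((1 / n) *\<^sub>R V)) / 2)\<bar>"
            by (simp add: abs_mult)
          also have "n\<^sup>2 * (G (X i \<omega>) - ((1 / n) *\<^sub>R V) \<bullet> (H *v ((1 / n) *\<^sub>R V)) / 2)
              = n\<^sup>2 * G (X i \<omega>) - V \<bullet> (H *v V) / 2"
            using n(1) by (simp add: matrix_vector_mult_scaleR right_diff_distrib power2_eq_square)
          finally show ?thesis .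
        qed
        finally have 1: "\<bar>n\<^sup>2 * G (X i \<omega>) - V \<bullet> (H *v V) / 2\<bar> \<le> \<epsilon> / 2" .
        have "\<bar>V \<bullet> (H *v V) / 2 - w \<bullet> (H *v w) / 2\<bar> \<le> h * norm (V - w) * (norm V + norm w)"
          using h by (intro quadratic_form_diff) auto
        also have "\<dots> \<le> h * \<epsilon>' * (2 * D)"
          using Vw V w h(1) \<epsilon>'(1) by (intro mult_mono) auto
        finally have 2: "\<bar>V \<bullet> (H *v V) / 2 - w \<bullet> (H *v w) / 2\<bar> \<le> \<epsilon> / 2" using \<epsilon>'(3) by linarith
        show "\<bar>real (N i) * G (X i \<omega>)
            - (- (A *v S (N i) \<omega>) - c *\<^sub>R g) \<bullet> (H *v (- (A *v S (N i) \<omega>) - c *\<^sub>R g)) / 2\<bar> \<le> \<epsilon>"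
          unfolding n(2)[symmetric] w_def[symmetric] using 1 2 by linarith
      qed
    qed
  qed
qed

text \<open>The penalty dominates the noise, so the displacement \<open>V\<close> is divided by
  \<open>a = sqrt n * l\<close>: \<open>U = V / a\<close> is close to \<open>- g\<close>, and
  \<open>n G\<close> is about \<open>a^2 * (g \<bullet> H g) / 2\<close>. The expansion alone does
  not make \<open>X - xs\<close> small, as \<open>l\<close> is not assumed to tend to 0 here;
  consistency brings \<open>X\<close> into the range of the Taylor estimate.\<close>

lemma scaled_excess_divergence:
  fixes X :: "'i \<Rightarrow> 'w \<Rightarrow> real^'d" and A :: "real^'m^'d" and H :: "real^'d^'d"
  assumes taylor: "\<And>\<epsilon>. \<epsilon> > 0 \<Longrightarrow> \<exists>\<eta>>0. \<forall>v. norm v < \<eta> \<longrightarrow>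
      \<bar>G (xs + v) - v \<bullet> (H *v v) / 2\<bar> \<le> \<epsilon> * (norm v)\<^sup>2"
    and exp: "\<And>\<epsilon> \<delta>. \<epsilon> > 0 \<Longrightarrow> \<delta> > 0 \<Longrightarrow>
      whp \<delta> F (\<lambda>i \<omega>. norm (X i \<omega> - xs + A *v emp_dev P \<xi> (N i) f \<omega> + l i *\<^sub>R g)
        \<le> \<epsilon> * (1 / sqrt (real (N i)) + \<bar>l i\<bar>))"
    and N: "filterlim N sequentially F"
    and cons: "\<And>\<epsilon> \<delta>. \<epsilon> > 0 \<Longrightarrow> \<delta> > 0 \<Longrightarrow> whp \<delta> F (\<lambda>i \<omega>. norm (X i \<omega> - xs) \<le> \<epsilon>)"
    and div: "filterlim (\<lambda>i. \<bar>sqrt (real (N i)) * l i\<bar>) at_top F"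
    and pos: "g \<bullet> (H *v g) > 0" and "\<delta> > 0"
  shows "whp \<delta> F (\<lambda>i \<omega>. b \<le> real (N i) * G (X i \<omega>))"
proof -
  define \<kappa> where "\<kappa> = g \<bullet> (H *v g) / 2"
  have "\<kappa> > 0" using pos by (simp add: \<kappa>_def)
  obtain B where B: "B > 0" "\<And>v. norm (A *v v) \<le> B * norm v"
    using matrix_vector_bound[of A] by blast
  obtain h where h: "h > 0" "\<And>v. norm (H *v v) \<le> h * norm v"
    using matrix_vector_bound[of H] by blast
  obtain T where T: "T > 0" "whp (\<delta>/3) sequentially (\<lambda>n \<omega>. norm (S n \<omega>) \<le> T)"
    using S_tight[of "\<delta>/3"] \<open>\<delta> > 0\<close> by auto
  define D where "D = norm g + 1"
  have "D \<ge> 1" by (simp add: D_def)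
  \<comment> \<open>Keeps the quadratic form at \<open>U\<close> within \<open>\<kappa> / 4\<close>
    of its value \<open>\<kappa>\<close> at \<open>- g\<close>; the Taylor error takes another
    \<open>\<kappa> / 4\<close>, which leaves \<open>\<kappa> / 2\<close>.\<close>
  define e where "e = min 1 (\<kappa> / (8 * h * D))"
  have e: "e > 0" "e \<le> 1" "h * e * (2 * D) \<le> \<kappa> / 4"
  proof -
    show "e > 0" "e \<le> 1" using h \<open>D \<ge> 1\<close> \<open>\<kappa> > 0\<close> by (auto simp: e_def)
    have "h * e * (2 * D) \<le> h * (\<kappa> / (8 * h * D)) * (2 * D)"
      using h \<open>D \<ge> 1\<close> by (intro mult_right_mono mult_left_mono) (auto simp: e_def)
    also have "\<dots> = \<kappa> / 4" using h \<open>D \<ge> 1\<close> by (simp add: field_simps)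
    finally show "h * e * (2 * D) \<le> \<kappa> / 4" .
  qed
  obtain \<eta> where \<eta>: "\<eta> > 0" "\<And>v. norm v < \<eta> \<Longrightarrow>
      \<bar>G (xs + v) - v \<bullet> (H *v v) / 2\<bar> \<le> \<kappa> / (4 * D\<^sup>2) * (norm v)\<^sup>2"
    using taylor[of "\<kappa> / (4 * D\<^sup>2)"] \<open>\<kappa> > 0\<close> \<open>D \<ge> 1\<close> by auto
  \<comment> \<open>A threshold for \<open>\<bar>a\<bar>\<close>. It makes the noise
    \<open>B * T\<close> at most \<open>e / 4 * \<bar>a\<bar>\<close>, and since
    \<open>\<bar>a\<bar> \<ge> Q \<ge> 1\<close> gives \<open>a^2 \<ge> Q\<close>, it lifts
    \<open>\<kappa> / 2 * a^2\<close> to at least \<open>b\<close>.\<close>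
  define Q where "Q = max (max 1 (4 * B * T / e)) (2 * \<bar>b\<bar> / \<kappa>)"
  have Q: "Q \<ge> 1" "B * T \<le> e / 4 * Q" "\<bar>b\<bar> \<le> \<kappa> / 2 * Q"
  proof -
    show "Q \<ge> 1" by (simp add: Q_def)
    have "4 * B * T / e \<le> Q" by (simp add: Q_def)
    then show "B * T \<le> e / 4 * Q" using e(1) by (simp add: field_simps)
    have "2 * \<bar>b\<bar> / \<kappa> \<le> Q" by (simp add: Q_def)
    then show "\<bar>b\<bar> \<le> \<kappa> / 2 * Q" using \<open>\<kappa> > 0\<close> by (simp add: field_simps)
  qed
  have "whp (\<delta>/3 + (\<delta>/3 + \<delta>/3)) F (\<lambda>i \<omega>. norm (S (N i) \<omega>) \<le> T \<and>
      norm (X i \<omega> - xs + A *v emp_dev P \<xi> (N i) f \<omega> + l i *\<^sub>R g) \<le> e / 4 * (1 / sqrt (real (N i)) + \<bar>l i\<bar>)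
      \<and> norm (X i \<omega> - xs) \<le> \<eta> / 2)"
    using \<open>\<delta> > 0\<close> e(1) \<eta>(1) by (intro whp_conj whp_filterlim[OF T(2) N] exp cons) auto
  moreover have "\<delta>/3 + (\<delta>/3 + \<delta>/3) = \<delta>" by simp
  ultimately have "whp \<delta> F (\<lambda>i \<omega>. norm (S (N i) \<omega>) \<le> T \<and>
      norm (X i \<omega> - xs + A *v emp_dev P \<xi> (N i) f \<omega> + l i *\<^sub>R g) \<le> e / 4 * (1 / sqrt (real (N i)) + \<bar>l i\<bar>)
      \<and> norm (X i \<omega> - xs) \<le> \<eta> / 2)" by simp
  then show ?thesis
  proof (rule whp_mono)
    have "\<forall>\<^sub>F i in F. N i \<ge> 1"
      using eventually_ge_at_top[of 1] N by (rule eventually_compose_filterlim)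
    moreover have "\<forall>\<^sub>F i in F. Q \<le> \<bar>sqrt (real (N i)) * l i\<bar>"
      using div by (simp add: filterlim_at_top)
    ultimately show "\<forall>\<^sub>F i in F. \<forall>\<omega>\<in>space M. norm (S (N i) \<omega>) \<le> T \<and>
      norm (X i \<omega> - xs + A *v emp_dev P \<xi> (N i) f \<omega> + l i *\<^sub>R g) \<le> e / 4 * (1 / sqrt (real (N i)) + \<bar>l i\<bar>)
      \<and> norm (X i \<omega> - xs) \<le> \<eta> / 2 \<longrightarrow> b \<le> real (N i) * G (X i \<omega>)"
    proof eventually_elim
      case (elim i)
      show ?case
      proof (intro ballI impI)
        fix \<omega> assume H': "norm (S (N i) \<omega>) \<le> T \<and>
          norm (X i \<omega> - xs + A *v emp_dev P \<xi> (N i) f \<omega> + l i *\<^sub>R g) \<le> e / 4 * (1 / sqrt (real (N i)) + \<bar>l i\<bar>)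
          \<and> norm (X i \<omega> - xs) \<le> \<eta> / 2"
        define n where "n = sqrt (real (N i))"
        have n: "n \<ge> 1" "n\<^sup>2 = real (N i)" using elim by (auto simp: n_def)
        define a where "a = n * l i"
        have a: "\<bar>a\<bar> \<ge> Q" using elim by (simp add: a_def n_def)
        then have "a \<noteq> 0" using Q(1) by auto
        define V where "V = n *\<^sub>R (X i \<omega> - xs)"
        define U where "U = (1 / a) *\<^sub>R V"
        have VU: "V = a *\<^sub>R U" using \<open>a \<noteq> 0\<close> by (simp add: U_def)
        have "a *\<^sub>R (U + g) = n *\<^sub>R (X i \<omega> - xs + A *v emp_dev P \<xi> (N i) f \<omega> + l i *\<^sub>R g) - A *v S (N i) \<omega>"
          unfolding scaleR_add_right VU[symmetric]
          by (simp add: V_def a_def S_def n_def matrix_vector_mult_scaleR algebra_simps)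
        then have "\<bar>a\<bar> * norm (U + g)
            \<le> norm (n *\<^sub>R (X i \<omega> - xs + A *v emp_dev P \<xi> (N i) f \<omega> + l i *\<^sub>R g)) + norm (A *v S (N i) \<omega>)"
          by (metis norm_scaleR norm_triangle_ineq4)
        also have "\<dots> \<le> e / 4 * (1 + \<bar>a\<bar>) + B * T"
        proof (intro add_mono)
          have "norm (n *\<^sub>R (X i \<omega> - xs + A *v emp_dev P \<xi> (N i) f \<omega> + l i *\<^sub>R g))
              \<le> n * (e / 4 * (1 / n + \<bar>l i\<bar>))"
            using H' n(1) by (simp add: n_def mult_left_mono)
          also have "\<dots> = e / 4 * (1 + \<bar>a\<bar>)" using n(1) by (simp add: a_def abs_mult field_simps)
          finally show "norm (n *\<^sub>R (X i \<omega> - xs + A *v emp_dev P \<xi> (N i) f \<omega> + l i *\<^sub>R g)) \<le> e / 4 * (1 + \<bar>a\<bar>)" .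
          show "norm (A *v S (N i) \<omega>) \<le> B * T"
            using H' B by (intro order.trans[OF B(2)] mult_left_mono) auto
        qed
        also have "\<dots> \<le> \<bar>a\<bar> * e"
        proof -
          have "e / 4 * (1 + \<bar>a\<bar>) \<le> e / 4 * (\<bar>a\<bar> + \<bar>a\<bar>)"
            using a Q(1) e(1) by (intro mult_left_mono) auto
          moreover have "B * T \<le> e / 4 * \<bar>a\<bar>"
            using a e(1) by (intro order.trans[OF Q(2)] mult_left_mono) auto
          ultimately have "e / 4 * (1 + \<bar>a\<bar>) + B * T \<le> e / 4 * (\<bar>a\<bar> + \<bar>a\<bar>) + e / 4 * \<bar>a\<bar>"
            by (rule add_mono)
          also have "\<dots> = 3 / 4 * (\<bar>a\<bar> * e)" by (simp add: algebra_simps)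
          also have "\<dots> \<le> 1 * (\<bar>a\<bar> * e)" using e(1) by (intro mult_right_mono) auto
          finally show ?thesis by simp
        qed
        finally have Ug: "norm (U - (- g)) \<le> e" using \<open>a \<noteq> 0\<close> by simp
        have "norm U \<le> norm (U - (- g)) + norm g" by norm
        then have U: "norm U \<le> D" using Ug e(2) by (simp add: D_def)
        have "\<bar>U \<bullet> (H *v U) / 2 - (- g) \<bullet> (H *v (- g)) / 2\<bar> \<le> h * norm (U - (- g)) * (norm U + norm (- g))"
          using h by (intro quadratic_form_diff) auto
        also have "\<dots> \<le> h * e * (2 * D)"
          using Ug U h(1) e(1) by (intro mult_mono) (auto simp: D_def)
        also have "(- g) \<bullet> (H *v (- g)) / 2 = \<kappa>"
          using matrix_vector_mult_scaleR[of H "-1" g] by (simp add: \<kappa>_def)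
        finally have qU: "U \<bullet> (H *v U) / 2 \<ge> 3 / 4 * \<kappa>" using e(3) by linarith
        have "(a / n) *\<^sub>R U = (1 / n) *\<^sub>R V" by (simp add: VU)
        also have "\<dots> = X i \<omega> - xs" using n(1) by (simp add: V_def)
        finally have aU: "(a / n) *\<^sub>R U = X i \<omega> - xs" .
        then have Xv: "X i \<omega> = xs + (a / n) *\<^sub>R U" by simp
        have "norm ((a / n) *\<^sub>R U) < \<eta>" unfolding aU using H' \<eta>(1) by linarith
        from \<eta>(2)[OF this] have "n\<^sup>2 * ((a / n) *\<^sub>R U \<bullet> (H *v ((a / n) *\<^sub>R U)) / 2
            - \<kappa> / (4 * D\<^sup>2) * (norm ((a / n) *\<^sub>R U))\<^sup>2) \<le> n\<^sup>2 * G (X i \<omega>)"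
          unfolding Xv by (intro mult_left_mono) auto
        also have "n\<^sup>2 * ((a / n) *\<^sub>R U \<bullet> (H *v ((a / n) *\<^sub>R U)) / 2
            - \<kappa> / (4 * D\<^sup>2) * (norm ((a / n) *\<^sub>R U))\<^sup>2)
            = a\<^sup>2 * (U \<bullet> (H *v U) / 2 - \<kappa> / (4 * D\<^sup>2) * (norm U)\<^sup>2)"
        proof -
          have 1: "(a / n) *\<^sub>R U \<bullet> (H *v ((a / n) *\<^sub>R U)) = (a / n)\<^sup>2 * (U \<bullet> (H *v U))"
            by (simp add: matrix_vector_mult_scaleR power2_eq_square)
          have 2: "(norm ((a / n) *\<^sub>R U))\<^sup>2 = (a / n)\<^sup>2 * (norm U)\<^sup>2"
            by (simp add: power_mult_distrib power_divide)
          have 3: "n\<^sup>2 * (a / n)\<^sup>2 = a\<^sup>2" using n(1) by (simp add: power_divide)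
          have "n\<^sup>2 * ((a / n)\<^sup>2 * p / 2 - k * ((a / n)\<^sup>2 * r)) = (n\<^sup>2 * (a / n)\<^sup>2) * (p / 2 - k * r)" for p k r
            by (simp add: algebra_simps)
          then show ?thesis unfolding 1 2 by (simp only: 3)
        qed
        finally have G: "a\<^sup>2 * (U \<bullet> (H *v U) / 2 - \<kappa> / (4 * D\<^sup>2) * (norm U)\<^sup>2) \<le> real (N i) * G (X i \<omega>)"
          by (simp add: n(2))
        have "\<kappa> / (4 * D\<^sup>2) * (norm U)\<^sup>2 \<le> \<kappa> / (4 * D\<^sup>2) * D\<^sup>2"
          using U \<open>\<kappa> > 0\<close> by (intro mult_left_mono power_mono) auto
        also have "\<dots> = \<kappa> / 4" using \<open>D \<ge> 1\<close> by simp
        finally have low: "\<kappa> / 2 \<le> U \<bullet> (H *v U) / 2 - \<kappa> / (4 * D\<^sup>2) * (norm U)\<^sup>2"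
          using qU by linarith
        have "Q \<le> Q * Q" using Q(1) by simp
        also have "\<dots> \<le> \<bar>a\<bar> * \<bar>a\<bar>" using a Q(1) by (intro mult_mono) auto
        finally have "Q \<le> a\<^sup>2" by (simp add: power2_eq_square)
        have "b \<le> \<kappa> / 2 * Q" using Q(3) by linarith
        also have "\<dots> = Q * (\<kappa> / 2)" by simp
        also have "\<dots> \<le> a\<^sup>2 * (U \<bullet> (H *v U) / 2 - \<kappa> / (4 * D\<^sup>2) * (norm U)\<^sup>2)"
          using \<open>Q \<le> a\<^sup>2\<close> low \<open>\<kappa> > 0\<close> by (intro mult_mono) auto
        finally show "b \<le> real (N i) * G (X i \<omega>)" using G by linarith
      qed
    qed
  qed
qed

end

lemma emp_dev_linear:
  fixes A :: "real^'m^'d" and g :: "'x \<Rightarrow> real^'m"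
  assumes "integrable P g"
  shows "emp_dev P \<xi> n (\<lambda>z. A *v g z) \<omega> = A *v emp_dev P \<xi> n g \<omega>"
proof -
  have "(\<integral>z. A *v g z \<partial>P) = A *v (\<integral>z. g z \<partial>P)"
    using assms by (intro integral_bounded_linear matrix_vector_mul_bounded_linear)
  moreover have "(\<Sum>i<n. A *v g (\<xi> i \<omega>)) = A *v (\<Sum>i<n. g (\<xi> i \<omega>))"
    by (simp add: linear_sum[OF matrix_vector_mul_linear])
  ultimately show ?thesis
    by (simp add: emp_dev_def matrix_vector_mult_scaleR matrix_vector_mult_diff_distrib)
qed

theorem theorem5:
  fixes M :: "'w measure" and P :: "'x measure" and \<xi> :: "nat \<Rightarrow> 'w \<Rightarrow> 'x"
    and \<psi> :: "real^'d \<Rightarrow> real^'m \<Rightarrow> real" and R :: "real^'d \<Rightarrow> real"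
    and Z \<G> :: "real^'d \<Rightarrow> real"
    and \<X> :: "(real^'d) set" and xs :: "real^'d" and \<theta>s :: "real^'m"
    and \<theta>h :: "nat \<Rightarrow> 'w \<Rightarrow> real^'m" and IF :: "'x \<Rightarrow> real^'m"
    and xEO :: "nat \<Rightarrow> 'w \<Rightarrow> real^'d" and xReg :: "nat \<Rightarrow> real \<Rightarrow> 'w \<Rightarrow> real^'d"
    and \<Lambda> :: "real set"
    and H :: "real^'d^'d" and C :: "real^'m^'d" and K :: "real^'d"
    and L :: "(nat \<times> real) filter"
  assumes M: "prob_space M" and P: "prob_space P" and iid: "iid_sample M P \<xi>"
    and Z: "Z = (\<lambda>x. \<psi> x \<theta>s)"
    and G: "\<G> = (\<lambda>x. Z x - Z xs)"
    and H: "H = hessian (\<lambda>x. \<psi> x \<theta>s) xs"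
    and C: "C = cross_derivative \<psi> xs \<theta>s"
    and K: "K = - (matrix_inv H *v gradient R xs)"
    and L: "L = sequentially \<times>\<^sub>F inf (nhds 0) (principal \<Lambda>)"
    and xs_opt: "is_arg_min Z (\<lambda>x. x \<in> \<X>) xs"
    and xs_interior: "xs \<in> interior \<X>"
    and \<theta>h_measurable: "\<And>n. \<theta>h n \<in> borel_measurable M"
    and xEO_measurable: "\<And>n. xEO n \<in> borel_measurable M"
    and xReg_measurable: "\<And>n l. l \<in> \<Lambda> \<Longrightarrow> xReg n l \<in> borel_measurable M"
    and xEO_argmin: "\<And>n \<omega>. n \<ge> 1 \<Longrightarrow> \<omega> \<in> space M \<Longrightarrow>
           is_arg_min (\<lambda>x. \<psi> x (\<theta>h n \<omega>)) (\<lambda>x. x \<in> \<X>) (xEO n \<omega>)"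
    and xReg_argmin: "\<And>n l \<omega>. n \<ge> 1 \<Longrightarrow> l \<in> \<Lambda> \<Longrightarrow> \<omega> \<in> space M \<Longrightarrow>
           is_arg_min (\<lambda>x. \<psi> x (\<theta>h n \<omega>) + l * R x) (\<lambda>x. x \<in> \<X>) (xReg n l \<omega>)"
    and xEO_consistent: "small_o_p M (\<lambda>n \<omega>. xEO n \<omega> - xs) (\<lambda>_. 1) sequentially"
    and xReg_consistent: "small_o_p M (\<lambda>(n, l) \<omega>. xReg n l \<omega> - xs) (\<lambda>_. 1) L"
    and A_stationary: "gradient (\<lambda>x. \<psi> x \<theta>s) xs = 0"
    and A_differentiable: "\<forall>\<^sub>F (x, \<theta>) in nhds (xs, \<theta>s). (\<lambda>y. \<psi> y \<theta>) differentiable (at x)"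
    and A_smooth: "cont_diff_at (\<lambda>(x, \<theta>). gradient (\<lambda>y. \<psi> y \<theta>) x) (xs, \<theta>s)"
    and A_invertible: "invertible H"
    and B: "twice_cont_diff R"
    and C_covariance: "finite_covariance P IF"
    and C_expansion: "small_o_p M (\<lambda>n \<omega>. \<theta>h n \<omega> - \<theta>s - emp_dev P \<xi> n IF \<omega>)
           (\<lambda>n. 1 / sqrt (real n)) sequentially"
  shows "small_o_p M
           (\<lambda>(n, l) \<omega>. (xReg n l \<omega> - xs)
              - (- emp_dev P \<xi> n (\<lambda>z. (matrix_inv H ** C) *v IF z) \<omega>
                 - l *\<^sub>R (matrix_inv H *v gradient R xs)))
           (\<lambda>(n, l). 1 / sqrt (real n) + \<bar>l\<bar>) L \<and>
         ((\<forall>x\<in>\<X>. twice_differentiable_at Z x) \<and> gradient Z xs = 0 \<and>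
          (\<forall>v. 0 \<le> v \<bullet> (hessian Z xs *v v)) \<and> K \<bullet> (hessian Z xs *v K) \<noteq> 0 \<longrightarrow>
            (\<forall>l. (\<forall>n. l n \<in> \<Lambda>) \<and> l \<longlonglongrightarrow> 0 \<longrightarrow>
               asymptotically_ssd M (\<lambda>n \<omega>. real n * \<G> (xEO n \<omega>))
                 (\<lambda>n \<omega>. real n * \<G> (xReg n (l n) \<omega>))))"
proof (intro conjI impI allI)
  interpret iid_finite_covariance M P \<xi> IF
    using M P iid C_covariance
    by (simp add: iid_finite_covariance_def iid_finite_covariance_axioms_def)

  \<comment> \<open>Expansion of the regularised minimiser\<close>
  define A where "A = matrix_inv H ** C"
  define g where "g = matrix_inv H *v gradient R xs"
  \<comment> \<open>The unregularised problem is the case \<open>l = 0\<close>, so one local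
    expansion serves both minimisers.\<close>
  define opt where "opt \<theta> l x \<longleftrightarrow> is_arg_min (\<lambda>y. \<psi> y \<theta> + l * R y) (\<lambda>y. y \<in> \<X>) x" for \<theta> l x
  have local: "\<exists>\<eta>>0. \<forall>x \<theta> l. norm (x - xs) < \<eta> \<longrightarrow> norm (\<theta> - \<theta>s) < \<eta> \<longrightarrow> opt \<theta> l x \<longrightarrow>
      norm (x - xs + A *v (\<theta> - \<theta>s) + l *\<^sub>R g) \<le> \<epsilon> * (norm (\<theta> - \<theta>s) + \<bar>l\<bar>)" if "\<epsilon> > 0" for \<epsilon>
    unfolding opt_def A_def g_def
    by (rule argmin_expansion[OF H C xs_interior A_stationary A_differentiable A_smooth A_invertible B that])
      (blast)
  have \<theta>: "whp \<delta> sequentially (\<lambda>n \<omega>. norm (\<theta>h n \<omega> - \<theta>s - emp_dev P \<xi> n IF \<omega>) \<le> \<epsilon> * (1 / sqrt (real n)))"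
    if "\<epsilon> > 0" "\<delta> > 0" for \<epsilon> \<delta>
  proof (rule small_o_p_imp_whp[OF C_expansion _ that])
    show "\<forall>\<^sub>F n in sequentially. (\<lambda>\<omega>. \<theta>h n \<omega> - \<theta>s - emp_dev P \<xi> n IF \<omega>) \<in> borel_measurable M
        \<and> 1 / sqrt (real n) > 0"
      using \<theta>h_measurable by (intro eventually_sequentiallyI[of 1]) auto
  qed
  have cons_EO: "whp \<delta> sequentially (\<lambda>n \<omega>. norm (xEO n \<omega> - xs) \<le> \<epsilon>)" if "\<epsilon> > 0" "\<delta> > 0" for \<epsilon> \<delta>
    using small_o_p_imp_whp[OF xEO_consistent _ that] xEO_measurable by simp
  have L_fst: "filterlim fst sequentially L" unfolding L by (rule filterlim_fst)
  have L_\<Lambda>: "\<forall>\<^sub>F i in L. snd i \<in> \<Lambda>"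
  proof -
    have "\<forall>\<^sub>F l in inf (nhds 0) (principal \<Lambda>). l \<in> \<Lambda>" by (simp add: eventually_inf_principal)
    then show ?thesis unfolding L by (rule eventually_compose_filterlim) (rule filterlim_snd)
  qed
  have L_1: "\<forall>\<^sub>F i in L. fst i \<ge> 1"
    using eventually_ge_at_top[of 1] L_fst by (rule eventually_compose_filterlim)
  have cons_Reg: "whp \<delta> L (\<lambda>i \<omega>. norm (xReg (fst i) (snd i) \<omega> - xs) \<le> \<epsilon>)" if "\<epsilon> > 0" "\<delta> > 0" for \<epsilon> \<delta>
  proof -
    have "\<forall>\<^sub>F i in L. (\<lambda>\<omega>. xReg (fst i) (snd i) \<omega> - xs) \<in> borel_measurable M \<and> (1::real) > 0"
      using L_\<Lambda> by eventually_elim (use xReg_measurable in auto)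
    then show ?thesis
      using small_o_p_imp_whp[OF xReg_consistent _ that] by (simp add: case_prod_unfold)
  qed
  have exp_Reg: "whp \<delta> L (\<lambda>i \<omega>. norm (xReg (fst i) (snd i) \<omega> - xs + A *v emp_dev P \<xi> (fst i) IF \<omega> + snd i *\<^sub>R g)
      \<le> \<epsilon> * (1 / sqrt (real (fst i)) + \<bar>snd i\<bar>))" if "\<epsilon> > 0" "\<delta> > 0" for \<epsilon> \<delta>
  proof (rule argmin_expansion_whp[OF local \<theta> L_fst cons_Reg _ that])
    show "\<forall>\<^sub>F i in L. \<forall>\<omega>\<in>space M. opt (\<theta>h (fst i) \<omega>) (snd i) (xReg (fst i) (snd i) \<omega>)"
      using L_\<Lambda> L_1 by eventually_elim (use xReg_argmin in \<open>auto simp: opt_def\<close>)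
  qed
  show "small_o_p M
           (\<lambda>(n, l) \<omega>. (xReg n l \<omega> - xs)
              - (- emp_dev P \<xi> n (\<lambda>z. (matrix_inv H ** C) *v IF z) \<omega>
                 - l *\<^sub>R (matrix_inv H *v gradient R xs)))
           (\<lambda>(n, l). 1 / sqrt (real n) + \<bar>l\<bar>) L"
  proof (rule whp_imp_small_o_p)
    show "\<forall>\<^sub>F i in L. (case i of (n, l) \<Rightarrow> 1 / sqrt (real n) + \<bar>l\<bar>) > 0"
      using L_1 by eventually_elim (auto simp: add_pos_nonneg)
    fix \<epsilon> \<delta> :: real assume "\<epsilon> > 0" "\<delta> > 0"
    from exp_Reg[OF this] show "whp \<delta> L (\<lambda>i \<omega>. norm ((case i of (n, l) \<Rightarrow> \<lambda>\<omega>. (xReg n l \<omega> - xs)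
              - (- emp_dev P \<xi> n (\<lambda>z. (matrix_inv H ** C) *v IF z) \<omega>
                 - l *\<^sub>R (matrix_inv H *v gradient R xs))) \<omega>)
        \<le> \<epsilon> * (case i of (n, l) \<Rightarrow> 1 / sqrt (real n) + \<bar>l\<bar>))"
      by (simp add: case_prod_unfold emp_dev_linear[OF integrable_f] A_def g_def algebra_simps)
  qed

  \<comment> \<open>Dominance of the scaled excesses\<close>
  fix l :: "nat \<Rightarrow> real"
  assume hyps: "(\<forall>x\<in>\<X>. twice_differentiable_at Z x) \<and> gradient Z xs = 0 \<and>
          (\<forall>v. 0 \<le> v \<bullet> (hessian Z xs *v v)) \<and> K \<bullet> (hessian Z xs *v K) \<noteq> 0"
    and l: "(\<forall>n. l n \<in> \<Lambda>) \<and> l \<longlonglongrightarrow> 0"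
  have hess: "hessian Z xs = H" by (simp add: H Z)
  have "xs \<in> \<X>" using xs_interior interior_subset by blast
  define q where "q v = v \<bullet> (H *v v) / 2" for v
  have q_nonneg: "q v \<ge> 0" for v using hyps by (simp add: q_def hess)
  have q_minus: "q (- v) = q v" for v
    using matrix_vector_mult_scaleR[of H "-1" v] by (simp add: q_def)
  \<comment> \<open>The parallelogram identity: the mean of \<open>q (u + v)\<close> and
    \<open>q (u - v)\<close> is \<open>q u + q v\<close>, and positive semidefiniteness gives
    \<open>q v \<ge> 0\<close>.\<close>
  have q_mid: "q u \<le> (q (u + v) + q (u - v)) / 2" for u v
  proof -
    have "(q (u + v) + q (u - v)) / 2 = q u + q v"
      by (simp add: q_def matrix_vector_right_distrib matrix_vector_mult_diff_distrib
          inner_add_left inner_add_right inner_diff_left inner_diff_right field_simps)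
    then show ?thesis using q_nonneg[of v] by simp
  qed
  have q_cont: "continuous_on UNIV (\<lambda>y. q (k y))" if "continuous_on UNIV k" for k :: "real^'m \<Rightarrow> real^'d"
    unfolding q_def using that
    by (intro continuous_intros matrix_vector_mult_linear_continuous_on continuous_on_compose2[of UNIV "\<lambda>v. H *v v"]) auto
  have g_pos: "g \<bullet> (H *v g) > 0"
  proof -
    have "K = - g" by (simp add: K g_def)
    then have "q K = q g" using q_minus by simp
    then have "K \<bullet> (H *v K) = g \<bullet> (H *v g)" by (simp add: q_def)
    moreover have "K \<bullet> (H *v K) \<noteq> 0" "K \<bullet> (H *v K) \<ge> 0" using hyps by (simp_all add: hess)
    ultimately show ?thesis by linarith
  qed
  have taylor: "\<exists>\<eta>>0. \<forall>v. norm v < \<eta> \<longrightarrow> \<bar>\<G> (xs + v) - v \<bullet> (H *v v) / 2\<bar> \<le> \<epsilon> * (norm v)\<^sup>2"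
    if "\<epsilon> > 0" for \<epsilon>
  proof -
    have "twice_differentiable_at Z xs" "gradient Z xs = 0" using hyps \<open>xs \<in> \<X>\<close> by auto
    then show ?thesis
      by (rule second_order_expansion[OF _ _ that]) (auto simp: hess G)
  qed
  have \<G>_nonneg: "\<G> x \<ge> 0" if "x \<in> \<X>" for x
    using xs_opt that by (auto simp: G is_arg_min_def not_less)
  define QA where "QA n \<omega> = real n * \<G> (xEO n \<omega>)" for n \<omega>
  define QB where "QB n \<omega> = real n * \<G> (xReg n (l n) \<omega>)" for n \<omega>
  \<comment> \<open>Optimality, and with it membership in \<open>\<X>\<close>, is assumed from
    \<open>n = 1\<close> on; at \<open>n = 0\<close> the factor \<open>real n\<close> makes the
    product 0.\<close>
  have scaled_measurable: "(\<lambda>\<omega>. real n * \<G> (X \<omega>)) \<in> borel_measurable M"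
    if "X \<in> borel_measurable M" "n \<ge> 1 \<Longrightarrow> \<forall>\<omega>\<in>space M. X \<omega> \<in> \<X>" for X n
  proof (cases "n \<ge> 1")
    case True
    then have "(\<lambda>\<omega>. Z (X \<omega>)) \<in> borel_measurable M"
      using that hyps by (intro measurable_comp_differentiable[of X M \<X> Z]) auto
    then show ?thesis by (simp add: G)
  next
    case False
    then have "n = 0" by simp
    then show ?thesis by simp
  qed
  have QA_meas: "QA n \<in> borel_measurable M" for n
    unfolding QA_def using xEO_argmin by (intro scaled_measurable xEO_measurable) (auto simp: is_arg_min_def)
  have QB_meas: "QB n \<in> borel_measurable M" for n
    unfolding QB_def using xReg_argmin l
    by (intro scaled_measurable xReg_measurable) (auto simp: is_arg_min_def)
  have QB_nonneg: "QB n \<omega> \<ge> 0" if "\<omega> \<in> space M" for n \<omega>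
  proof (cases "n \<ge> 1")
    case True
    then have "xReg n (l n) \<omega> \<in> \<X>" using xReg_argmin l that by (auto simp: is_arg_min_def)
    then show ?thesis by (simp add: QB_def \<G>_nonneg)
  next
    case False
    then have "n = 0" by simp
    then show ?thesis by (simp add: QB_def)
  qed

  have lim_A: "whp \<delta> sequentially (\<lambda>n \<omega>. \<bar>QA (r n) \<omega> - q (- (A *v S (r n) \<omega>))\<bar> \<le> \<epsilon>)"
    if r: "strict_mono r" and "\<epsilon> > 0" "\<delta> > 0" for r \<epsilon> \<delta>
  proof -
    note r' = filterlim_subseq[OF r]
    have exp: "whp \<delta> sequentially (\<lambda>n \<omega>. norm (xEO (r n) \<omega> - xs + A *v emp_dev P \<xi> (r n) IF \<omega> + 0 *\<^sub>R g)
      \<le> \<epsilon> * (1 / sqrt (real (r n)) + \<bar>0\<bar>))" if "\<epsilon> > 0" "\<delta> > 0" for \<epsilon> \<delta>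
    proof (rule argmin_expansion_whp[OF local \<theta> r' whp_filterlim[OF cons_EO r'] _ that])
      show "\<forall>\<^sub>F n in sequentially. \<forall>\<omega>\<in>space M. opt (\<theta>h (r n) \<omega>) 0 (xEO (r n) \<omega>)"
        using eventually_compose_filterlim[OF eventually_ge_at_top[of 1] r']
        by eventually_elim (use xEO_argmin in \<open>auto simp: opt_def\<close>)
    qed
    show ?thesis
      using scaled_excess_limit[OF taylor exp r' _ that(2,3), where c=0] by (simp add: QA_def q_def)
  qed

  show "asymptotically_ssd M (\<lambda>n \<omega>. real n * \<G> (xEO n \<omega>)) (\<lambda>n \<omega>. real n * \<G> (xReg n (l n) \<omega>))"
    unfolding asymptotically_ssd_def QA_def[abs_def, symmetric] QB_def[abs_def, symmetric]
  proof (intro allI impI)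
    fix r s W0 W1
    assume rs: "strict_mono r \<and> strict_mono s \<and> weakly_to M (QA \<circ> r) W0 \<and> weakly_to M (QB \<circ> s) W1"
    have not_minus: "W1 \<noteq> Minus_Inf"
    proof
      assume "W1 = Minus_Inf"
      then have "(\<lambda>n. prob {\<omega> \<in> space M. (QB \<circ> s) n \<omega> < 0}) \<longlonglongrightarrow> 1" using rs by simp
      moreover have "prob {\<omega> \<in> space M. (QB \<circ> s) n \<omega> < 0} = 0" for n
      proof -
        have "{\<omega> \<in> space M. (QB \<circ> s) n \<omega> < 0} = {}"
          using QB_nonneg by (auto simp: not_less[symmetric])
        then show ?thesis by (simp only: measure_empty)
      qed
      ultimately have "(\<lambda>n. 0 :: real) \<longlonglongrightarrow> 1" by (simp only:)
      then show False by (simp add: LIMSEQ_const_iff)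
    qed
    \<comment> \<open>The unregularised scaled excess is tight: for large \<open>n\<close> it
      exceeds \<open>D + 1\<close> with probability at most 1/2, which excludes convergence to
      infinity.\<close>
    have not_plus: "W0 \<noteq> Plus_Inf"
    proof
      assume W0: "W0 = Plus_Inf"
      obtain T where T: "T > 0" "whp (1/4) sequentially (\<lambda>n \<omega>. norm (S n \<omega>) \<le> T)"
        using S_tight[of "1/4"] by auto
      have "compact ((\<lambda>y. q (- (A *v y))) ` cball 0 T)"
        by (intro compact_continuous_image continuous_on_subset[OF q_cont]) (auto intro!: continuous_intros matrix_vector_mult_linear_continuous_on)
      then obtain D where D: "\<And>y. norm y \<le> T \<Longrightarrow> \<bar>q (- (A *v y))\<bar> \<le> D"
        using compact_imp_bounded by (fastforce simp: bounded_iff)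
      have "whp (1/4 + 1/4) sequentially (\<lambda>n \<omega>. norm (S (r n) \<omega>) \<le> T \<and>
          \<bar>QA (r n) \<omega> - q (- (A *v S (r n) \<omega>))\<bar> \<le> 1)"
        using rs by (intro whp_conj lim_A whp_filterlim[OF T(2) filterlim_subseq]) auto
      then have "whp (1/4 + 1/4) sequentially (\<lambda>n \<omega>. QA (r n) \<omega> \<le> D + 1)"
      proof (rule whp_mono, intro always_eventually allI ballI impI)
        fix n \<omega>
        assume "norm (S (r n) \<omega>) \<le> T \<and> \<bar>QA (r n) \<omega> - q (- (A *v S (r n) \<omega>))\<bar> \<le> 1"
        then show "QA (r n) \<omega> \<le> D + 1" using D[of "S (r n) \<omega>"] by linarith
      qed
      from whp_prob_le[OF this]
      have "\<forall>\<^sub>F n in sequentially. prob {\<omega> \<in> space M. (QA \<circ> r) n \<omega> > D + 1} \<le> 1/2"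
        by (simp add: not_le)
      moreover have "(\<lambda>n. prob {\<omega> \<in> space M. (QA \<circ> r) n \<omega> > D + 1}) \<longlonglongrightarrow> 1"
        using rs W0 by simp
      ultimately have "1 \<le> (1/2 :: real)" by (intro tendsto_upperbound) auto
      then show False by simp
    qed
    show "limit_ssd W0 W1"
    proof (cases W1)
      case Plus_Inf
      then show ?thesis by (cases W0) auto
    next
      case Minus_Inf
      then show ?thesis using not_minus by simp
    next
      case W1: (Law w1)
      show ?thesis
      proof (cases W0)
        case Plus_Inf
        then show ?thesis using not_plus by simp
      next
        case Minus_Inf
        then show ?thesis using W1 by simp
      next
        case W0: (Law w0)
        have w0: "real_distribution w0" "weak_conv_m (\<lambda>n. distr M borel (QA (r n))) w0"
          and w1: "real_distribution w1" "weak_conv_m (\<lambda>n. distr M borel (QB (s n))) w1"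
          using rs W0 W1 by (simp_all add: o_def)
        \<comment> \<open>The given penalties trace a path along which the joint filter
          \<open>L\<close> is followed, so every statement along \<open>L\<close> specialises to
          each subsequence of sample sizes.\<close>
        have along: "filterlim (\<lambda>n. (t n, l (t n))) L sequentially" if t: "strict_mono t" for t
        proof -
          have "filterlim (\<lambda>n. l (t n)) (inf (nhds 0) (principal \<Lambda>)) sequentially"
            using l LIMSEQ_subseq_LIMSEQ[of l 0 t] t
            by (auto simp: filterlim_inf filterlim_principal o_def)
          then show ?thesis unfolding L by (intro filterlim_Pair filterlim_subseq t)
        qed
        have exp: "whp \<delta> sequentially (\<lambda>n \<omega>. norm (xReg (t n) (l (t n)) \<omega> - xs
            + A *v emp_dev P \<xi> (t n) IF \<omega> + l (t n) *\<^sub>R g) \<le> \<epsilon> * (1 / sqrt (real (t n)) + \<bar>l (t n)\<bar>))"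
          if "strict_mono t" "\<epsilon> > 0" "\<delta> > 0" for t \<epsilon> \<delta>
          using whp_filterlim[OF exp_Reg[OF that(2,3)] along[OF that(1)]] by simp
        have "\<not> filterlim (\<lambda>n. \<bar>sqrt (real (s n)) * l (s n)\<bar>) at_top sequentially"
        proof
          assume div: "filterlim (\<lambda>n. \<bar>sqrt (real (s n)) * l (s n)\<bar>) at_top sequentially"
          have s: "strict_mono s" using rs by simp
          have cons: "whp \<delta> sequentially (\<lambda>n \<omega>. norm (xReg (s n) (l (s n)) \<omega> - xs) \<le> \<epsilon>)"
            if "\<epsilon> > 0" "\<delta> > 0" for \<epsilon> \<delta>
            using whp_filterlim[OF cons_Reg[OF that] along[OF s]] by simp
          have "whp \<delta> sequentially (\<lambda>n \<omega>. b \<le> QB (s n) \<omega>)" if "\<delta> > 0" for b \<delta>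
            unfolding QB_def
            by (rule scaled_excess_divergence[OF taylor exp[OF s] filterlim_subseq[OF s] cons div g_pos that])
          then show False
            using w1 by (intro divergent_not_weakly_convergent[of "\<lambda>n. QB (s n)" w1] QB_meas)
        qed
        \<comment> \<open>Thinning out \<open>s\<close> further fixes the constant \<open>c\<close>
          and keeps the weak limit \<open>w1\<close>.\<close>
        then obtain t c where t: "strict_mono t" and c: "(\<lambda>n. sqrt (real (s (t n))) * l (s (t n))) \<longlonglongrightarrow> c"
          using convergent_subsequence_if_not_divergent[of "\<lambda>n. sqrt (real (s n)) * l (s n)"] by metis
        have st: "strict_mono (s \<circ> t)" using rs t by (simp add: strict_mono_o)
        have lim_B: "whp \<delta> sequentially
            (\<lambda>n \<omega>. \<bar>QB ((s \<circ> t) n) \<omega> - q (- (A *v S ((s \<circ> t) n) \<omega>) - c *\<^sub>R g)\<bar> \<le> \<epsilon>)"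
          if "\<epsilon> > 0" "\<delta> > 0" for \<epsilon> \<delta>
          using scaled_excess_limit[OF taylor exp[OF st] filterlim_subseq[OF st] _ that, of c] c
          by (simp add: QB_def q_def)
        have w1': "weak_conv_m (\<lambda>n. distr M borel (QB ((s \<circ> t) n))) w1"
          using w1(2) t LIMSEQ_subseq_LIMSEQ unfolding weak_conv_m_def weak_conv_def
          by (fastforce simp: o_def)
        let ?q0 = "\<lambda>y. q (- (A *v y))" and ?q1 = "\<lambda>y. q (- (A *v y) - c *\<^sub>R g)"
        have q01: "continuous_on UNIV ?q0" "continuous_on UNIV ?q1"
          by (intro q_cont continuous_intros matrix_vector_mult_linear_continuous_on)+
        then have [measurable]: "?q0 \<in> borel_measurable borel" "?q1 \<in> borel_measurable borel"
          by (auto intro: borel_measurable_continuous_onI)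
        have "ssd w0 w1"
        proof (rule ssd_limit_laws[of r "s \<circ> t" w0 w1 ?q0 ?q1])
          \<comment> \<open>As \<open>q\<close> is even, \<open>?q1 (- y)\<close> equals
            \<open>q (- (A *v y) + c *\<^sub>R g)\<close>, so \<open>?q1\<close> evaluates
            \<open>q\<close> at two points symmetric about \<open>- (A *v y)\<close>.\<close>
          show "?q0 y \<le> (?q1 y + ?q1 (- y)) / 2" for y
          proof -
            have "A *v (- y) = - (A *v y)"
              using matrix_vector_mult_scaleR[of A "-1" y] by simp
            then have "?q1 (- y) = q (A *v y - c *\<^sub>R g)" by simp
            also have "\<dots> = q (- (A *v y) + c *\<^sub>R g)"
              using q_minus[of "A *v y - c *\<^sub>R g"] by simp
            finally show ?thesis using q_mid[of "- (A *v y)" "c *\<^sub>R g"] by simp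
          qed
          fix h :: "real \<Rightarrow> real" and B
          assume h: "uniformly_continuous_on UNIV h" and bd: "\<And>x. \<bar>h x\<bar> \<le> B"
          show "(\<lambda>n. expectation (\<lambda>\<omega>. h (?q0 (S (r n) \<omega>)))) \<longlonglongrightarrow> (\<integral>x. h x \<partial>w0)"
            using rs by (intro weak_limit_expectation[OF w0 h bd QA_meas] lim_A) auto
          show "(\<lambda>n. expectation (\<lambda>\<omega>. h (?q1 (S ((s \<circ> t) n) \<omega>)))) \<longlonglongrightarrow> (\<integral>x. h x \<partial>w1)"
            by (intro weak_limit_expectation[OF w1(1) w1' h bd QB_meas] lim_B) auto
        qed (use rs st w0 w1 q01 q_nonneg in auto)
        then show ?thesis by (simp add: W0 W1)
      qed
    qed
  qed
qed

end
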